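(* Let $H\subset X\subset H'$ be nested Hilbert spaces, let $X_0\subset X$ be a subspace of finite codimension with $X$-orthogonal projection $\Pi_0:X\to X_0$, let $J:H\to\mathbb{R}$ be a smooth energy, let $\mathcal{M}=\{\Phi(\mathbf{p}):\mathbf{p}\in\mathcal{P}\subset\mathbb{R}^n\}\subset H$ be a smooth manifold given as the graph of a map $\Phi$, let $u_0\in H$ denote the initial data, and let $\mathcal{C}_{X_0}$ be the class of gradients defined in the context. Suppose that $J$ and $\mathcal{M}$ satisfy, for the gradient $\mathcal{G}=\Pi_0$ and a parameter $\delta>0$, the spectral hypotheses (H0)–(H4) in the context, and in addition: (EH1) $\mathcal{M}\subset u_0+X_0$; (EA) there exist $\mu_e,\gamma_e>0$ such that $\langle(\nabla_X^2J(\phi)+\gamma_e)v,v\rangle_X\ge\mu_e\|v\|_H^2$ for all $v\in H\cap X_0$ and all $\phi\in\mathcal{M}$. Then there exists a projection $\Pi_{\mathcal{M}}$ onto $\mathcal{M}$, with complement $\tilde\Pi_{\mathcal{M}}:=I-\Pi_{\mathcal{M}}$, defined within an $H$-neighborhood of $\mathcal{M}$ of size $\eta>0$, for which the following (A1) and (A2) are valid. (A1) There is a constant $c_1>0$ such that $\|\tilde\Pi_{\mathcal{M}}u\|_H\le c_1\,d_H(u,\mathcal{M})$ for all $u$ in the neighborhood. (A2) For all $u$ with $d_H(u,\mathcal{M})<\eta$, $$J(u)=J(\Pi_{\mathcal{M}}u)+\langle\nabla_XJ(\Pi_{\mathcal{M}}u),\tilde\Pi_{\mathcal{M}}u\rangle_X+\tfrac12\langle\nabla_X^2J(\Pi_{\mathcal{M}}u)\tilde\Pi_{\mathcal{M}}u,\tilde\Pi_{\mathcal{M}}u\rangle_X+\mathcal{N}_E(\tilde\Pi_{\mathcal{M}}u),$$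 where, for some $\delta_2,c_2>0$, some $\mu_2>0$, and some $\rho>2$, $$|\langle\nabla_XJ(\Pi_{\mathcal{M}}u),\tilde\Pi_{\mathcal{M}}u\rangle_X|\le\delta_2\|\tilde\Pi_{\mathcal{M}}u\|_H,\qquad \tfrac12\langle\nabla_X^2J(\Pi_{\mathcal{M}}u)\tilde\Pi_{\mathcal{M}}u,\tilde\Pi_{\mathcal{M}}u\rangle_X\ge\mu_2\|\tilde\Pi_{\mathcal{M}}u\|_H^2,$$ $$|\mathcal{N}_E(\tilde\Pi_{\mathcal{M}}u)|\le c_2\|\tilde\Pi_{\mathcal{M}}u\|_H^{\rho}.$$ Moreover, define $$\eta^*:=\min\Big\{\eta,\tfrac1{c_1}\Big(\frac{\mu_2}{2c_2}\Big)^{\frac1{\rho-2}}\Big\},\qquad \eta_*:=\frac{\delta_2}{\mu_2}+\sqrt{\frac{\delta_2^2}{\mu_2^2}+2\,\frac{\delta_0+\delta_1}{\mu_2}}.$$ Assume that $|J(u_1)-J(u_2)|\le\delta_0$ for all $u_1,u_2\in\mathcal{M}$, where $\delta_0>0$, and that the initial data satisfies $J(u_0)\le\sup_{\phi\in\mathcal{M}}J(\phi)+\delta_1$ for some $\delta_1>0$, with $\delta,\delta_0,\delta_1$ sufficiently small that $\eta_*<\eta^*$. Then, for every gradient $\mathcal{G}\in\mathcal{C}_{X_0}$, the corresponding solution $u(t)$ of $$u_t=-\mathcal{G}\nabla_XJ(u),\qquad u(0)=u_0,$$ can be decomposed as $u(t)=\Phi(\cdot;\mathbf{p}(t))+w(\cdot,t)$,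 where the residual $w$ satisfies $\|w\|_H\le\eta_*$ for all $t\in(0,T_{\mathrm{exit}})$, with $T_{\mathrm{exit}}:=\inf\{t:\mathbf{p}(t)\notin\mathcal{P}\}$.
   Context: $\nabla_XJ$ and $\nabla_X^2J$ denote the first and second variational derivatives of $J$ in the $X$ inner product; $d_H$ is the distance in the $H$-norm. Flows are assumed locally well-posed. Class of gradients: $\mathcal{C}_{X_0}$ is the set of non-negative, $X$-self-adjoint linear operators $\mathcal{G}:H\to X_0$ with $\ker\mathcal{G}=X_0^\perp$ whose inverse $\mathcal{G}^{-1}:X_0\to\mathcal{D}_{\mathcal{G}}\subset X_0$ is bounded in the $X$-norm. The flow of such a gradient leaves $u_0+X_0$ invariant. Spectral hypotheses for the gradient $\Pi_0$ with parameter $\delta$. Let $F(u):=-\Pi_0\nabla_XJ(u)$. It is assumed that $F(\Phi(\mathbf{p})+v)=\mathcal{R}(\mathbf{p})+\mathbb{L}_{\mathbf{p}}v+\mathcal{N}_S(v)$, where $\mathcal{R}(\mathbf{p}):=F(\Phi(\mathbf{p}))$ is the residual, $\mathbb{L}_{\mathbf{p}}$ is the linearization of $F$ at $\Phi(\mathbf{p})$, and $\|\mathcal{N}_S(v)\|_H\le C\|v\|_H^r$ with some $r>1$ and $C$ independent of $\mathbf{p}\in\mathcal{P}$. The hypotheses are that there are constants $C_0,c_0,k_s,C_2,C_3,C_4>0$ such that for all $\mathbf{p}\in\mathcal{P}$: (H0) $\|\mathcal{R}(\mathbf{p})\|_H\le C_0\delta$. (H1) The spectrum of $\mathbb{L}_{\mathbf{p}}$,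 viewed as a map from $H$ into $X$, consists of a stable part $\sigma_s\subset\{\lambda\le-k_s\}$ and a slow part $\sigma_0\subset\{|\lambda|\le c_0\delta\}$; the associated slow eigenspace $Y_{\mathbf{p}}$ has dimension $n$, equal to the dimension of $\mathcal{P}$ and of the tangent space to $\mathcal{M}$. (H2) $\mathbb{L}_{\mathbf{p}}$ generates a $C_0$-semigroup $S_{\mathbf{p}}$ with $\|S_{\mathbf{p}}(t)u\|_H\le C_2e^{-k_st}\|u\|_H$ for all $t\ge0$ and $u\in Y_{\mathbf{p}}':=Y_{\mathbf{p}}^\perp\cap H$, the perp being taken in $X$. (H3) There is an ordering $\{\psi_1,\dots,\psi_n\}$ of the eigenfunctions of $Y_{\mathbf{p}}$ with $\|\psi_i(\mathbf{p})-\partial\Phi/\partial p_i\|_H\le C_3\delta$ for $i=1,\dots,n$. (H4) The normalized eigenfunctions satisfy $\max_{i,\mathbf{p}}\big(\|\psi_i(\mathbf{p})\|_H+\|\nabla_{\mathbf{p}}^2\psi_i(\mathbf{p})\|_H\big)\le C_4$.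
   Formalization: Added: δ below a threshold set by the spaces and constants; d_H(u₀,M)<η*; (H0)–(H4) taken on H∩X₀ with X-orthonormal ψ_i; hypotheses hold on an open Q containing a uniform neighborhood of P, closure(M)⊂Φ(Q), Π_M maps into Φ(Q); (A1),(A2) only for u in u₀+X₀. *)

theory Defs
  imports "HOL-Analysis.Analysis"
begin

section \<open>Frechet derivatives and smoothness\<close>

definition fderiv :: "('a::real_normed_vector \<Rightarrow> 'b::real_normed_vector) \<Rightarrow> 'a \<Rightarrow> 'a \<Rightarrow>\<^sub>L 'b" where
  "fderiv f x = Blinfun (frechet_derivative f (at x))"

definition bounded_multilinear ::
  "nat \<Rightarrow> ('a::real_normed_vector list \<Rightarrow> 'b::real_normed_vector) \<Rightarrow> bool" where
  "bounded_multilinear n A \<longleftrightarrow>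
     (\<forall>vs i. length vs = n \<and> i < n \<longrightarrow> linear (\<lambda>v. A (vs[i := v]))) \<and>
     (\<exists>K. \<forall>vs. length vs = n \<longrightarrow> norm (A vs) \<le> K * prod_list (map norm vs))"

text \<open>Infinitely often Frechet differentiable on the open set \<open>S\<close>. The spaces of \<open>n\<close>-linear maps
  have no common type, so \<open>D n x\<close> is the \<open>n\<close>-th derivative at \<open>x\<close> acting on lists of length \<open>n\<close>;
  the last clause says that \<open>D (Suc n)\<close> is the derivative of \<open>D n\<close> in the operator norm.\<close>

definition smooth_on :: "'a::real_normed_vector set \<Rightarrow> ('a \<Rightarrow> 'b::real_normed_vector) \<Rightarrow> bool" where
  "smooth_on S f \<longleftrightarrow>
     (\<exists>D :: nat \<Rightarrow> 'a \<Rightarrow> 'a list \<Rightarrow> 'b. \<forall>x\<in>S.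
        D 0 x [] = f x \<and>
        (\<forall>n. bounded_multilinear n (D n x) \<and>
             (\<forall>e>0. \<exists>d>0. \<forall>y\<in>S. dist y x < d \<longrightarrow>
                (\<forall>vs. length vs = n \<longrightarrow>
                   norm (D n y vs - D n x vs - D (Suc n) x ((y - x) # vs))
                     \<le> e * norm (y - x) * prod_list (map norm vs)))))"


section \<open>The triple \<open>H \<subset> X \<subset> H'\<close> and the constraint space\<close>

text \<open>\<open>H\<close> and \<open>X\<close> are the types \<open>'h\<close> and \<open>'x\<close>, the inclusion of \<open>H\<close> in \<open>X\<close> is \<open>\<iota>\<close>, and \<open>H'\<close> is
  the type \<open>'h \<Rightarrow>\<^sub>L real\<close>, into which \<open>X\<close> is mapped by \<open>to_dual \<iota>\<close>. The duality pairing
  extending the inner product of \<open>X\<close> is evaluation: \<open>\<langle>f, v\<rangle>\<^sub>X\<close> is \<open>blinfun_apply f v\<close>.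
  Density of \<open>H\<close> in \<open>X\<close> is what makes \<open>to_dual \<iota>\<close> injective.\<close>

definition gelfand_triple ::
  "('h::{real_inner,complete_space} \<Rightarrow>\<^sub>L 'x::{real_inner,complete_space}) \<Rightarrow> bool" where
  "gelfand_triple \<iota> \<longleftrightarrow> inj (blinfun_apply \<iota>) \<and> closure (range (blinfun_apply \<iota>)) = UNIV"

definition to_dual :: "('h::real_inner \<Rightarrow>\<^sub>L 'x::real_inner) \<Rightarrow> 'x \<Rightarrow> 'h \<Rightarrow>\<^sub>L real" where
  "to_dual \<iota> x = blinfun_inner_right x o\<^sub>L \<iota>"

text \<open>That \<open>X\<^sub>0\<^sup>\<bottom>\<close> lies in \<open>H\<close> is implicit in the requirement that gradients, which are
  defined on \<open>H\<close>, have kernel \<open>X\<^sub>0\<^sup>\<bottom>\<close>; it lets \<open>\<Pi>\<^sub>0\<close> act on \<open>H\<close>, hence on \<open>H'\<close> by duality.\<close>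

definition constraint_space :: "('h::real_inner \<Rightarrow>\<^sub>L 'x::real_inner) \<Rightarrow> 'x set \<Rightarrow> bool" where
  "constraint_space \<iota> X0 \<longleftrightarrow>
     subspace X0 \<and> closed X0 \<and> (\<exists>B. finite B \<and> span (X0 \<union> B) = UNIV) \<and>
     orthogonal_comp X0 \<subseteq> range (blinfun_apply \<iota>)"

definition orth_proj :: "'x::real_inner set \<Rightarrow> 'x \<Rightarrow> 'x" where
  "orth_proj X0 x = (THE y. y \<in> X0 \<and> x - y \<in> orthogonal_comp X0)"

definition orth_proj_H :: "('h::real_inner \<Rightarrow>\<^sub>L 'x::real_inner) \<Rightarrow> 'x set \<Rightarrow> 'h \<Rightarrow> 'h" where
  "orth_proj_H \<iota> X0 v = (THE w. blinfun_apply \<iota> w = orth_proj X0 (blinfun_apply \<iota> v))"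

definition orth_proj_dual ::
  "('h::real_inner \<Rightarrow>\<^sub>L 'x::real_inner) \<Rightarrow> 'x set \<Rightarrow> ('h \<Rightarrow>\<^sub>L real) \<Rightarrow> ('h \<Rightarrow>\<^sub>L real)" where
  "orth_proj_dual \<iota> X0 f = Blinfun (\<lambda>v. blinfun_apply f (orth_proj_H \<iota> X0 v))"


section \<open>Variational derivatives and the constrained gradient\<close>

text \<open>\<open>\<nabla>\<^sub>X J(u)\<close> is the element of \<open>H'\<close> with \<open>\<langle>\<nabla>\<^sub>X J(u), v\<rangle>\<^sub>X = DJ(u) v\<close>; likewise
  \<open>\<langle>\<nabla>\<^sub>X\<^sup>2 J(u) v, w\<rangle>\<^sub>X = D\<^sup>2J(u)(v, w)\<close>, as a map from \<open>H\<close> to \<open>H'\<close>.\<close>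

definition grad :: "('h::real_inner \<Rightarrow> real) \<Rightarrow> 'h \<Rightarrow> 'h \<Rightarrow>\<^sub>L real" where
  "grad J u = fderiv J u"

definition hess :: "('h::real_inner \<Rightarrow> real) \<Rightarrow> 'h \<Rightarrow> 'h \<Rightarrow>\<^sub>L 'h \<Rightarrow>\<^sub>L real" where
  "hess J u = fderiv (grad J) u"

definition rhs ::
  "('h::real_inner \<Rightarrow>\<^sub>L 'x::real_inner) \<Rightarrow> 'x set \<Rightarrow> ('h \<Rightarrow> real) \<Rightarrow> 'h \<Rightarrow> 'h \<Rightarrow>\<^sub>L real" where
  "rhs \<iota> X0 J u = - orth_proj_dual \<iota> X0 (grad J u)"

definition linearization ::
  "('h::real_inner \<Rightarrow>\<^sub>L 'x::real_inner) \<Rightarrow> 'x set \<Rightarrow> ('h \<Rightarrow> real) \<Rightarrow> 'h \<Rightarrow> 'h \<Rightarrow>\<^sub>L 'h \<Rightarrow>\<^sub>L real" where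
  "linearization \<iota> X0 J \<phi> = fderiv (rhs \<iota> X0 J) \<phi>"


section \<open>Unbounded operators, as graphs\<close>

definition adjoint_op :: "('x::real_inner \<times> 'x) set \<Rightarrow> ('x \<times> 'x) set" where
  "adjoint_op A = {(y, z). \<forall>(x, w)\<in>A. w \<bullet> y = x \<bullet> z}"

text \<open>Real resolvent points of an operator in the closed subspace \<open>V\<close>. The operators below are
  self-adjoint, so that no non-real spectrum is lost.\<close>

definition op_spectrum :: "'x::real_normed_vector set \<Rightarrow> ('x \<times> 'x) set \<Rightarrow> real set" where
  "op_spectrum V A = {l. \<not> ((\<forall>y\<in>V. \<exists>x. (x, y + l *\<^sub>R x) \<in> A) \<and>
                         (\<exists>K. \<forall>(x, z)\<in>A. norm x \<le> K * norm (z - l *\<^sub>R x)))}"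

definition c0_semigroup_on :: "'x::real_normed_vector set \<Rightarrow> (real \<Rightarrow> 'x \<Rightarrow> 'x) \<Rightarrow> bool" where
  "c0_semigroup_on V S \<longleftrightarrow>
     (\<forall>t\<ge>0. (\<forall>x\<in>V. S t x \<in> V) \<and>
            (\<forall>x\<in>V. \<forall>y\<in>V. \<forall>a b. S t (a *\<^sub>R x + b *\<^sub>R y) = a *\<^sub>R S t x + b *\<^sub>R S t y) \<and>
            (\<exists>K. \<forall>x\<in>V. norm (S t x) \<le> K * norm x)) \<and>
     (\<forall>x\<in>V. S 0 x = x) \<and>
     (\<forall>s\<ge>0. \<forall>t\<ge>0. \<forall>x\<in>V. S (s + t) x = S s (S t x)) \<and>
     (\<forall>x\<in>V. ((\<lambda>t. S t x) \<longlongrightarrow> x) (at_right 0))"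

definition semigroup_generator :: "'x::real_normed_vector set \<Rightarrow> (real \<Rightarrow> 'x \<Rightarrow> 'x) \<Rightarrow> ('x \<times> 'x) set" where
  "semigroup_generator V S =
     {(x, y). x \<in> V \<and> y \<in> V \<and> ((\<lambda>t. (S t x - x) /\<^sub>R t) \<longlongrightarrow> y) (at_right 0)}"

text \<open>The linearization as an operator in \<open>X\<^sub>0\<close>: its domain consists of those
  \<open>v \<in> H \<inter> X\<^sub>0\<close> that it sends, a priori into \<open>H'\<close>, to elements of \<open>X\<close>. The restriction to
  \<open>X\<^sub>0\<close>, the tangent space of the phase space \<open>u\<^sub>0 + X\<^sub>0\<close>, is essential: on all of \<open>H\<close>
  the operator has \<open>X\<^sub>0\<^sup>\<bottom>\<close> as cokernel, which no tangent vectors of a manifold in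
  \<open>u\<^sub>0 + X\<^sub>0\<close> can match.\<close>

definition lin_op ::
  "('h::real_inner \<Rightarrow>\<^sub>L 'x::real_inner) \<Rightarrow> 'x set \<Rightarrow> ('h \<Rightarrow> real) \<Rightarrow> 'h \<Rightarrow> ('x \<times> 'x) set" where
  "lin_op \<iota> X0 J \<phi> =
     {(x, y). x \<in> X0 \<and> y \<in> X0 \<and>
        (\<exists>v. x = blinfun_apply \<iota> v \<and> blinfun_apply (linearization \<iota> X0 J \<phi>) v = to_dual \<iota> y)}"

definition slow_space ::
  "('h::real_inner \<Rightarrow>\<^sub>L 'x::real_inner) \<Rightarrow> 'x set \<Rightarrow> ('h \<Rightarrow> real) \<Rightarrow> 'h \<Rightarrow> real \<Rightarrow> 'h set" where
  "slow_space \<iota> X0 J \<phi> b =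
     span {v. \<exists>l. \<bar>l\<bar> \<le> b \<and>
              (blinfun_apply \<iota> v, l *\<^sub>R blinfun_apply \<iota> v) \<in> lin_op \<iota> X0 J \<phi>}"

definition fast_space ::
  "('h::real_inner \<Rightarrow>\<^sub>L 'x::real_inner) \<Rightarrow> 'x set \<Rightarrow> ('h \<Rightarrow> real) \<Rightarrow> 'h \<Rightarrow> real \<Rightarrow> 'h set" where
  "fast_space \<iota> X0 J \<phi> b =
     {v. blinfun_apply \<iota> v \<in> X0 \<and>
         (\<forall>y\<in>slow_space \<iota> X0 J \<phi> b. blinfun_apply \<iota> v \<bullet> blinfun_apply \<iota> y = 0)}"


section \<open>The manifold\<close>

text \<open>\<open>\<M> = \<Phi> ` P\<close>. So that \<open>\<p>(t) \<notin> P\<close> makes sense, \<open>\<Phi>\<close> is defined on an open chart domain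
  \<open>Q\<close> containing a neighbourhood of \<open>P\<close> of fixed size \<open>m\<close>. The manifold \<open>\<Phi> ` Q\<close> also
  contains the limit points of \<open>\<M>\<close>; this is automatic for bounded \<open>P\<close>, and says that \<open>\<M>\<close> is
  closed if \<open>P = Q = UNIV\<close>. Without such an extension there is no projection near the edge of
  \<open>\<M>\<close>: for \<open>J (x, y) = y\<^sup>2\<close> on the plane and \<open>\<M> = {0<..<1} \<times> {0}\<close>, a point \<open>(1 + \<epsilon>, 0)\<close>
  differs from every point of \<open>\<M>\<close> by a null vector of \<open>\<nabla>\<^sup>2J\<close>.\<close>

definition param_manifold ::
  "(real^'n \<Rightarrow> 'h::real_normed_vector) \<Rightarrow> (real^'n) set \<Rightarrow> (real^'n) set \<Rightarrow> real \<Rightarrow> bool" where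
  "param_manifold \<Phi> P Q m \<longleftrightarrow>
     P \<noteq> {} \<and> open Q \<and> (\<forall>p\<in>P. ball p m \<subseteq> Q) \<and>
     smooth_on Q \<Phi> \<and> inj_on \<Phi> Q \<and> (\<forall>p\<in>Q. inj (frechet_derivative \<Phi> (at p))) \<and>
     closure (\<Phi> ` P) \<subseteq> \<Phi> ` Q"


section \<open>Hypotheses\<close>

text \<open>In order: the remainder bound for the nonlinearity \<open>N\<close>, the bound on the residual, the
  spectral gap with its slow eigenspace, the decay of the semigroup, and the alignment and
  regularity of one \<open>X\<close>-orthonormal system \<open>\<psi>\<close> of slow eigenfunctions. Membership of a functional in
  \<open>H\<close> means that it is \<open>to_dual \<iota> (\<iota> R)\<close> for some \<open>R\<close>.\<close>

definition spectral_hyps ::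
  "('h::{real_inner,complete_space} \<Rightarrow>\<^sub>L 'x::{real_inner,complete_space}) \<Rightarrow> 'x set \<Rightarrow> ('h \<Rightarrow> real) \<Rightarrow>
   (real^'n \<Rightarrow> 'h) \<Rightarrow> (real^'n) set \<Rightarrow> real \<Rightarrow>
   real \<Rightarrow> real \<Rightarrow> real \<Rightarrow> real \<Rightarrow> real \<Rightarrow> real \<Rightarrow> real \<Rightarrow> real \<Rightarrow> bool" where
  "spectral_hyps \<iota> X0 J \<Phi> Q \<delta> C r C0 c0 ks C2 C3 C4 \<longleftrightarrow>
     (\<forall>p\<in>Q. \<forall>v. blinfun_apply \<iota> v \<in> X0 \<longrightarrow>
        (\<exists>N. rhs \<iota> X0 J (\<Phi> p + v) =
               rhs \<iota> X0 J (\<Phi> p) + blinfun_apply (linearization \<iota> X0 J (\<Phi> p)) v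
               + to_dual \<iota> (blinfun_apply \<iota> N) \<and>
             norm N \<le> C * norm v powr r)) \<and>
     (\<forall>p\<in>Q. \<exists>R. rhs \<iota> X0 J (\<Phi> p) = to_dual \<iota> (blinfun_apply \<iota> R) \<and> norm R \<le> C0 * \<delta>) \<and>
     (\<forall>p\<in>Q. op_spectrum X0 (lin_op \<iota> X0 J (\<Phi> p)) \<subseteq> {l. l \<le> - ks} \<union> {l. \<bar>l\<bar> \<le> c0 * \<delta>}) \<and>
     (\<forall>p\<in>Q. dim (slow_space \<iota> X0 J (\<Phi> p) (c0 * \<delta>)) = CARD('n)) \<and>
     (\<forall>p\<in>Q. \<exists>S. c0_semigroup_on X0 S \<and> semigroup_generator X0 S = lin_op \<iota> X0 J (\<Phi> p) \<and>
        (\<forall>t\<ge>0. \<forall>u\<in>fast_space \<iota> X0 J (\<Phi> p) (c0 * \<delta>).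
           \<exists>w. blinfun_apply \<iota> w = S t (blinfun_apply \<iota> u) \<and>
               norm w \<le> C2 * exp (- ks * t) * norm u)) \<and>
     (\<exists>\<psi> :: 'n \<Rightarrow> real^'n \<Rightarrow> 'h.
        (\<forall>p\<in>Q. \<forall>i. \<exists>l. \<bar>l\<bar> \<le> c0 * \<delta> \<and>
           (blinfun_apply \<iota> (\<psi> i p), l *\<^sub>R blinfun_apply \<iota> (\<psi> i p)) \<in> lin_op \<iota> X0 J (\<Phi> p)) \<and>
        (\<forall>p\<in>Q. \<forall>i j. blinfun_apply \<iota> (\<psi> i p) \<bullet> blinfun_apply \<iota> (\<psi> j p) = (if i = j then 1 else 0)) \<and>
        (\<forall>p\<in>Q. \<forall>i. norm (\<psi> i p - frechet_derivative \<Phi> (at p) (axis i 1)) \<le> C3 * \<delta>) \<and>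
        (\<forall>p\<in>Q. \<forall>i. \<psi> i differentiable (at p) \<and> fderiv (\<psi> i) differentiable (at p) \<and>
           norm (\<psi> i p) + norm (fderiv (fderiv (\<psi> i)) p) \<le> C4))"

definition in_affine :: "('h::real_inner \<Rightarrow>\<^sub>L 'x::real_inner) \<Rightarrow> 'x set \<Rightarrow> 'h \<Rightarrow> 'h set" where
  "in_affine \<iota> X0 u0 = {u. blinfun_apply \<iota> (u - u0) \<in> X0}"

definition energy_coercive ::
  "('h::real_inner \<Rightarrow>\<^sub>L 'x::real_inner) \<Rightarrow> 'x set \<Rightarrow> ('h \<Rightarrow> real) \<Rightarrow> 'h set \<Rightarrow> real \<Rightarrow> real \<Rightarrow> bool" where
  "energy_coercive \<iota> X0 J M \<mu>e \<gamma>e \<longleftrightarrow>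
     (\<forall>\<phi>\<in>M. \<forall>v. blinfun_apply \<iota> v \<in> X0 \<longrightarrow>
        blinfun_apply (blinfun_apply (hess J \<phi>) v + \<gamma>e *\<^sub>R to_dual \<iota> (blinfun_apply \<iota> v)) v
          \<ge> \<mu>e * (norm v)\<^sup>2)"

text \<open>A gradient is an unbounded self-adjoint operator in \<open>X\<close> whose domain contains \<open>H\<close>; the
  domain of \<open>\<Pi>\<^sub>0\<close> is \<open>X\<close>.\<close>

definition gradients ::
  "('h::real_inner \<Rightarrow>\<^sub>L 'x::real_inner) \<Rightarrow> 'x set \<Rightarrow> ('x \<times> 'x) set set" where
  "gradients \<iota> X0 =
     {G. subspace G \<and> single_valued G \<and> range (blinfun_apply \<iota>) \<subseteq> Domain G \<and> Range G \<subseteq> X0 \<and>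
         (\<forall>(x, y)\<in>G. 0 \<le> y \<bullet> x) \<and> adjoint_op G = G \<and>
         {x. (x, 0) \<in> G} = orthogonal_comp X0 \<and>
         (\<forall>y\<in>X0. \<exists>x\<in>X0. (x, y) \<in> G) \<and>
         (\<exists>K. \<forall>(x, y)\<in>G. x \<in> X0 \<longrightarrow> norm x \<le> K * norm y)}"


section \<open>Energy projections and flows\<close>

definition affine_nbhd ::
  "('h::real_inner \<Rightarrow>\<^sub>L 'x::real_inner) \<Rightarrow> 'x set \<Rightarrow> 'h \<Rightarrow> 'h set \<Rightarrow> real \<Rightarrow> 'h set" where
  "affine_nbhd \<iota> X0 u0 M \<eta> = {u \<in> in_affine \<iota> X0 u0. infdist u M < \<eta>}"

text \<open>\<open>\<Pi>\<^sub>\<M> u = \<Phi> (\<pi> u)\<close>. The neighbourhood is taken in the phase space \<open>u\<^sub>0 + X\<^sub>0\<close>: the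
  hypotheses do not control \<open>J\<close> in the directions \<open>X\<^sub>0\<^sup>\<bottom>\<close>. The remainder \<open>NE\<close> depends on the
  base point as well. Past the edge of \<open>\<M>\<close> the value \<open>\<pi> u\<close> may lie in \<open>Q - P\<close>.\<close>

definition energy_projection ::
  "('h::real_inner \<Rightarrow>\<^sub>L 'x::real_inner) \<Rightarrow> 'x set \<Rightarrow> ('h \<Rightarrow> real) \<Rightarrow> (real^'n \<Rightarrow> 'h) \<Rightarrow>
   (real^'n) set \<Rightarrow> (real^'n) set \<Rightarrow> 'h \<Rightarrow> ('h \<Rightarrow> real^'n) \<Rightarrow>
   real \<Rightarrow> real \<Rightarrow> real \<Rightarrow> real \<Rightarrow> real \<Rightarrow> real \<Rightarrow> bool" where
  "energy_projection \<iota> X0 J \<Phi> P Q u0 \<pi> \<eta> c1 \<delta>2 c2 \<mu>2 \<rho> \<longleftrightarrow>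
     0 < \<eta> \<and> 0 < c1 \<and> 0 < \<delta>2 \<and> 0 < c2 \<and> 0 < \<mu>2 \<and> 2 < \<rho> \<and>
     (\<forall>u\<in>affine_nbhd \<iota> X0 u0 (\<Phi> ` P) \<eta>. \<pi> u \<in> Q) \<and>
     (\<forall>\<phi>\<in>\<Phi> ` P. \<Phi> (\<pi> \<phi>) = \<phi>) \<and>
     (\<forall>u\<in>affine_nbhd \<iota> X0 u0 (\<Phi> ` P) \<eta>. norm (u - \<Phi> (\<pi> u)) \<le> c1 * infdist u (\<Phi> ` P)) \<and>
     (\<exists>NE :: 'h \<Rightarrow> 'h \<Rightarrow> real. \<forall>u\<in>affine_nbhd \<iota> X0 u0 (\<Phi> ` P) \<eta>.
        let \<phi> = \<Phi> (\<pi> u); v = u - \<Phi> (\<pi> u) in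
          J u = J \<phi> + blinfun_apply (grad J \<phi>) v
                + 1/2 * blinfun_apply (blinfun_apply (hess J \<phi>) v) v + NE \<phi> v \<and>
          \<bar>blinfun_apply (grad J \<phi>) v\<bar> \<le> \<delta>2 * norm v \<and>
          1/2 * blinfun_apply (blinfun_apply (hess J \<phi>) v) v \<ge> \<mu>2 * (norm v)\<^sup>2 \<and>
          \<bar>NE \<phi> v\<bar> \<le> c2 * norm v powr \<rho>)"

definition eta_upper :: "real \<Rightarrow> real \<Rightarrow> real \<Rightarrow> real \<Rightarrow> real \<Rightarrow> real" where
  "eta_upper \<eta> c1 c2 \<mu>2 \<rho> = min \<eta> (1 / c1 * (\<mu>2 / (2 * c2)) powr (1 / (\<rho> - 2)))"

definition eta_lower :: "real \<Rightarrow> real \<Rightarrow> real \<Rightarrow> real \<Rightarrow> real" where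
  "eta_lower \<delta>2 \<mu>2 \<delta>0 \<delta>1 = \<delta>2 / \<mu>2 + sqrt (\<delta>2\<^sup>2 / \<mu>2\<^sup>2 + 2 * ((\<delta>0 + \<delta>1) / \<mu>2))"

text \<open>A classical solution on \<open>[0, T)\<close>, \<open>T \<le> \<infinity>\<close>: continuous into \<open>H\<close>, differentiable into \<open>H\<close>
  for \<open>t > 0\<close>, with \<open>g = \<nabla>\<^sub>X J(u(t))\<close> in the domain of the gradient.\<close>

definition flow_solution ::
  "('h::real_inner \<Rightarrow>\<^sub>L 'x::real_inner) \<Rightarrow> ('h \<Rightarrow> real) \<Rightarrow> ('x \<times> 'x) set \<Rightarrow> 'h \<Rightarrow> ereal \<Rightarrow>
   (real \<Rightarrow> 'h) \<Rightarrow> bool" where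
  "flow_solution \<iota> J G u0 T u \<longleftrightarrow>
     u 0 = u0 \<and> continuous_on {t. 0 \<le> t \<and> ereal t < T} u \<and>
     (\<forall>t. 0 < t \<and> ereal t < T \<longrightarrow>
        (\<exists>u' g. (u has_vector_derivative u') (at t) \<and> grad J (u t) = to_dual \<iota> g \<and>
                (g, - blinfun_apply \<iota> u') \<in> G))"

text \<open>\<open>\<p>(t) = \<pi> (u t)\<close> is defined while \<open>u t\<close> is within distance \<open>\<eta>\<close> of \<open>M\<close>; leaving that
  neighbourhood does not count as an exit of \<open>\<p>\<close> from \<open>P\<close>.\<close>

definition exit_time ::
  "('h::real_normed_vector \<Rightarrow> 'p) \<Rightarrow> 'p set \<Rightarrow> 'h set \<Rightarrow> real \<Rightarrow> ereal \<Rightarrow> (real \<Rightarrow> 'h) \<Rightarrow> ereal" where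
  "exit_time \<pi> P M \<eta> T u =
     Inf (ereal ` {t. 0 \<le> t \<and> ereal t < T \<and> infdist (u t) M < \<eta> \<and> \<pi> (u t) \<notin> P})"

end

theory Submission
  imports Defs
begin

text \<open>Existence of the projection rests on two facts about the second variation \<open>q = \<nabla>\<^sup>2J(\<phi>)\<close> at
a point \<open>\<phi> = \<Phi> p\<close> of the manifold and one fact about the manifold itself.

On directions \<open>v\<close> tangent to the phase space \<open>u\<^sub>0 + X\<^sub>0\<close>, the linearization \<open>L\<close> of the flow is
the operator of the form \<open>- q\<close>, and it is symmetric. For a symmetric generator, exponential decay of
one orbit at rate \<open>k\<close>, with whatever constant, forces \<open>\<langle>L v, v\<rangle> \<le> - k \<parallel>v\<parallel>\<^sup>2\<close>, since
\<open>t \<mapsto> \<langle>S(t) v, v\<rangle>\<close> is log-convex (\<open>semigroup_decay_imp_dissipative\<close>). So the semigroup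
hypothesis gives \<open>q v v \<ge> k\<^sub>s \<parallel>v\<parallel>\<^sub>X\<^sup>2\<close> on the fast vectors in the domain of \<open>L\<close>; these are
\<open>H\<close>-dense in the fast space (\<open>operator_domain_dense\<close>), and the energy coercivity upgrades the
\<open>X\<close>-norm to the \<open>H\<close>-norm (\<open>hess_coercive_on_fast_space\<close>). The slow eigenvectors are
\<open>q\<close>-orthogonal to the fast space and contribute at worst \<open>- c\<^sub>0 \<delta>\<close> times their squared \<open>X\<close>-norm, so \<open>q\<close> remains coercive on
vectors whose slow components are small (\<open>hess_coercive_near_fast_space\<close>).

Such vectors come from nearest points. Let \<open>\<Phi> p\<close> be \<open>X\<close>-nearest to \<open>u\<close> among the points of the
manifold close to it. Then \<open>u - \<Phi> p\<close> is \<open>X\<close>-orthogonal to the tangent vectors \<open>\<partial>\<^sub>i \<Phi>\<close>, which are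
within \<open>C\<^sub>3 \<delta>\<close> of the slow eigenvectors; hence its slow components are of order \<open>\<delta>\<close>. For a
neighbourhood of uniform size the manifold must not bend too fast. The eigenvectors form an
\<open>X\<close>-orthonormal frame whose first derivative is controlled by interpolation between the bounds for
the frame and for its second derivative (\<open>frame_lipschitz\<close>), so that \<open>\<Phi>\<close> is close to a linear
isometry into \<open>X\<close> on balls of fixed radius, and the minimum is attained in the interior of such a ball
(\<open>foot_point_exists\<close>). The Taylor remainder of \<open>J\<close> comes from the pairing of the
nonlinearity with the increment and has order \<open>r + 1 > 2\<close>; the linear term comes from the residual
of the manifold and has order \<open>\<delta>\<close>.

The trapping statement (\<open>flow_trapped\<close>) holds for every energy projection. The energy does not
increase along the flow of any gradient, so as long as \<open>u(t)\<close> is within \<open>\<eta>\<^sup>*\<close> of the manifold the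
expansion of \<open>J\<close> gives \<open>\<mu>\<^sub>2/2 x\<^sup>2 - \<delta>\<^sub>2 x \<le> \<delta>\<^sub>0 + \<delta>\<^sub>1\<close> for \<open>x = \<parallel>w\<parallel>\<close>, that is \<open>x \<le> \<eta>\<^sub>*\<close>. Since
\<open>\<eta>\<^sub>* < \<eta>\<^sup>*\<close>, the distance to the manifold cannot pass continuously through the values between
them.\<close>

section \<open>Symmetric forms and orthogonal projections in Hilbert space\<close>

text \<open>The solution is the minimizer over \<open>V\<close> of \<open>a v v - 2 * l v\<close>. By the parallelogram identity
\<open>a (u - v) (u - v)\<close> is at most twice the sum of the excesses of the values at \<open>u\<close> and \<open>v\<close> over
the infimum, so minimizing sequences are Cauchy.\<close>

lemma symmetric_lax_milgram:
  fixes a :: "'v::{real_inner,complete_space} \<Rightarrow> 'v \<Rightarrow> real"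
  assumes a: "bounded_bilinear a" and sym: "\<And>x y. a x y = a y x"
    and V: "subspace V" "closed V" and c: "0 < c" "\<And>v. v \<in> V \<Longrightarrow> c * (norm v)\<^sup>2 \<le> a v v"
    and l: "bounded_linear l"
  obtains v where "v \<in> V" "\<And>w. w \<in> V \<Longrightarrow> a v w = l w"
proof -
  interpret a: bounded_bilinear a by fact
  interpret l: bounded_linear l by fact
  define E where "E v = a v v - 2 * l v" for v
  obtain K where K: "0 < K" "\<And>x. \<bar>l x\<bar> \<le> norm x * K"
    using l.pos_bounded by auto
  have low: "- K\<^sup>2 / c \<le> E v" if "v \<in> V" for v
  proof -
    have "0 \<le> (c * norm v - K)\<^sup>2 / c" using c(1) by simp
    also have "\<dots> = c * (norm v)\<^sup>2 - 2 * (norm v * K) + K\<^sup>2 / c"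
      using c(1) by (simp add: power2_eq_square field_simps)
    finally show ?thesis
      using c(2)[OF that] K(2)[of v] unfolding E_def by simp
  qed
  define I where "I = Inf (E ` V)"
  have bdd: "bdd_below (E ` V)" using low by (auto intro!: bdd_belowI)
  have V0: "0 \<in> V" using V(1) subspace_0 by blast
  have Ile: "I \<le> E v" if "v \<in> V" for v
    unfolding I_def by (rule cInf_lower) (use that bdd in auto)
  have "\<exists>v\<in>V. E v < I + inverse (real (Suc n))" for n
    using cInf_lessD[of "E ` V" "I + inverse (real (Suc n))"] V0 unfolding I_def by auto
  then obtain x where x: "\<And>n. x n \<in> V" "\<And>n. E (x n) < I + inverse (real (Suc n))"
    by metis
  have par: "c * (norm (u - v))\<^sup>2 \<le> 2 * (E u - I) + 2 * (E v - I)" if "u \<in> V" "v \<in> V" for u v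
  proof -
    have uv: "u - v \<in> V" "(1/2) *\<^sub>R (u + v) \<in> V"
      using that V(1) by (auto intro: subspace_diff subspace_add subspace_scale)
    have "a (u - v) (u - v) = 2 * E u + 2 * E v - 4 * E ((1/2) *\<^sub>R (u + v))"
      using sym[of u v]
      by (simp add: E_def a.diff_left a.diff_right a.add_left a.add_right a.scaleR_left
          a.scaleR_right l.add l.scaleR algebra_simps)
    then show ?thesis using Ile[OF uv(2)] c(2)[OF uv(1)] by simp
  qed
  have "Cauchy x"
  proof (rule CauchyI)
    fix e :: real assume e: "0 < e"
    then obtain N where N: "inverse (real (Suc N)) < c * e\<^sup>2 / 4"
      using reals_Archimedean[of "c * e\<^sup>2 / 4"] c(1) by auto
    have small: "E (x n) - I < c * e\<^sup>2 / 4" if "n \<ge> N" for n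
    proof -
      have "inverse (real (Suc n)) \<le> inverse (real (Suc N))" using that by simp
      then show ?thesis using x(2)[of n] N by linarith
    qed
    have "norm (x m - x n) < e" if "m \<ge> N" "n \<ge> N" for m n
    proof -
      have "c * (norm (x m - x n))\<^sup>2 < c * e\<^sup>2"
        using par[OF x(1)[of m] x(1)[of n]] small[OF that(1)] small[OF that(2)] by simp
      then have "(norm (x m - x n))\<^sup>2 < e\<^sup>2" using c(1) by simp
      then show ?thesis using e by (simp add: power2_less_imp_less)
    qed
    then show "\<exists>M. \<forall>m\<ge>M. \<forall>n\<ge>M. norm (x m - x n) < e" by blast
  qed
  then obtain v where v: "x \<longlonglongrightarrow> v" using convergent_eq_Cauchy Cauchy_convergent_iff convergent_def by metis
  have vV: "v \<in> V" using closed_sequentially[OF V(2)] x(1) v by blast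
  have "(\<lambda>n. E (x n)) \<longlonglongrightarrow> E v" unfolding E_def
    by (intro tendsto_intros a.tendsto l.tendsto v)
  moreover have "(\<lambda>n. I + inverse (real (Suc n))) \<longlonglongrightarrow> I"
    using tendsto_add[OF tendsto_const LIMSEQ_inverse_real_of_nat, of I] by simp
  ultimately have "E v \<le> I"
    by (rule LIMSEQ_le) (use x(2) less_imp_le in blast)
  then have min: "E v \<le> E w" if "w \<in> V" for w using Ile[OF that] by simp
  have "a v w = l w" if w: "w \<in> V" for w
  proof (rule ccontr)
    assume ne: "a v w \<noteq> l w"
    define g where "g = a v w - l w"
    have gle: "0 \<le> t\<^sup>2 * a w w + 2 * t * g" for t
    proof -
      have "v + t *\<^sub>R w \<in> V" using V(1) vV w by (auto intro: subspace_add subspace_scale)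
      from min[OF this] show ?thesis using sym[of w v] unfolding E_def g_def
        by (simp add: a.add_left a.add_right a.scaleR_left a.scaleR_right l.add l.scaleR
            power2_eq_square algebra_simps)
    qed
    have "0 \<le> c * (norm w)\<^sup>2" using c(1) by simp
    then have aw: "0 \<le> a w w" using c(2)[OF w] by linarith
    define s where "s = a w w + 1"
    \<comment> \<open>almost the minimizer of the quadratic polynomial in \<open>t\<close>; the summand 1 in \<open>s\<close> avoids division by zero\<close>
    define t where "t = - g / s"
    have s: "0 < s" "a w w = s - 1" using aw by (auto simp: s_def)
    have "t\<^sup>2 * a w w + 2 * t * g = - (g\<^sup>2 * (s + 1) / s\<^sup>2)"
      unfolding t_def s(2) using s(1) by (simp add: power2_eq_square field_simps)
    also have "\<dots> < 0"
      using ne s(1) unfolding g_def by simp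
    finally show False using gle[of t] by simp
  qed
  then show thesis using that vV by blast
qed

lemma orth_proj_unique:
  assumes V: "subspace V" "closed V"
  shows "\<exists>!y. y \<in> V \<and> x - y \<in> orthogonal_comp (V :: 'v::{real_inner,complete_space} set)"
proof -
  obtain y where y: "y \<in> V" "\<And>w. w \<in> V \<Longrightarrow> y \<bullet> w = x \<bullet> w"
    by (rule symmetric_lax_milgram[OF bounded_bilinear_inner _ V, of 1 "\<lambda>w. x \<bullet> w"])
       (auto simp: inner_commute power2_norm_eq_inner bounded_linear_inner_right)
  have "x - y \<in> orthogonal_comp V"
    using y(2) by (auto simp: orthogonal_comp_def orthogonal_def inner_diff inner_commute)
  moreover have "z = y" if "z \<in> V" "x - z \<in> orthogonal_comp V" for z
  proof -
    have "z - y \<in> V" using V that y subspace_diff by blast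
    moreover have "z \<bullet> w = x \<bullet> w" if "w \<in> V" for w
      using \<open>x - z \<in> _\<close> that
      by (simp add: orthogonal_comp_def orthogonal_def inner_diff inner_commute)
    ultimately have "(z - y) \<bullet> (z - y) = 0"
      using y(2)[of "z - y"] by (metis inner_diff_left right_minus_eq)
    then show ?thesis by simp
  qed
  ultimately show ?thesis using y(1) by blast
qed

context
  fixes V :: "'v::{real_inner,complete_space} set"
  assumes V: "subspace V" "closed V"
begin

lemma orth_proj_in: "orth_proj V x \<in> V"
  and orth_proj_diff: "x - orth_proj V x \<in> orthogonal_comp V"
  using theI'[OF orth_proj_unique[OF V, of x]] unfolding orth_proj_def by auto

lemma orth_proj_eqI: "y \<in> V \<Longrightarrow> x - y \<in> orthogonal_comp V \<Longrightarrow> orth_proj V x = y"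
  using orth_proj_unique[OF V, of x] orth_proj_in orth_proj_diff by blast

lemma orth_proj_self: "x \<in> V \<Longrightarrow> orth_proj V x = x"
  by (rule orth_proj_eqI) (auto simp: subspace_orthogonal_comp subspace_0)

lemma inner_orth_proj: "y \<in> V \<Longrightarrow> y \<bullet> orth_proj V x = y \<bullet> x"
  using orth_proj_diff[of x] by (simp add: orthogonal_comp_def orthogonal_def inner_diff)

lemma bounded_linear_orth_proj: "bounded_linear (orth_proj V)"
proof
  fix x y :: 'v and r :: real
  show "orth_proj V (x + y) = orth_proj V x + orth_proj V y"
    by (rule orth_proj_eqI)
       (use subspace_add[OF V(1) orth_proj_in[of x] orth_proj_in[of y]]
          subspace_add[OF subspace_orthogonal_comp orth_proj_diff[of x] orth_proj_diff[of y]]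
        in \<open>auto simp: algebra_simps\<close>)
  show "orth_proj V (r *\<^sub>R x) = r *\<^sub>R orth_proj V x"
    by (rule orth_proj_eqI)
       (use subspace_scale[OF V(1) orth_proj_in[of x], of r]
          subspace_scale[OF subspace_orthogonal_comp orth_proj_diff[of x], of r]
        in \<open>auto simp: algebra_simps\<close>)
  have "norm (orth_proj V x) \<le> norm x * 1" for x
  proof (cases "orth_proj V x = 0")
    case False
    have "norm (orth_proj V x) * norm (orth_proj V x) = orth_proj V x \<bullet> x"
      using inner_orth_proj[OF orth_proj_in, of x x]
      by (simp add: power2_norm_eq_inner flip: power2_eq_square)
    also have "\<dots> \<le> norm (orth_proj V x) * norm x" by (rule norm_cauchy_schwarz)
    finally show ?thesis using False by simp
  qed simp
  then show "\<exists>K. \<forall>x. norm (orth_proj V x) \<le> norm x * K" by blast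
qed

lemma mem_double_orthogonal: 
  assumes "\<And>z. z \<in> orthogonal_comp V \<Longrightarrow> x \<bullet> z = 0"
  shows "x \<in> V"
proof -
  have "(x - orth_proj V x) \<bullet> (x - orth_proj V x) = 0"
    using assms[OF orth_proj_diff[of x]] orth_proj_in[of x] orth_proj_diff[of x]
    by (simp add: inner_diff_left orthogonal_comp_def orthogonal_def)
  then show ?thesis using orth_proj_in[of x] by simp
qed

end

section \<open>Semigroups with a symmetric generator\<close>

text \<open>Sokal's elementary argument. The point \<open>x (Suc n)\<close> is within \<open>3\<^sup>-\<^sup>n\<close> of \<open>x n\<close> and chosen such
that \<open>A n\<close>, of norm above \<open>4\<^sup>n\<close>, has there two thirds of the largest size that this step allows. All
later steps together have length at most half of \<open>3\<^sup>-\<^sup>n\<close> and cannot undo it, so \<open>A n\<close> is of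
order \<open>(4/3)\<^sup>n\<close> at the limit point.\<close>

lemma uniform_boundedness:
  fixes T :: "'i \<Rightarrow> 'a::{real_normed_vector,complete_space} \<Rightarrow> 'b::real_normed_vector"
  assumes T: "\<And>i. i \<in> I \<Longrightarrow> bounded_linear (T i)"
    and bd: "\<And>x. \<exists>K. \<forall>i\<in>I. norm (T i x) \<le> K"
  shows "\<exists>K. \<forall>i\<in>I. \<forall>x. norm (T i x) \<le> K * norm x"
proof (rule ccontr)
  assume contr: "\<not> ?thesis"
  have "\<exists>i\<in>I. 4 ^ n < onorm (T i)" for n :: nat
  proof (rule ccontr)
    assume "\<not> ?thesis"
    then have "norm (T i x) \<le> 4 ^ n * norm x" if "i \<in> I" for i x
      using onorm[OF T[OF that], of x] that
      by (meson dual_order.trans mult_right_mono norm_ge_zero not_less)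
    then show False using contr by blast
  qed
  then obtain i where i: "\<And>n. i n \<in> I" "\<And>n::nat. 4 ^ n < onorm (T (i n))" by metis
  define A where "A n = T (i n)" for n
  have A: "bounded_linear (A n)" for n unfolding A_def using T i by blast
  have big: "4 ^ n < onorm (A n)" for n unfolding A_def by (rule i)
  have pos: "0 < onorm (A n)" for n using big[of n] zero_less_power[of "4::real" n] by linarith
  \<comment> \<open>in any ball of radius \<open>r\<close> a bounded operator attains two thirds of \<open>r\<close> times its norm\<close>
  have step: "\<exists>y. norm (y - x) \<le> r \<and> 2/3 * r * onorm (A n) \<le> norm (A n y)"
    if r: "0 < r" for x r n
  proof -
    interpret bounded_linear "A n" by (rule A)
    obtain z where z: "2/3 * onorm (A n) * norm z < norm (A n z)"
    proof (rule ccontr)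
      assume "\<not> thesis"
      with that have "norm (A n z) \<le> 2/3 * onorm (A n) * norm z" for z by (meson not_less)
      then have "onorm (A n) \<le> 2/3 * onorm (A n)"
        using pos[of n] by (intro onorm_bound) auto
      then show False using pos[of n] by simp
    qed
    have z0: "z \<noteq> 0" using z by (auto simp: zero)
    define e where "e = (r / norm z) *\<^sub>R z"
    have e: "norm e = r" using z0 r by (simp add: e_def)
    have "2/3 * onorm (A n) * r = (r / norm z) * (2/3 * onorm (A n) * norm z)" using z0 by simp
    also have "\<dots> \<le> (r / norm z) * norm (A n z)"
      using z r by (intro mult_left_mono) auto
    also have "\<dots> = norm (A n e)" using r by (simp add: e_def scaleR)
    finally have Ae: "2/3 * r * onorm (A n) \<le> norm (A n e)" by (simp add: mult_ac)
    have "2 *\<^sub>R A n e = A n (x + e) - A n (x - e)"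
      by (simp add: add diff scaleR_2)
    then have "2 * norm (A n e) \<le> norm (A n (x + e)) + norm (A n (x - e))"
      by (metis norm_triangle_ineq4 norm_scaleR abs_numeral)
    then have "norm (A n e) \<le> norm (A n (x + e)) \<or> norm (A n e) \<le> norm (A n (x - e))"
      by linarith
    then show ?thesis
    proof
      assume "norm (A n e) \<le> norm (A n (x + e))"
      then show ?thesis using Ae e by (intro exI[of _ "x + e"]) simp
    next
      assume "norm (A n e) \<le> norm (A n (x - e))"
      then show ?thesis using Ae e by (intro exI[of _ "x - e"]) simp
    qed
  qed
  have "\<exists>x. \<forall>n. True \<and> norm (x (Suc n) - x n) \<le> (1/3) ^ n \<and>
          2/3 * (1/3) ^ n * onorm (A n) \<le> norm (A n (x (Suc n)))"
    by (rule dependent_nat_choice) (use step in auto)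
  then obtain x where x: "\<And>n. norm (x (Suc n) - x n) \<le> (1/3) ^ n"
    "\<And>n. 2/3 * (1/3) ^ n * onorm (A n) \<le> norm (A n (x (Suc n)))" by auto
  have tail: "norm (x (n + k) - x n) \<le> 3/2 * (1/3) ^ n" for n k
  proof -
    have "norm (x (n + k) - x n) \<le> 3/2 * (1/3) ^ n - 3/2 * (1/3) ^ (n + k)"
    proof (induction k)
      case (Suc k)
      have "norm (x (n + Suc k) - x n) \<le> norm (x (Suc (n + k)) - x (n + k)) + norm (x (n + k) - x n)"
        using norm_triangle_ineq[of "x (Suc (n + k)) - x (n + k)" "x (n + k) - x n"] by simp
      then show ?case using Suc x(1)[of "n + k"] by simp
    qed simp
    also have "\<dots> \<le> 3/2 * (1/3) ^ n" by simp
    finally show ?thesis .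
  qed
  have "Cauchy x"
  proof (rule CauchyI')
    fix e :: real assume "0 < e"
    then obtain N where N: "(1/3::real) ^ N < e / (3/2)"
      using real_arch_pow_inv[of "e / (3/2)" "1/3"] by auto
    have "dist (x m) (x n) < e" if "m \<ge> N" "n > m" for m n
    proof -
      have "norm (x n - x m) \<le> 3/2 * (1/3) ^ m" using tail[of m "n - m"] that by simp
      also have "\<dots> \<le> 3/2 * (1/3) ^ N" using that by (simp add: power_decreasing)
      finally show ?thesis using N by (simp add: dist_norm norm_minus_commute)
    qed
    then show "\<exists>M. \<forall>m\<ge>M. \<forall>n>m. dist (x m) (x n) < e" by blast
  qed
  then obtain l where l: "x \<longlonglongrightarrow> l" using Cauchy_convergent_iff convergent_def by metis
  have lim: "norm (l - x (Suc n)) \<le> 1/2 * (1/3) ^ n" for n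
  proof (rule LIMSEQ_le_const2)
    show "(\<lambda>k. norm (x (k + Suc n) - x (Suc n))) \<longlonglongrightarrow> norm (l - x (Suc n))"
      by (intro tendsto_intros LIMSEQ_ignore_initial_segment l)
    show "\<exists>N. \<forall>k\<ge>N. norm (x (k + Suc n) - x (Suc n)) \<le> 1/2 * (1/3) ^ n"
      using tail[of "Suc n"] by (auto simp: add.commute)
  qed
  have grow: "1/6 * (4/3) ^ n \<le> norm (A n l)" for n
  proof -
    interpret bounded_linear "A n" by (rule A)
    have "norm (A n (l - x (Suc n))) \<le> onorm (A n) * (1/2 * (1/3) ^ n)"
      using onorm[OF A[of n], of "l - x (Suc n)"] mult_left_mono[OF lim[of n], of "onorm (A n)"]
        pos[of n] by linarith
    moreover have "norm (A n (x (Suc n))) \<le> norm (A n l) + norm (A n (l - x (Suc n)))"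
      unfolding diff by (metis norm_minus_commute norm_triangle_sub)
    ultimately have "norm (A n l) \<ge> 1/6 * (1/3) ^ n * onorm (A n)"
      using x(2)[of n] by (simp add: algebra_simps)
    moreover have "1/6 * (1/3) ^ n * onorm (A n) \<ge> 1/6 * (1/3) ^ n * 4 ^ n"
      using big[of n] by (intro mult_left_mono) auto
    moreover have "(1/6::real) * (1/3) ^ n * 4 ^ n = 1/6 * (4/3) ^ n"
      by (simp flip: power_mult_distrib)
    ultimately show ?thesis by linarith
  qed
  obtain K where K: "\<And>j. j \<in> I \<Longrightarrow> norm (T j l) \<le> K" using bd by blast
  obtain n where "6 * K < (4/3::real) ^ n" using real_arch_pow[of "4/3" "6 * K"] by auto
  then show False using grow[of n] K[OF i(1)[of n]] unfolding A_def by simp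
qed

context
  fixes V :: "'v::{real_inner,complete_space} set" and S :: "real \<Rightarrow> 'v \<Rightarrow> 'v"
  assumes V: "subspace V" "closed V" and S: "c0_semigroup_on V S"
begin

lemma semigroup_mem: "0 \<le> t \<Longrightarrow> x \<in> V \<Longrightarrow> S t x \<in> V"
  and semigroup_lin: "0 \<le> t \<Longrightarrow> x \<in> V \<Longrightarrow> y \<in> V \<Longrightarrow>
      S t (a *\<^sub>R x + c *\<^sub>R y) = a *\<^sub>R S t x + c *\<^sub>R S t y"
  and semigroup_bounded: "0 \<le> t \<Longrightarrow> \<exists>K. \<forall>x\<in>V. norm (S t x) \<le> K * norm x"
  and semigroup_comp: "0 \<le> r \<Longrightarrow> 0 \<le> t \<Longrightarrow> x \<in> V \<Longrightarrow> S (r + t) x = S r (S t x)"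
  and semigroup_0: "x \<in> V \<Longrightarrow> S 0 x = x"
  and semigroup_cont: "x \<in> V \<Longrightarrow> ((\<lambda>t. S t x) \<longlongrightarrow> x) (at_right 0)"
  using S unfolding c0_semigroup_on_def by blast+

text \<open>Strong continuity at \<open>0\<close> is a pointwise condition. Operators \<open>S (t n)\<close> with \<open>t n\<close> tending to \<open>0\<close>
converge pointwise, hence they are uniformly bounded; composed with the projection onto \<open>V\<close> they
are defined on the whole space.\<close>

lemma semigroup_bounded_near_0:
  "\<exists>n::nat. \<forall>t. 0 < t \<and> t \<le> inverse (real (Suc n)) \<longrightarrow> (\<forall>x\<in>V. norm (S t x) \<le> real n * norm x)"
proof (rule ccontr)
  note P = orth_proj_in[OF V] orth_proj_self[OF V] bounded_linear_orth_proj[OF V]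
  assume "\<not> ?thesis"
  then have "\<forall>n. \<exists>t. 0 < t \<and> t \<le> inverse (real (Suc n)) \<and> (\<exists>x\<in>V. \<not> norm (S t x) \<le> real n * norm x)"
    by blast
  from choice[OF this] obtain t where t: "\<And>n. 0 < t n" "\<And>n. t n \<le> inverse (real (Suc n))"
    and ex: "\<And>n::nat. \<exists>x\<in>V. \<not> norm (S (t n) x) \<le> real n * norm x"
    by blast
  have t_nonneg: "0 \<le> t n" for n using t(1)[of n] by simp
  have "t \<longlonglongrightarrow> 0"
    by (rule real_tendsto_sandwich[OF _ _ tendsto_const LIMSEQ_inverse_real_of_nat])
       (use t(2) t_nonneg in \<open>auto simp del: of_nat_Suc\<close>)
  moreover have "t n \<noteq> 0" for n using t(1)[of n] by simp
  ultimately have t0: "filterlim t (at_right 0) sequentially"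
    unfolding filterlim_at using t(1) by simp
  define T where "T n x = S (t n) (orth_proj V x)" for n :: nat and x
  have Tlin: "bounded_linear (T n)" for n
  proof -
    interpret P: bounded_linear "orth_proj V" by (rule P(3))
    obtain K where K: "\<And>x. x \<in> V \<Longrightarrow> norm (S (t n) x) \<le> K * norm x"
      using semigroup_bounded[OF t_nonneg] by blast
    obtain L where L: "0 < L" "\<And>x. norm (orth_proj V x) \<le> norm x * L" using P.pos_bounded by auto
    show ?thesis
    proof
      fix x y r
      show "T n (x + y) = T n x + T n y"
        using semigroup_lin[OF t_nonneg P(1) P(1), of n 1 x 1 y] by (simp add: T_def P.add)
      show "T n (r *\<^sub>R x) = r *\<^sub>R T n x"
        using semigroup_lin[OF t_nonneg P(1) P(1), of n r x 0 x] by (simp add: T_def P.scaleR)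
      have "norm (T n x) \<le> norm x * (L * \<bar>K\<bar>)" for x
      proof -
        have "norm (T n x) \<le> K * norm (orth_proj V x)" unfolding T_def by (rule K[OF P(1)])
        also have "\<dots> \<le> \<bar>K\<bar> * norm (orth_proj V x)" by (intro mult_right_mono) auto
        also have "\<dots> \<le> \<bar>K\<bar> * (norm x * L)" by (intro mult_left_mono L) auto
        finally show ?thesis by (simp add: mult_ac)
      qed
      then show "\<exists>K. \<forall>x. norm (T n x) \<le> norm x * K" by blast
    qed
  qed
  have "\<exists>K. \<forall>n\<in>UNIV. norm (T n x) \<le> K" for x
  proof -
    have "(\<lambda>n. T n x) \<longlonglongrightarrow> orth_proj V x"
      unfolding T_def by (rule filterlim_compose[OF semigroup_cont[OF P(1)] t0])
    then have "Bseq (\<lambda>n. T n x)" by (rule convergent_imp_Bseq[OF convergentI])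
    then show ?thesis unfolding Bseq_def by blast
  qed
  from uniform_boundedness[OF Tlin this] obtain K where K: "\<And>n x. norm (T n x) \<le> K * norm x"
    by auto
  obtain n where n: "K \<le> real n" using real_arch_simple by blast
  obtain x where x: "x \<in> V" "\<not> norm (S (t n) x) \<le> real n * norm x" using ex by blast
  have "norm (S (t n) x) \<le> K * norm x" using K[of n x] P(2)[OF x(1)] by (simp add: T_def)
  also have "\<dots> \<le> real n * norm x" using n by (intro mult_right_mono) auto
  finally show False using x(2) by blast
qed

lemma semigroup_locally_bounded:
  obtains M where "1 \<le> M" "\<And>t x. 0 \<le> t \<Longrightarrow> t \<le> b \<Longrightarrow> x \<in> V \<Longrightarrow> norm (S t x) \<le> M * norm x"
proof -
  obtain n :: nat where n: "\<And>t x. 0 < t \<Longrightarrow> t \<le> inverse (real (Suc n)) \<Longrightarrow> x \<in> V \<Longrightarrow>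
      norm (S t x) \<le> real n * norm x" using semigroup_bounded_near_0 by blast
  define d where "d = inverse (real (Suc n))"
  define M where "M = real n + 1"
  have d: "0 < d" by (simp add: d_def)
  have M: "1 \<le> M" by (simp add: M_def)
  have short: "norm (S t x) \<le> M * norm x" if "0 \<le> t" "t \<le> d" "x \<in> V" for t x
  proof (cases "t = 0")
    case True
    then show ?thesis using semigroup_0[OF that(3)] mult_right_mono[OF M norm_ge_zero[of x]] by simp
  next
    case False
    then have "norm (S t x) \<le> real n * norm x" using n[of t x] that by (simp add: d_def)
    then show ?thesis unfolding M_def by (simp add: distrib_right add_increasing2)
  qed
  have long: "norm (S t x) \<le> M ^ Suc k * norm x" if "0 \<le> t" "t \<le> real (Suc k) * d" "x \<in> V" for t k x
    using that
  proof (induction k arbitrary: t)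
    case 0
    then show ?case using short by simp
  next
    case (Suc k)
    show ?case
    proof (cases "t \<le> d")
      case True
      have "norm (S t x) \<le> M * norm x" using short Suc.prems True by blast
      also have "\<dots> \<le> M ^ Suc (Suc k) * norm x"
        using M by (intro mult_right_mono self_le_power) auto
      finally show ?thesis .
    next
      case False
      then have s: "0 \<le> t - d" "t - d \<le> real (Suc k) * d" using Suc.prems by (auto simp: algebra_simps)
      have "S t x = S d (S (t - d) x)" using semigroup_comp[of d "t - d" x] s d Suc.prems by simp
      also have "norm \<dots> \<le> M * norm (S (t - d) x)"
        by (rule short) (use semigroup_mem[of "t - d" x] s d Suc.prems in auto)
      also have "\<dots> \<le> M * (M ^ Suc k * norm x)"
        using Suc.IH[OF s Suc.prems(3)] M by (intro mult_left_mono) auto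
      finally show ?thesis by (simp add: mult_ac)
    qed
  qed
  obtain k where k: "b / d \<le> real k" using real_arch_simple by blast
  have "b \<le> real (Suc k) * d" using k d by (simp add: field_simps)
  then show thesis
    using that[of "M ^ Suc k"] long[of _ k] one_le_power[OF M, of "Suc k"] order_trans by blast
qed

lemma semigroup_quotient:
  assumes t: "0 \<le> t" and h: "0 < h" and x: "x \<in> V" and y: "y \<in> V"
  shows "(S h (S t x) - S t x) /\<^sub>R h - S t y = S t ((S h x - x) /\<^sub>R h - y)"
    and "(S h x - x) /\<^sub>R h - y \<in> V"
proof -
  note mem = semigroup_mem[OF less_imp_le[OF h] x]
  have sub: "S h x - x \<in> V" using V(1) mem x by (rule subspace_diff)
  have "S t (S h x - x) = S h (S t x) - S t x"
    using semigroup_lin[OF t mem x, of 1 "-1"] semigroup_comp[of t h x] semigroup_comp[of h t x] t h x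
    by (simp add: add.commute)
  then show "(S h (S t x) - S t x) /\<^sub>R h - S t y = S t ((S h x - x) /\<^sub>R h - y)"
    using semigroup_lin[OF t sub y, of "inverse h" "-1"] by simp
  show "(S h x - x) /\<^sub>R h - y \<in> V"
    using V(1) sub y by (meson subspace_diff subspace_scale)
qed

lemma semigroup_generator_invariant:
  assumes xy: "(x, y) \<in> semigroup_generator V S" and t: "0 \<le> t"
  shows "(S t x, S t y) \<in> semigroup_generator V S"
proof -
  have m: "x \<in> V" "y \<in> V" and lim: "((\<lambda>h. (S h x - x) /\<^sub>R h) \<longlongrightarrow> y) (at_right 0)"
    using xy by (auto simp: semigroup_generator_def)
  obtain K where K: "\<And>x. x \<in> V \<Longrightarrow> norm (S t x) \<le> K * norm x"
    using semigroup_bounded[OF t] by blast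
  have "((\<lambda>h. (S h (S t x) - S t x) /\<^sub>R h - S t y) \<longlongrightarrow> 0) (at_right 0)"
  proof (rule Lim_null_comparison)
    show "\<forall>\<^sub>F h in at_right 0. norm ((S h (S t x) - S t x) /\<^sub>R h - S t y)
        \<le> K * norm ((S h x - x) /\<^sub>R h - y)"
      unfolding eventually_at_right_field
      using semigroup_quotient[OF t _ m] K by (intro exI[of _ 1]) simp
    have "((\<lambda>h. K * norm ((S h x - x) /\<^sub>R h - y)) \<longlongrightarrow> K * norm (y - y)) (at_right 0)"
      by (intro tendsto_intros lim)
    then show "((\<lambda>h. K * norm ((S h x - x) /\<^sub>R h - y)) \<longlongrightarrow> 0) (at_right 0)" by simp
  qed
  then show ?thesis using m semigroup_mem t by (simp add: semigroup_generator_def LIM_zero_iff)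
qed

text \<open>The time \<open>t\<close> is cut into steps of length \<open>h\<close>, which are moved one at a time from the first factor of
\<open>S t x \<bullet> x'\<close> to the second. Symmetry of the generator cancels the term of order \<open>h\<close>, and local
boundedness makes the error \<open>o(h)\<close> uniform in the position of the step, so all steps together cost
\<open>o(1)\<close>.\<close>

lemma semigroup_symmetric:
  assumes sym: "\<And>x y x' y'. (x, y) \<in> semigroup_generator V S \<Longrightarrow>
      (x', y') \<in> semigroup_generator V S \<Longrightarrow> y \<bullet> x' = x \<bullet> y'"
    and xy: "(x, y) \<in> semigroup_generator V S" and xy': "(x', y') \<in> semigroup_generator V S"
    and t: "0 < t"
  shows "S t x \<bullet> x' = x \<bullet> S t x'"
proof -
  have m: "x \<in> V" "y \<in> V" and lim: "((\<lambda>h. (S h x - x) /\<^sub>R h) \<longlongrightarrow> y) (at_right 0)"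
    and m': "x' \<in> V" "y' \<in> V" and lim': "((\<lambda>h. (S h x' - x') /\<^sub>R h) \<longlongrightarrow> y') (at_right 0)"
    using xy xy' by (auto simp: semigroup_generator_def)
  obtain M where M: "1 \<le> M"
    "\<And>s x. 0 \<le> s \<Longrightarrow> s \<le> t \<Longrightarrow> x \<in> V \<Longrightarrow> norm (S s x) \<le> M * norm x"
    using semigroup_locally_bounded[of t] by blast
  define e where "e h = norm ((S h x - x) /\<^sub>R h - y)" for h
  define e' where "e' h = norm ((S h x' - x') /\<^sub>R h - y')" for h
  \<comment> \<open>shifting one step of length \<open>h\<close> from one factor to the other costs \<open>o(h)\<close>\<close>
  have shift: "\<bar>S h (S r x) \<bullet> S s x' - S r x \<bullet> S h (S s x')\<bar> \<le> h * (M\<^sup>2 * (e h * norm x' + norm x * e' h))"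
    if h: "0 < h" and r: "0 \<le> r" "r \<le> t" and s: "0 \<le> s" "s \<le> t" for h r s
  proof -
    define d where "d = (S h x - x) /\<^sub>R h - y"
    define d' where "d' = (S h x' - x') /\<^sub>R h - y'"
    note q = semigroup_quotient[OF r(1) h m, folded d_def]
    note q' = semigroup_quotient[OF s(1) h m', folded d'_def]
    have "h *\<^sub>R ((S h (S r x) - S r x) /\<^sub>R h - S r y) = h *\<^sub>R S r d" using q(1) by simp
    then have 1: "S h (S r x) = S r x + h *\<^sub>R S r y + h *\<^sub>R S r d"
      using h by (simp add: scaleR_diff_right algebra_simps)
    have "h *\<^sub>R ((S h (S s x') - S s x') /\<^sub>R h - S s y') = h *\<^sub>R S s d'" using q'(1) by simp
    then have 2: "S h (S s x') = S s x' + h *\<^sub>R S s y' + h *\<^sub>R S s d'"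
      using h by (simp add: scaleR_diff_right algebra_simps)
    have 3: "S r y \<bullet> S s x' = S r x \<bullet> S s y'"
      by (rule sym) (use semigroup_generator_invariant xy xy' r s in auto)
    have "S h (S r x) \<bullet> S s x' - S r x \<bullet> S h (S s x') = h * (S r d \<bullet> S s x' - S r x \<bullet> S s d')"
      unfolding 1 2 using 3 by (simp add: inner_add_left inner_add_right algebra_simps)
    also have "\<bar>\<dots>\<bar> = h * \<bar>S r d \<bullet> S s x' - S r x \<bullet> S s d'\<bar>" using h by (simp add: abs_mult)
    also have "\<dots> \<le> h * (M\<^sup>2 * (e h * norm x' + norm x * e' h))"
    proof (intro mult_left_mono)
      have "\<bar>S r d \<bullet> S s x'\<bar> \<le> norm (S r d) * norm (S s x')" by (rule Cauchy_Schwarz_ineq2)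
      also have "\<dots> \<le> (M * norm d) * (M * norm x')"
        using M r s q(2) m' by (intro mult_mono) auto
      finally have a: "\<bar>S r d \<bullet> S s x'\<bar> \<le> M\<^sup>2 * (e h * norm x')"
        by (simp add: e_def d_def power2_eq_square mult_ac)
      have "\<bar>S r x \<bullet> S s d'\<bar> \<le> norm (S r x) * norm (S s d')" by (rule Cauchy_Schwarz_ineq2)
      also have "\<dots> \<le> (M * norm x) * (M * norm d')"
        using M r s q'(2) m by (intro mult_mono) auto
      finally have "\<bar>S r x \<bullet> S s d'\<bar> \<le> M\<^sup>2 * (norm x * e' h)"
        by (simp add: e'_def d'_def power2_eq_square mult_ac)
      with a show "\<bar>S r d \<bullet> S s x' - S r x \<bullet> S s d'\<bar> \<le> M\<^sup>2 * (e h * norm x' + norm x * e' h)"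
        unfolding distrib_left by linarith
    qed (use h in auto)
    finally show ?thesis .
  qed
  \<comment> \<open>the total cost of all steps of length \<open>h\<close>\<close>
  define E where "E h = t * (M\<^sup>2 * (e h * norm x' + norm x * e' h))" for h
  have bound: "\<bar>S t x \<bullet> x' - x \<bullet> S t x'\<bar> \<le> E (t / real (Suc N))" for N
  proof -
    define h where "h = t / real (Suc N)"
    have h: "0 < h" "real (Suc N) * h = t" using t by (auto simp: h_def)
    have "\<bar>S t x \<bullet> x' - S (t - real k * h) x \<bullet> S (real k * h) x'\<bar>
        \<le> real k * (h * (M\<^sup>2 * (e h * norm x' + norm x * e' h)))" if "k \<le> Suc N" for k
      using that
    proof (induction k)
      case 0
      then show ?case using semigroup_0[OF m'(1)] by simp
    next
      case (Suc k)
      define r where "r = t - real (Suc k) * h"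
      define s where "s = real k * h"
      have "real (Suc k) * h \<le> real (Suc N) * h"
        using Suc.prems h by (intro mult_right_mono) auto
      moreover have "real k * h \<le> real (Suc N) * h"
        using Suc.prems h by (intro mult_right_mono) auto
      ultimately have rs: "0 \<le> r" "r \<le> t" "0 \<le> s" "s \<le> t"
        using h by (auto simp: r_def s_def algebra_simps)
      have e1: "S h (S r x) = S (t - real k * h) x"
        using semigroup_comp[of h r x] h rs m by (simp add: r_def algebra_simps)
      have e2: "S h (S s x') = S (real (Suc k) * h) x'"
        using semigroup_comp[of h s x'] h rs m' by (simp add: s_def algebra_simps)
      define B where "B = h * (M\<^sup>2 * (e h * norm x' + norm x * e' h))"
      have "\<bar>S t x \<bullet> x' - S (t - real k * h) x \<bullet> S s x'\<bar> \<le> real k * B"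
        using Suc unfolding s_def B_def by simp
      moreover have "\<bar>S (t - real k * h) x \<bullet> S s x' - S r x \<bullet> S (real (Suc k) * h) x'\<bar> \<le> B"
        using shift[OF h(1) rs] unfolding e1 e2 B_def .
      ultimately show ?case
        unfolding r_def[symmetric] B_def[symmetric] by (simp add: distrib_right)
    qed
    from this[of "Suc N"] show ?thesis
      using h semigroup_0[OF m(1)] unfolding E_def h_def[symmetric] by (simp add: mult.assoc[symmetric] del: of_nat_Suc)
  qed
  have "(\<lambda>N. t * inverse (real (Suc N))) \<longlonglongrightarrow> t * 0"
    by (intro tendsto_intros LIMSEQ_inverse_real_of_nat)
  then have "filterlim (\<lambda>N. t / real (Suc N)) (at_right 0) sequentially"
    unfolding filterlim_at using t by (auto simp: field_simps)
  moreover have "(E \<longlongrightarrow> t * (M\<^sup>2 * (norm (y - y) * norm x' + norm x * norm (y' - y')))) (at_right 0)"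
    unfolding E_def e_def e'_def by (intro tendsto_intros lim lim')
  ultimately have "(\<lambda>N. E (t / real (Suc N))) \<longlonglongrightarrow> 0"
    using filterlim_compose by fastforce
  then have "\<bar>S t x \<bullet> x' - x \<bullet> S t x'\<bar> \<le> 0"
    by (rule LIMSEQ_le_const) (use bound in blast)
  then show ?thesis by simp
qed

text \<open>For a symmetric semigroup \<open>g t = S t x \<bullet> x\<close> satisfies \<open>g (2 * t) = (norm (S t x))\<^sup>2\<close>, hence
\<open>(g t)\<^sup>2 \<le> g 0 * g (2 * t)\<close>. If \<open>g t\<close> exceeded \<open>g 0 * exp (- k * t)\<close> for some \<open>t\<close>, repeated
doubling of \<open>t\<close> would square the quotient of the two each time and contradict the decay. So the decay
holds with constant \<open>1\<close>, and the derivative at \<open>t = 0\<close> inherits it. Only the orbit of \<open>x\<close> enters,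
so the decay may be restricted to a set of initial values that the semigroup is not known to preserve.\<close>

lemma semigroup_decay_imp_dissipative:
  assumes sym: "\<And>x y x' y'. (x, y) \<in> semigroup_generator V S \<Longrightarrow>
      (x', y') \<in> semigroup_generator V S \<Longrightarrow> y \<bullet> x' = x \<bullet> y'"
    and xy: "(x, y) \<in> semigroup_generator V S"
    and decay: "\<And>t. 0 \<le> t \<Longrightarrow> norm (S t x) \<le> K * exp (- k * t)"
  shows "y \<bullet> x \<le> - k * (norm x)\<^sup>2"
proof -
  have m: "x \<in> V" "y \<in> V" and lim: "((\<lambda>h. (S h x - x) /\<^sub>R h) \<longlongrightarrow> y) (at_right 0)"
    using xy by (auto simp: semigroup_generator_def)
  define a where "a = (norm x)\<^sup>2"
  define g where "g t = S t x \<bullet> x" for t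
  have sq: "(norm (S t x))\<^sup>2 = g (2 * t)" if "0 < t" for t
    using semigroup_symmetric[OF sym semigroup_generator_invariant[OF xy] xy that, of t]
      semigroup_comp[of t t x] m that
    by (simp add: g_def power2_norm_eq_inner)
  have gle: "g t \<le> a * exp (- k * t)" if t: "0 < t" for t
  proof (cases "x = 0")
    case False
    then have a: "0 < a" by (simp add: a_def)
    \<comment> \<open>the claim is that this quotient never exceeds 1\<close>
    define \<rho> where "\<rho> t = g t * exp (k * t) / a" for t
    have g2: "(g t)\<^sup>2 \<le> g (2 * t) * a" if "0 < t" for t
    proof -
      have "\<bar>g t\<bar> \<le> norm (S t x) * norm x" unfolding g_def by (rule Cauchy_Schwarz_ineq2)
      then have "\<bar>g t\<bar>\<^sup>2 \<le> (norm (S t x) * norm x)\<^sup>2" by (intro power_mono) auto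
      then show ?thesis using sq[OF that] by (simp add: power_mult_distrib a_def)
    qed
    have \<rho>2: "(\<rho> t)\<^sup>2 \<le> \<rho> (2 * t)" if "0 < t" for t
    proof -
      have "(\<rho> t)\<^sup>2 = (g t)\<^sup>2 * exp (k * (2 * t)) / a\<^sup>2"
        by (simp add: \<rho>_def power_mult_distrib power_divide exp_double[symmetric] mult_ac)
      also have "\<dots> \<le> (g (2 * t) * a) * exp (k * (2 * t)) / a\<^sup>2"
        using g2[OF that] by (intro divide_right_mono mult_right_mono) auto
      also have "\<dots> = \<rho> (2 * t)" using a by (simp add: \<rho>_def power2_eq_square)
      finally show ?thesis .
    qed
    have \<rho>b: "\<rho> t \<le> K * norm x / a" if "0 < t" for t
    proof -
      have "g t \<le> norm (S t x) * norm x" unfolding g_def by (rule norm_cauchy_schwarz)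
      also have "\<dots> \<le> K * exp (- k * t) * norm x" using decay that by (intro mult_right_mono) auto
      finally have "g t * exp (k * t) \<le> K * exp (- k * t) * norm x * exp (k * t)"
        by (intro mult_right_mono) auto
      also have "\<dots> = K * norm x" by (simp add: exp_minus)
      finally show ?thesis unfolding \<rho>_def using a by (intro divide_right_mono) auto
    qed
    have "\<rho> t \<le> 1"
    proof (rule ccontr)
      assume "\<not> \<rho> t \<le> 1"
      then have gt: "1 < \<rho> t" by simp
      have "\<rho> t ^ (2 ^ j) \<le> \<rho> (2 ^ j * t)" for j
      proof (induction j)
        case (Suc j)
        have "\<rho> t ^ (2 ^ Suc j) = (\<rho> t ^ (2 ^ j))\<^sup>2" by (simp add: power_mult[symmetric] mult.commute)
        also have "\<dots> \<le> (\<rho> (2 ^ j * t))\<^sup>2" using Suc gt by (intro power_mono) auto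
        also have "\<dots> \<le> \<rho> (2 * (2 ^ j * t))" using \<rho>2[of "2 ^ j * t"] t by simp
        finally show ?case by (simp add: mult_ac)
      qed simp
      moreover have "\<rho> t ^ j \<le> \<rho> t ^ (2 ^ j)" for j
        using gt by (intro power_increasing) (auto simp: less_imp_le)
      ultimately have "\<rho> t ^ j \<le> K * norm x / a" for j
        using \<rho>b[of "2 ^ j * t"] t by (meson order_trans zero_less_mult_iff zero_less_numeral zero_less_power)
      moreover obtain j where "K * norm x / a < \<rho> t ^ j" using real_arch_pow[OF gt] by blast
      ultimately show False by (meson not_less)
    qed
    then have "g t * exp (k * t) \<le> a" using a by (simp add: \<rho>_def)
    then show ?thesis by (simp add: exp_minus field_simps)
  qed (simp add: g_def a_def)
  have "((\<lambda>h. ((S h x - x) /\<^sub>R h) \<bullet> x) \<longlongrightarrow> y \<bullet> x) (at_right 0)" by (intro tendsto_intros lim)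
  moreover have "((\<lambda>h. a * ((exp (- k * h) - 1) / h)) \<longlongrightarrow> a * (- k)) (at_right 0)"
  proof (intro tendsto_intros)
    have "((\<lambda>h. exp (- k * h)) has_real_derivative - k) (at 0)"
      by (auto intro!: derivative_eq_intros)
    then have "((\<lambda>h. (exp (- k * h) - 1) / h) \<longlongrightarrow> - k) (at 0)"
      by (simp add: has_field_derivative_iff)
    then show "((\<lambda>h. (exp (- k * h) - 1) / h) \<longlongrightarrow> - k) (at_right 0)"
      by (rule tendsto_mono[rotated]) (simp add: at_le)
  qed
  moreover have "\<forall>\<^sub>F h in at_right 0. ((S h x - x) /\<^sub>R h) \<bullet> x \<le> a * ((exp (- k * h) - 1) / h)"
    unfolding eventually_at_right_field
  proof (intro exI[of _ 1] conjI allI impI)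
    fix h :: real assume "0 < h"
    then show "((S h x - x) /\<^sub>R h) \<bullet> x \<le> a * ((exp (- k * h) - 1) / h)"
      using gle[of h] by (simp add: inner_diff_left g_def a_def power2_norm_eq_inner field_simps)
  qed simp
  ultimately have "y \<bullet> x \<le> a * (- k)"
    using tendsto_le[OF trivial_limit_at_right_real] by blast
  then show ?thesis by (simp add: a_def mult.commute)
qed

end

section \<open>First and second derivatives\<close>

lemma smooth_onE:
  assumes "smooth_on S f"
  obtains D where "\<And>x. x \<in> S \<Longrightarrow> D 0 x [] = f x"
    "\<And>x n. x \<in> S \<Longrightarrow> bounded_multilinear n (D n x)"
    "\<And>x n e. x \<in> S \<Longrightarrow> 0 < e \<Longrightarrow> \<exists>d>0. \<forall>y\<in>S. dist y x < d \<longrightarrow>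
        (\<forall>vs. length vs = n \<longrightarrow> norm (D n y vs - D n x vs - D (Suc n) x ((y - x) # vs))
           \<le> e * norm (y - x) * prod_list (map norm vs))"
proof -
  from assms obtain D where D: "\<forall>x\<in>S. D 0 x [] = f x \<and>
      (\<forall>n. bounded_multilinear n (D n x) \<and> (\<forall>e>0. \<exists>d>0. \<forall>y\<in>S. dist y x < d \<longrightarrow>
        (\<forall>vs. length vs = n \<longrightarrow> norm (D n y vs - D n x vs - D (Suc n) x ((y - x) # vs))
           \<le> e * norm (y - x) * prod_list (map norm vs))))"
    unfolding smooth_on_def by (elim exE)
  show thesis
    by (rule that[of D]) (simp_all only: D[rule_format])
qed

lemma bounded_multilinear_1:
  assumes "bounded_multilinear 1 A"
  shows "bounded_linear (\<lambda>v. A [v])"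
proof -
  have "\<forall>vs i. length vs = 1 \<and> i < 1 \<longrightarrow> linear (\<lambda>v. A (vs[i := v]))"
    using assms unfolding bounded_multilinear_def by (rule conjunct1)
  from this[rule_format, of "[0]" 0] have lin: "linear (\<lambda>v. A [v])" by simp
  obtain K where "\<forall>vs. length vs = 1 \<longrightarrow> norm (A vs) \<le> K * prod_list (map norm vs)"
    using assms unfolding bounded_multilinear_def by (elim conjE exE)
  from this[rule_format, of "[_]"] have K: "norm (A [v]) \<le> K * norm v" for v by simp
  show ?thesis
    using lin K by (intro bounded_linear.intro bounded_linear_axioms.intro exI[of _ K])
      (simp_all add: mult.commute)
qed

lemma smooth_on_derivative:
  fixes f :: "'a::real_normed_vector \<Rightarrow> 'b::real_normed_vector"
  assumes S: "open S" "x \<in> S" and D0: "\<And>x. x \<in> S \<Longrightarrow> D 0 x [] = f x"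
    and ml: "bounded_multilinear 1 (D 1 x)"
    and D1: "\<And>e. 0 < e \<Longrightarrow> \<exists>d>0. \<forall>y\<in>S. dist y x < d \<longrightarrow>
        (\<forall>vs. length vs = 0 \<longrightarrow> norm (D 0 y vs - D 0 x vs - D (Suc 0) x ((y - x) # vs))
           \<le> e * norm (y - x) * prod_list (map norm vs))"
  shows "(f has_derivative (\<lambda>v. D 1 x [v])) (at x)"
proof -
  have "(f has_derivative (\<lambda>v. D 1 x [v])) (at x within S)"
    unfolding has_derivative_within_alt
  proof (intro conjI allI impI)
    show "bounded_linear (\<lambda>v. D 1 x [v])" by (rule bounded_multilinear_1[OF ml])
    fix e :: real assume "0 < e"
    from D1[OF this] obtain d where d: "0 < d" "\<And>y. y \<in> S \<Longrightarrow> dist y x < d \<Longrightarrow>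
        norm (D 0 y [] - D 0 x [] - D 1 x [y - x]) \<le> e * norm (y - x)" by auto
    show "\<exists>d>0. \<forall>y\<in>S. norm (y - x) < d \<longrightarrow>
        norm (f y - f x - D 1 x [y - x]) \<le> e * norm (y - x)"
      using d S(2) by (intro exI[of _ d]) (simp add: D0 dist_norm)
  qed
  then show ?thesis by (simp only: at_within_open[OF S(2,1)])
qed

lemma smooth_on_differentiable:
  fixes f :: "'a::real_normed_vector \<Rightarrow> 'b::real_normed_vector"
  assumes f: "smooth_on S f" and S: "open S" "x \<in> S"
  shows "f differentiable (at x)"
proof -
  obtain D where D: "\<And>x. x \<in> S \<Longrightarrow> D 0 x [] = f x"
    "\<And>x n. x \<in> S \<Longrightarrow> bounded_multilinear n (D n x)"
    "\<And>x n e. x \<in> S \<Longrightarrow> 0 < e \<Longrightarrow> \<exists>d>0. \<forall>y\<in>S. dist y x < d \<longrightarrow>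
        (\<forall>vs. length vs = n \<longrightarrow> norm (D n y vs - D n x vs - D (Suc n) x ((y - x) # vs))
           \<le> e * norm (y - x) * prod_list (map norm vs))"
    by (rule smooth_onE[OF f], rule that)
  show ?thesis
    using smooth_on_derivative[where D = D, OF S D(1) D(2)[OF S(2)] D(3)[OF S(2)]]
    unfolding differentiable_def by blast
qed

lemma has_derivative_fderiv:
  assumes "f differentiable (at x)"
  shows "(f has_derivative blinfun_apply (fderiv f x)) (at x)"
proof -
  have d: "(f has_derivative frechet_derivative f (at x)) (at x)"
    using assms frechet_derivative_works by blast
  then show ?thesis
    unfolding fderiv_def by (simp add: bounded_linear_Blinfun_apply has_derivative_bounded_linear)
qed

lemma smooth_energy_grad:
  assumes "smooth_on UNIV J"
  shows "(J has_derivative blinfun_apply (grad J u)) (at u)"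
  unfolding grad_def by (rule has_derivative_fderiv[OF smooth_on_differentiable[OF assms]]) auto

text \<open>The second term of the sequence of derivatives, curried, is the derivative of the gradient in the
operator norm, because the error bound of \<open>smooth_on\<close> is uniform over the last argument.\<close>

lemma smooth_energy_hess:
  fixes J :: "'h::real_inner \<Rightarrow> real"
  assumes J: "smooth_on UNIV J"
  shows "(grad J has_derivative blinfun_apply (hess J u)) (at u)"
  unfolding hess_def
proof (rule has_derivative_fderiv)
  obtain D where "\<And>x. x \<in> UNIV \<Longrightarrow> D 0 x [] = J x"
    "\<And>x n. x \<in> UNIV \<Longrightarrow> bounded_multilinear n (D n x)"
    "\<And>x n e. x \<in> UNIV \<Longrightarrow> 0 < e \<Longrightarrow> \<exists>d>0. \<forall>y\<in>UNIV. dist y x < d \<longrightarrow>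
        (\<forall>vs. length vs = n \<longrightarrow> norm (D n y vs - D n x vs - D (Suc n) x ((y - x) # vs))
           \<le> e * norm (y - x) * prod_list (map norm vs))"
    by (rule smooth_onE[OF J], rule that)
  note D = this[OF UNIV_I]
  have grad: "blinfun_apply (grad J x) v = D 1 x [v]" for x v
    using has_derivative_unique[OF smooth_energy_grad[OF J, of x]
        smooth_on_derivative[where D = D, OF open_UNIV UNIV_I D(1) D(2) D(3)]] by metis
  have lin2: "\<forall>vs i. length vs = 2 \<and> i < 2 \<longrightarrow> linear (\<lambda>v. D 2 u (vs[i := v]))"
    using D(2)[of 2 u] unfolding bounded_multilinear_def by (rule conjunct1)
  have l0: "linear (\<lambda>v. D 2 u [v, w])" for w
    using lin2[rule_format, of "[0, w]" 0] by simp
  have l1: "linear (\<lambda>w. D 2 u [v, w])" for v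
    using lin2[rule_format, of "[v, 0]" 1] by simp
  obtain K where "\<forall>vs. length vs = 2 \<longrightarrow> norm (D 2 u vs) \<le> K * prod_list (map norm vs)"
    using D(2)[of 2 u] unfolding bounded_multilinear_def by (elim conjE exE)
  from this[rule_format, of "[_, _]"] have K: "norm (D 2 u [v, w]) \<le> K * (norm v * norm w)" for v w by simp
  have K': "norm (D 2 u [v, w]) \<le> \<bar>K\<bar> * norm v * norm w" for v w
    using order_trans[OF K mult_right_mono[OF abs_ge_self]] by (simp add: mult.assoc)
  have blD: "bounded_linear (\<lambda>w. D 2 u [v, w])" for v
    using l1 K' by (intro bounded_linear.intro bounded_linear_axioms.intro)
      (auto simp: mult.commute intro!: exI[of _ "\<bar>K\<bar> * norm v"])
  define A where "A v = Blinfun (\<lambda>w. D 2 u [v, w])" for v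
  have A: "blinfun_apply (A v) w = D 2 u [v, w]" for v w
    unfolding A_def by (simp add: bounded_linear_Blinfun_apply[OF blD])
  have "bounded_linear A"
  proof
    show "A (x + y) = A x + A y" for x y
      by (rule blinfun_eqI) (simp add: A blinfun.add_left linear_add[OF l0])
    show "A (r *\<^sub>R x) = r *\<^sub>R A x" for r x
      by (rule blinfun_eqI) (simp add: A blinfun.scaleR_left linear_scale[OF l0])
    have "norm (A x) \<le> norm x * \<bar>K\<bar>" for x
      by (rule norm_blinfun_bound) (use K'[of x] in \<open>simp_all add: A mult_ac\<close>)
    then show "\<exists>K. \<forall>x. norm (A x) \<le> norm x * K" by blast
  qed
  moreover have "\<exists>d>0. \<forall>y. norm (y - u) < d \<longrightarrow>
      norm (grad J y - grad J u - A (y - u)) \<le> e * norm (y - u)" if e: "0 < e" for e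
  proof -
    obtain d where d: "0 < d" "\<And>y vs. dist y u < d \<Longrightarrow> length vs = 1 \<Longrightarrow>
        norm (D 1 y vs - D 1 u vs - D (Suc 1) u ((y - u) # vs))
          \<le> e * norm (y - u) * prod_list (map norm vs)"
      using D(3)[OF e, of u 1] by (elim exE conjE) simp
    have "norm (grad J y - grad J u - A (y - u)) \<le> e * norm (y - u)" if "norm (y - u) < d" for y
    proof (rule norm_blinfun_bound)
      fix w
      show "norm (blinfun_apply (grad J y - grad J u - A (y - u)) w) \<le> e * norm (y - u) * norm w"
        using d(2)[of y "[w]"] that
        by (simp add: dist_norm blinfun.diff_left A grad numeral_2_eq_2)
    qed (use e in simp)
    then show ?thesis using d(1) by blast
  qed
  ultimately have "(grad J has_derivative A) (at u)"
    unfolding has_derivative_at_alt by blast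
  then show "grad J differentiable (at u)" by (auto simp: differentiable_def)
qed

lemma has_real_derivative_along_line:
  fixes f :: "'a::real_normed_vector \<Rightarrow> real"
  assumes f: "\<And>x. (f has_derivative blinfun_apply (f' x)) (at x)"
  shows "((\<lambda>t. f (x + t *\<^sub>R v)) has_real_derivative blinfun_apply (f' (x + t *\<^sub>R v)) v) (at t)"
proof -
  have "((\<lambda>t. x + t *\<^sub>R v) has_derivative (\<lambda>t. t *\<^sub>R v)) (at t)"
    by (auto intro!: derivative_eq_intros)
  from has_derivative_compose[OF this f] show ?thesis
    unfolding has_field_derivative_def
    by (rule has_derivative_eq_rhs) (simp add: fun_eq_iff blinfun.scaleR_right)
qed

text \<open>The mean value theorem in direction \<open>v\<close>, applied to the increment of \<open>f\<close> in direction \<open>s *\<^sub>R w\<close>,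
turns the second difference into a difference of two first derivatives.\<close>

lemma second_difference_estimate:
  fixes f :: "'a::real_normed_vector \<Rightarrow> real"
  assumes f: "\<And>x. (f has_derivative blinfun_apply (f' x)) (at x)"
    and f'': "\<And>y. norm (y - x) < d \<Longrightarrow> norm (f' y - f' x - blinfun_apply f'' (y - x)) \<le> e * norm (y - x)"
    and s: "0 < s" "s * (norm v + norm w) < d" and e: "0 \<le> e"
  shows "\<bar>f (x + s *\<^sub>R v + s *\<^sub>R w) - f (x + s *\<^sub>R v) - f (x + s *\<^sub>R w) + f x
            - s\<^sup>2 * blinfun_apply (blinfun_apply f'' w) v\<bar> \<le> 2 * e * s\<^sup>2 * (norm v + norm w)\<^sup>2"
proof -
  define h where "h t = f (x + s *\<^sub>R w + t *\<^sub>R (s *\<^sub>R v)) - f (x + t *\<^sub>R (s *\<^sub>R v))" for t :: real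
  have dh: "(h has_real_derivative (blinfun_apply (f' (x + s *\<^sub>R w + t *\<^sub>R (s *\<^sub>R v))) (s *\<^sub>R v)
      - blinfun_apply (f' (x + t *\<^sub>R (s *\<^sub>R v))) (s *\<^sub>R v))) (at t)" for t
    unfolding h_def by (intro DERIV_diff has_real_derivative_along_line f)
  obtain t where t: "0 < t" "t < 1" "h 1 - h 0 = (1 - 0) *
     (blinfun_apply (f' (x + s *\<^sub>R w + t *\<^sub>R (s *\<^sub>R v))) (s *\<^sub>R v)
      - blinfun_apply (f' (x + t *\<^sub>R (s *\<^sub>R v))) (s *\<^sub>R v))"
    using MVT2[of 0 1 h, OF zero_less_one dh] by blast
  define N where "N = norm v + norm w"
  have near: "\<bar>blinfun_apply (f' y) v - blinfun_apply (f' x) v - blinfun_apply (blinfun_apply f'' (y - x)) v\<bar>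
      \<le> e * s * N\<^sup>2" if y: "norm (y - x) \<le> s * N" for y
  proof -
    have "\<bar>blinfun_apply (f' y) v - blinfun_apply (f' x) v - blinfun_apply (blinfun_apply f'' (y - x)) v\<bar>
        = norm (blinfun_apply (f' y - f' x - blinfun_apply f'' (y - x)) v)"
      by (simp add: blinfun.diff_left)
    also have "\<dots> \<le> norm (f' y - f' x - blinfun_apply f'' (y - x)) * norm v" by (rule norm_blinfun)
    also have "\<dots> \<le> (e * (s * N)) * N"
      using f''[of y] y s e mult_left_mono[OF y e]
      by (intro mult_mono) (auto simp: N_def)
    finally show ?thesis by (simp add: power2_eq_square mult_ac)
  qed
  have tv: "norm (t *\<^sub>R (s *\<^sub>R v)) \<le> s * norm v"
    using t s by (simp add: mult_left_le_one_le)
  have n1: "norm (x + s *\<^sub>R w + t *\<^sub>R (s *\<^sub>R v) - x) \<le> s * N"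
    using norm_triangle_ineq[of "s *\<^sub>R w" "t *\<^sub>R (s *\<^sub>R v)"] tv s by (simp add: N_def distrib_left)
  have n2: "norm (x + t *\<^sub>R (s *\<^sub>R v) - x) \<le> s * N"
    using tv s by (simp add: N_def distrib_left add_increasing2)
  define G where "G = blinfun_apply (f' (x + s *\<^sub>R w + t *\<^sub>R (s *\<^sub>R v))) v - blinfun_apply (f' (x + t *\<^sub>R (s *\<^sub>R v))) v"
  have "\<bar>G - s * blinfun_apply (blinfun_apply f'' w) v\<bar> \<le> 2 * (e * s * N\<^sup>2)"
    using near[OF n1] near[OF n2] unfolding G_def
    by (simp add: blinfun.add_right blinfun.add_left blinfun.scaleR_right blinfun.scaleR_left)
  then have "s * \<bar>G - s * blinfun_apply (blinfun_apply f'' w) v\<bar> \<le> s * (2 * (e * s * N\<^sup>2))"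
    using s by (intro mult_left_mono) auto
  also have "s * (2 * (e * s * N\<^sup>2)) = 2 * e * s\<^sup>2 * (norm v + norm w)\<^sup>2"
    by (simp add: power2_eq_square N_def)
  also have "s * \<bar>G - s * blinfun_apply (blinfun_apply f'' w) v\<bar>
      = \<bar>s * (G - s * blinfun_apply (blinfun_apply f'' w) v)\<bar>"
    using s by (simp add: abs_mult)
  also have "s * (G - s * blinfun_apply (blinfun_apply f'' w) v)
      = f (x + s *\<^sub>R v + s *\<^sub>R w) - f (x + s *\<^sub>R v) - f (x + s *\<^sub>R w) + f x
        - s\<^sup>2 * blinfun_apply (blinfun_apply f'' w) v"
  proof -
    have "h 1 - h 0 = s * G"
      using t(3) by (simp add: G_def blinfun.scaleR_right right_diff_distrib)
    moreover have "x + s *\<^sub>R w + s *\<^sub>R v = x + s *\<^sub>R v + s *\<^sub>R w" by simp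
    ultimately show ?thesis unfolding h_def by (simp add: right_diff_distrib power2_eq_square)
  qed
  finally show ?thesis .
qed

text \<open>The second difference does not change when \<open>v\<close> and \<open>w\<close> are exchanged.\<close>

lemma second_derivative_symmetric:
  fixes f :: "'a::real_normed_vector \<Rightarrow> real"
  assumes f: "\<And>x. (f has_derivative blinfun_apply (f' x)) (at x)"
    and f'': "(f' has_derivative blinfun_apply f'') (at x)"
  shows "blinfun_apply (blinfun_apply f'' v) w = blinfun_apply (blinfun_apply f'' w) v"
proof -
  define N where "N = norm v + norm w"
  have N: "0 \<le> N" by (simp add: N_def)
  have "\<bar>blinfun_apply (blinfun_apply f'' w) v - blinfun_apply (blinfun_apply f'' v) w\<bar> \<le> e" if e: "0 < e" for e
  proof -
    define D where "D = N\<^sup>2 + 1"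
    define e1 where "e1 = e / (4 * D)"
    have D: "0 < D" by (simp add: D_def add_nonneg_pos)
    have e1: "0 < e1" using e D by (simp add: e1_def)
    obtain d where d: "0 < d" "\<And>y. norm (y - x) < d \<Longrightarrow>
        norm (f' y - f' x - blinfun_apply f'' (y - x)) \<le> e1 * norm (y - x)"
      using f''[unfolded has_derivative_at_alt, THEN conjunct2, rule_format, OF e1] by auto
    define s where "s = d / (N + 1)"
    have s: "0 < s" "s * (norm v + norm w) < d" "s * (norm w + norm v) < d"
    proof -
      have N1: "0 < N + 1" using N by simp
      then show "0 < s" using d(1) by (simp add: s_def)
      have "s * N < d" using d(1) N1 by (simp add: s_def pos_divide_less_eq distrib_left)
      then show "s * (norm v + norm w) < d" "s * (norm w + norm v) < d"
        by (simp_all add: N_def add.commute)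
    qed
    define \<Delta> where "\<Delta> = f (x + s *\<^sub>R v + s *\<^sub>R w) - f (x + s *\<^sub>R v) - f (x + s *\<^sub>R w) + f x"
    have a: "\<bar>\<Delta> - s\<^sup>2 * blinfun_apply (blinfun_apply f'' w) v\<bar> \<le> 2 * e1 * s\<^sup>2 * N\<^sup>2"
      using second_difference_estimate[OF f d(2) s(1,2) less_imp_le[OF e1]] by (simp add: \<Delta>_def N_def)
    have b: "\<bar>\<Delta> - s\<^sup>2 * blinfun_apply (blinfun_apply f'' v) w\<bar> \<le> 2 * e1 * s\<^sup>2 * N\<^sup>2"
    proof -
      have eq1: "x + s *\<^sub>R w + s *\<^sub>R v = x + s *\<^sub>R v + s *\<^sub>R w" by simp
      have eq2: "norm w + norm v = N" unfolding N_def by (rule add.commute)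
      have est: "\<bar>f (x + s *\<^sub>R w + s *\<^sub>R v) - f (x + s *\<^sub>R w) - f (x + s *\<^sub>R v) + f x
          - s\<^sup>2 * blinfun_apply (blinfun_apply f'' v) w\<bar> \<le> 2 * e1 * s\<^sup>2 * (norm w + norm v)\<^sup>2"
        by (rule second_difference_estimate[OF f _ s(1,3) less_imp_le[OF e1]]) (erule d(2))
      have swap: "a1 - a3 - a2 + a4 = a1 - a2 - a3 + a4" for a1 a2 a3 a4 :: real by simp
      have eq3: "f (x + s *\<^sub>R w + s *\<^sub>R v) - f (x + s *\<^sub>R w) - f (x + s *\<^sub>R v) + f x = \<Delta>"
        unfolding \<Delta>_def eq1 by (rule swap)
      show ?thesis using est unfolding eq3 eq2 .
    qed
    have "\<bar>s\<^sup>2 * blinfun_apply (blinfun_apply f'' w) v - s\<^sup>2 * blinfun_apply (blinfun_apply f'' v) w\<bar>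
        \<le> 2 * (2 * e1 * s\<^sup>2 * N\<^sup>2)"
      using a b by linarith
    then have "s\<^sup>2 * \<bar>blinfun_apply (blinfun_apply f'' w) v - blinfun_apply (blinfun_apply f'' v) w\<bar>
        \<le> s\<^sup>2 * (4 * e1 * N\<^sup>2)"
      unfolding right_diff_distrib[symmetric] abs_mult by (simp add: mult_ac)
    then have "\<bar>blinfun_apply (blinfun_apply f'' w) v - blinfun_apply (blinfun_apply f'' v) w\<bar> \<le> 4 * e1 * N\<^sup>2"
      using s(1) by (simp only: mult_le_cancel_left_pos zero_less_power)
    also have "\<dots> = e * (N\<^sup>2 / D)" by (simp add: e1_def)
    also have "\<dots> \<le> e * 1" using e D by (intro mult_left_mono) (simp_all add: D_def)
    finally show ?thesis by simp
  qed
  then have "\<bar>blinfun_apply (blinfun_apply f'' w) v - blinfun_apply (blinfun_apply f'' v) w\<bar> \<le> 0"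
    by (rule field_le_epsilon) simp
  then show ?thesis by simp
qed

lemma hess_symmetric:
  assumes "smooth_on UNIV J"
  shows "blinfun_apply (blinfun_apply (hess J u) v) w = blinfun_apply (blinfun_apply (hess J u) w) v"
  by (rule second_derivative_symmetric[OF smooth_energy_grad[OF assms] smooth_energy_hess[OF assms]])

lemma taylor_second_order:
  fixes f :: "'a::real_normed_vector \<Rightarrow> real"
  assumes f: "\<And>x. (f has_derivative blinfun_apply (f' x)) (at x)"
    and B: "\<And>s. 0 \<le> s \<Longrightarrow> s \<le> 1 \<Longrightarrow>
      \<bar>blinfun_apply (f' (x + s *\<^sub>R v)) v - blinfun_apply (f' x) v - s * q\<bar> \<le> B"
  shows "\<bar>f (x + v) - f x - blinfun_apply (f' x) v - 1/2 * q\<bar> \<le> B"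
proof -
  define h where "h s = f (x + s *\<^sub>R v) - s * blinfun_apply (f' x) v - s\<^sup>2 / 2 * q" for s :: real
  have lin: "((\<lambda>s. s * c) has_real_derivative c) (at s)" for c s :: real
    by (auto intro!: derivative_eq_intros)
  have square: "((\<lambda>s. s\<^sup>2 / 2 * q) has_real_derivative s * q) (at s)" for s
    by (auto intro!: derivative_eq_intros)
  have dh: "(h has_real_derivative (blinfun_apply (f' (x + s *\<^sub>R v)) v - blinfun_apply (f' x) v - s * q)) (at s)" for s
    unfolding h_def
    by (rule DERIV_diff[OF DERIV_diff[OF has_real_derivative_along_line[OF f] lin] square])
  obtain s where s: "0 < s" "s < 1" "h 1 - h 0 = (1 - 0) *
     (blinfun_apply (f' (x + s *\<^sub>R v)) v - blinfun_apply (f' x) v - s * q)"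
    using MVT2[of 0 1 h, OF zero_less_one dh] by blast
  moreover have "h 1 - h 0 = f (x + v) - f x - blinfun_apply (f' x) v - 1/2 * q"
    by (simp add: h_def)
  ultimately show ?thesis using B[of s] by simp
qed

section \<open>The phase_tangent gradient and its linearization\<close>

text \<open>The directions in \<open>H\<close> that are tangent to the phase space \<open>u\<^sub>0 + X\<^sub>0\<close>.\<close>

definition phase_tangent :: "('h::real_inner \<Rightarrow>\<^sub>L 'x::real_inner) \<Rightarrow> 'x set \<Rightarrow> 'h set" where
  "phase_tangent \<iota> X0 = {v. blinfun_apply \<iota> v \<in> X0}"

lemma finite_orthogonal_basis_of_complement:
  fixes V :: "'v::{real_inner,complete_space} set"
  assumes V: "subspace V" "closed V" and B: "finite B" "span (V \<union> B) = UNIV"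
  obtains C where "finite C" "pairwise orthogonal C" "0 \<notin> C" "span C = orthogonal_comp V"
proof -
  \<comment> \<open>the projection onto the complement, which is spanned by the images of the finitely many elements of \<open>B\<close>\<close>
  define Q where "Q x = x - orth_proj V x" for x
  have Q: "linear Q"
    unfolding Q_def
    by (intro linear_compose_sub linear_ident bounded_linear.linear bounded_linear_orth_proj V)
  have Qz: "Q z = z" if "z \<in> orthogonal_comp V" for z
    using orth_proj_eqI[OF V, of 0 z] that V(1) by (simp add: Q_def subspace_0)
  have QV: "Q ` V \<subseteq> {0}" using orth_proj_self[OF V] by (auto simp: Q_def)
  have "span (Q ` B) = orthogonal_comp V"
  proof
    show "span (Q ` B) \<subseteq> orthogonal_comp V"
      using orth_proj_diff[OF V] subspace_orthogonal_comp
      by (intro span_minimal) (auto simp: Q_def)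
    show "orthogonal_comp V \<subseteq> span (Q ` B)"
    proof
      fix z assume z: "z \<in> orthogonal_comp V"
      have "Q z \<in> Q ` span (V \<union> B)" unfolding B(2) by simp
      also have "\<dots> = span (Q ` (V \<union> B))" by (rule linear_span_image[OF Q, symmetric])
      also have "\<dots> \<subseteq> span (insert 0 (Q ` B))"
        using QV by (intro span_mono) auto
      finally show "z \<in> span (Q ` B)" by (simp add: Qz[OF z])
    qed
  qed
  moreover obtain C where C: "finite C" "span C = span (Q ` B)" "pairwise orthogonal C"
    using basis_orthogonal[of "Q ` B"] B(1) by auto
  ultimately show thesis
    using that[of "C - {0}"] by (auto simp: pairwise_def)
qed

locale constrained_triple =
  fixes \<iota> :: "'h::{real_inner,complete_space} \<Rightarrow>\<^sub>L 'x::{real_inner,complete_space}"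
    and X0 :: "'x set"
  assumes triple: "gelfand_triple \<iota>" and X0: "constraint_space \<iota> X0"
begin

lemma inj_embedding: "inj (blinfun_apply \<iota>)"
  using triple by (simp add: gelfand_triple_def)

lemma embedding_eq_0: "blinfun_apply \<iota> v = 0 \<longleftrightarrow> v = 0"
  using inj_embedding by (metis blinfun.zero_right injD)

lemma subspace_X0: "subspace X0" and closed_X0: "closed X0"
  using X0 by (simp_all add: constraint_space_def)

lemmas proj_X0 = subspace_X0 closed_X0

lemma subspace_phase_tangent: "subspace (phase_tangent \<iota> X0)"
  using subspace_X0 unfolding phase_tangent_def subspace_def
  by (simp add: blinfun.zero_right blinfun.add_right blinfun.scaleR_right)

lemma closed_phase_tangent: "closed (phase_tangent \<iota> X0)"
  unfolding phase_tangent_def vimage_def[symmetric]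
  by (rule closed_vimage[OF closed_X0]) (intro continuous_intros)

text \<open>\<open>X\<^sub>0\<^sup>\<bottom>\<close> has a finite orthogonal basis \<open>C\<close>, and its elements lift to \<open>H\<close>. Lifting the
projection onto \<open>X\<^sub>0\<^sup>\<bottom>\<close> coordinate by coordinate gives an explicit finite-rank operator on
\<open>H\<close>, which is visibly bounded.\<close>

lemma orth_proj_H_bounded:
  "bounded_linear (orth_proj_H \<iota> X0)"
  and embedding_orth_proj_H: "blinfun_apply \<iota> (orth_proj_H \<iota> X0 v) = orth_proj X0 (blinfun_apply \<iota> v)"
proof -
  obtain B where B: "finite B" "span (X0 \<union> B) = UNIV" and sub: "orthogonal_comp X0 \<subseteq> range (blinfun_apply \<iota>)"
    using X0 unfolding constraint_space_def by blast
  obtain C where C: "finite C" "pairwise orthogonal C" "0 \<notin> C" "span C = orthogonal_comp X0"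
    by (rule finite_orthogonal_basis_of_complement[OF proj_X0 B])
  have "\<forall>c\<in>C. \<exists>h. blinfun_apply \<iota> h = c"
    using sub span_superset[of C] C(4) by blast
  then obtain h where h: "\<And>c. c \<in> C \<Longrightarrow> blinfun_apply \<iota> (h c) = c" by metis
  define P where "P v = v - (\<Sum>c\<in>C. (blinfun_apply \<iota> v \<bullet> c / (c \<bullet> c)) *\<^sub>R h c)" for v
  have iP: "blinfun_apply \<iota> (P v) = orth_proj X0 (blinfun_apply \<iota> v)" for v
  proof (rule sym, rule orth_proj_eqI[OF proj_X0])
    define r where "r = (\<Sum>c\<in>C. (blinfun_apply \<iota> v \<bullet> c / (c \<bullet> c)) *\<^sub>R c)"
    have iPv: "blinfun_apply \<iota> (P v) = blinfun_apply \<iota> v - r"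
      by (simp add: P_def r_def blinfun.diff_right blinfun.sum_right blinfun.scaleR_right h)
    have r: "r \<in> orthogonal_comp X0"
      unfolding r_def C(4)[symmetric] by (intro span_sum span_scale span_base)
    then show "blinfun_apply \<iota> v - blinfun_apply \<iota> (P v) \<in> orthogonal_comp X0" by (simp add: iPv)
    have "(blinfun_apply \<iota> v - r) \<bullet> d = 0" if d: "d \<in> C" for d
    proof -
      have "r \<bullet> d = (\<Sum>c\<in>C. if c = d then blinfun_apply \<iota> v \<bullet> d else 0)"
        unfolding r_def inner_sum_left
        using C(2,3) d by (intro sum.cong) (auto simp: pairwise_def orthogonal_def)
      then show ?thesis using d C(1) by (simp add: inner_diff_left)
    qed
    then have "(blinfun_apply \<iota> v - r) \<bullet> z = 0" if "z \<in> span C" for z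
      using orthogonal_to_span[OF that, of "blinfun_apply \<iota> v - r"] by (simp add: orthogonal_def)
    then show "blinfun_apply \<iota> (P v) \<in> X0"
      unfolding iPv using mem_double_orthogonal[OF proj_X0] C(4) by blast
  qed
  have "orth_proj_H \<iota> X0 v = P v" for v
    unfolding orth_proj_H_def using iP inj_embedding by (intro the_equality) (auto simp: inj_def)
  then have eq: "orth_proj_H \<iota> X0 = P" by blast
  show "bounded_linear (orth_proj_H \<iota> X0)"
    unfolding eq P_def
    by (intro bounded_linear_sub bounded_linear_ident bounded_linear_sum
        bounded_linear_scaleR_left[THEN bounded_linear_compose]
        bounded_linear_compose[OF bounded_linear_divide]
        bounded_linear_compose[OF bounded_linear_inner_left] blinfun.bounded_linear_right)
  show "blinfun_apply \<iota> (orth_proj_H \<iota> X0 v) = orth_proj X0 (blinfun_apply \<iota> v)"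
    unfolding eq by (rule iP)
qed

lemma orth_proj_H_phase_tangent:
  "orth_proj_H \<iota> X0 v \<in> phase_tangent \<iota> X0"
  "v \<in> phase_tangent \<iota> X0 \<Longrightarrow> orth_proj_H \<iota> X0 v = v"
proof -
  show "orth_proj_H \<iota> X0 v \<in> phase_tangent \<iota> X0"
    by (simp add: phase_tangent_def embedding_orth_proj_H orth_proj_in[OF proj_X0])
  show "orth_proj_H \<iota> X0 v = v" if "v \<in> phase_tangent \<iota> X0"
    using embedding_orth_proj_H[of v] that orth_proj_self[OF proj_X0] inj_embedding
    by (simp add: phase_tangent_def inj_eq)
qed

lemma orth_proj_dual_eq:
  "orth_proj_dual \<iota> X0 f = f o\<^sub>L Blinfun (orth_proj_H \<iota> X0)"
  unfolding orth_proj_dual_def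
  by (rule blinfun_eqI)
     (simp add: bounded_linear_Blinfun_apply[OF orth_proj_H_bounded]
        bounded_linear_Blinfun_apply[OF bounded_linear_compose[OF blinfun.bounded_linear_right orth_proj_H_bounded]])

lemma rhs_apply:
  "blinfun_apply (rhs \<iota> X0 J u) v = - blinfun_apply (grad J u) (orth_proj_H \<iota> X0 v)"
  by (simp add: rhs_def orth_proj_dual_eq blinfun.minus_left
      bounded_linear_Blinfun_apply[OF orth_proj_H_bounded])

lemma linearization_apply:
  assumes J: "smooth_on UNIV J"
  shows "blinfun_apply (blinfun_apply (linearization \<iota> X0 J u) v) w
    = - blinfun_apply (blinfun_apply (hess J u) v) (orth_proj_H \<iota> X0 w)"
proof -
  let ?P = "Blinfun (orth_proj_H \<iota> X0)"
  have eq: "rhs \<iota> X0 J = (\<lambda>u. - (grad J u o\<^sub>L ?P))"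
    by (simp add: fun_eq_iff rhs_def orth_proj_dual_eq)
  have d: "(rhs \<iota> X0 J has_derivative (\<lambda>v. - (blinfun_apply (hess J u) v o\<^sub>L ?P))) (at u)"
    unfolding eq
    by (intro has_derivative_minus bounded_linear.has_derivative[OF _ smooth_energy_hess[OF J]]
        bounded_bilinear.bounded_linear_left[OF bounded_bilinear_blinfun_compose])
  then have "rhs \<iota> X0 J differentiable (at u)" by (auto simp: differentiable_def)
  from has_derivative_unique[OF has_derivative_fderiv[OF this] d]
  have "blinfun_apply (linearization \<iota> X0 J u) v = - (blinfun_apply (hess J u) v o\<^sub>L ?P)"
    unfolding linearization_def by metis
  then show ?thesis
    by (simp add: blinfun.minus_left bounded_linear_Blinfun_apply[OF orth_proj_H_bounded])
qed

text \<open>The weak form of the linearization. The projection \<open>\<Pi>\<^sub>0\<close> is symmetric and can be moved to the test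
vector, where it has the effect that only test vectors tangent to the phase space matter.\<close>

lemma lin_op_iff:
  assumes J: "smooth_on UNIV J"
  shows "(blinfun_apply \<iota> v, y) \<in> lin_op \<iota> X0 J u \<longleftrightarrow> v \<in> phase_tangent \<iota> X0 \<and> y \<in> X0 \<and>
    (\<forall>w\<in>phase_tangent \<iota> X0. blinfun_apply (blinfun_apply (hess J u) v) w = - (y \<bullet> blinfun_apply \<iota> w))"
proof -
  have "blinfun_apply (linearization \<iota> X0 J u) v = to_dual \<iota> y \<longleftrightarrow>
     (\<forall>w\<in>phase_tangent \<iota> X0. blinfun_apply (blinfun_apply (hess J u) v) w = - (y \<bullet> blinfun_apply \<iota> w))"
    if y: "y \<in> X0"
  proof -
    have "blinfun_apply (linearization \<iota> X0 J u) v = to_dual \<iota> y \<longleftrightarrow>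
       (\<forall>w. - blinfun_apply (blinfun_apply (hess J u) v) (orth_proj_H \<iota> X0 w) = y \<bullet> blinfun_apply \<iota> w)"
    proof -
      have ext: "f = g \<longleftrightarrow> (\<forall>w. blinfun_apply f w = blinfun_apply g w)" for f g :: "'h \<Rightarrow>\<^sub>L real"
        by (auto intro: blinfun_eqI)
      show ?thesis by (simp add: ext to_dual_def linearization_apply[OF J])
    qed
    also have "\<dots> \<longleftrightarrow> (\<forall>w. blinfun_apply (blinfun_apply (hess J u) v) (orth_proj_H \<iota> X0 w)
        = - (y \<bullet> blinfun_apply \<iota> (orth_proj_H \<iota> X0 w)))"
      unfolding embedding_orth_proj_H inner_orth_proj[OF proj_X0 y]
      by (intro iff_allI) linarith
    also have "\<dots> \<longleftrightarrow> (\<forall>w\<in>phase_tangent \<iota> X0. blinfun_apply (blinfun_apply (hess J u) v) w = - (y \<bullet> blinfun_apply \<iota> w))"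
      using orth_proj_H_phase_tangent by metis
    finally show ?thesis .
  qed
  moreover have "(blinfun_apply \<iota> v, y) \<in> lin_op \<iota> X0 J u \<longleftrightarrow> v \<in> phase_tangent \<iota> X0 \<and> y \<in> X0 \<and>
      blinfun_apply (linearization \<iota> X0 J u) v = to_dual \<iota> y"
    using inj_embedding by (auto simp: lin_op_def phase_tangent_def inj_eq)
  ultimately show ?thesis by blast
qed

end

section \<open>Coercivity of the second variation near the fast space\<close>

lemma subspace_closure:
  fixes S :: "'a::real_normed_vector set"
  assumes S: "subspace S"
  shows "subspace (closure S)"
  unfolding subspace_def
proof (intro conjI ballI allI)
  show "0 \<in> closure S" using S subspace_0 closure_subset by blast
  fix x assume "x \<in> closure S"
  then obtain f where f: "\<And>n. f n \<in> S" "f \<longlonglongrightarrow> x" unfolding closure_sequential by blast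
  show "c *\<^sub>R x \<in> closure S" for c
    unfolding closure_sequential
    by (intro exI[of _ "\<lambda>n. c *\<^sub>R f n"] conjI allI tendsto_intros f subspace_scale[OF S])
  fix y assume "y \<in> closure S"
  then obtain g where g: "\<And>n. g n \<in> S" "g \<longlonglongrightarrow> y" unfolding closure_sequential by blast
  show "x + y \<in> closure S"
    unfolding closure_sequential
    by (intro exI[of _ "\<lambda>n. f n + g n"] conjI allI tendsto_intros f g subspace_add[OF S])
qed

lemma bounded_bilinear_add:
  assumes "bounded_bilinear f" "bounded_bilinear g"
  shows "bounded_bilinear (\<lambda>x y. f x y + g x y)"
proof -
  interpret f: bounded_bilinear f by fact
  interpret g: bounded_bilinear g by fact
  obtain K where K: "\<And>x y. norm (f x y) \<le> norm x * norm y * K" using f.bounded by blast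
  obtain L where L: "\<And>x y. norm (g x y) \<le> norm x * norm y * L" using g.bounded by blast
  show ?thesis
  proof
    have "norm (f x y + g x y) \<le> norm x * norm y * (K + L)" for x y
      using norm_triangle_ineq[of "f x y" "g x y"] K[of x y] L[of x y] by (simp add: distrib_left)
    then show "\<exists>K. \<forall>x y. norm (f x y + g x y) \<le> norm x * norm y * K" by blast
  qed (simp_all add: f.add_left f.add_right f.scaleR_left f.scaleR_right
        g.add_left g.add_right g.scaleR_left g.scaleR_right scaleR_add_right)
qed

lemma span_eq_of_card_eq_dim:
  fixes S :: "'a::real_vector set"
  assumes B: "finite B" "independent B" "B \<subseteq> span S" and card: "card B = dim S" "0 < dim S"
  shows "span S = span B"
proof
  obtain b where bS: "b \<subseteq> S" "S \<subseteq> span b" and b: "card b = dim S"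
    by (rule real_vector.basis_exists[of S]) auto
  have fb: "finite b" by (rule card_ge_0_finite) (use b card(2) in simp)
  have sb: "span S \<subseteq> span b" using bS(2) by (rule span_minimal) (rule subspace_span)
  show "span B \<subseteq> span S" using B(3) by (rule span_minimal) (rule subspace_span)
  have "x \<in> span B" if x: "x \<in> span S" for x
  proof (rule ccontr)
    assume nx: "x \<notin> span B"
    then have "x \<notin> B" using span_base by blast
    have "independent (insert x B)" using B(2) nx by (rule independent_insertI[rotated])
    then have "card (insert x B) \<le> card b"
      using independent_span_bound[OF fb, of "insert x B"] B(3) sb x by auto
    then show False using card(1) b B(1) \<open>x \<notin> B\<close> by simp
  qed
  then show "span S \<subseteq> span B" by blast
qed

text \<open>The spectral hypotheses at a single point \<open>u\<close> of the manifold, with slow eigenvectors \<open>\<psi> i\<close>, their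
eigenvalues \<open>l i\<close> of size at most \<open>b\<close>, and the semigroup \<open>S\<close> of the linearization. They are kept
apart from the parametrization because the coercivity of the second variation is a statement about one
point.\<close>

locale spectral_splitting = constrained_triple \<iota> X0
  for \<iota> :: "'h::{real_inner,complete_space} \<Rightarrow>\<^sub>L 'x::{real_inner,complete_space}"
    and X0 :: "'x set" +
  fixes J :: "'h \<Rightarrow> real" and u :: 'h and \<psi> :: "'n::finite \<Rightarrow> 'h"
    and l :: "'n \<Rightarrow> real" and S :: "real \<Rightarrow> 'x \<Rightarrow> 'x" and b \<mu>e \<gamma>e ks C2 :: real
  assumes J: "smooth_on UNIV J"
    and coercive: "energy_coercive \<iota> X0 J {u} \<mu>e \<gamma>e" and pos: "0 < \<mu>e" "0 < \<gamma>e" "0 < ks"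
    and dim: "dim (slow_space \<iota> X0 J u b) = CARD('n)"
    and semigroup: "c0_semigroup_on X0 S" "semigroup_generator X0 S = lin_op \<iota> X0 J u"
    and decay: "\<And>t v. 0 \<le> t \<Longrightarrow> v \<in> fast_space \<iota> X0 J u b \<Longrightarrow>
       \<exists>w. blinfun_apply \<iota> w = S t (blinfun_apply \<iota> v) \<and> norm w \<le> C2 * exp (- ks * t) * norm v"
    and eigen: "\<And>i. \<bar>l i\<bar> \<le> b"
       "\<And>i. (blinfun_apply \<iota> (\<psi> i), l i *\<^sub>R blinfun_apply \<iota> (\<psi> i)) \<in> lin_op \<iota> X0 J u"
    and orthonormal: "\<And>i j. blinfun_apply \<iota> (\<psi> i) \<bullet> blinfun_apply \<iota> (\<psi> j) = (if i = j then 1 else 0)"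
begin

abbreviation "q \<equiv> \<lambda>v w. blinfun_apply (blinfun_apply (hess J u) v) w"
abbreviation "H0 \<equiv> phase_tangent \<iota> X0"
abbreviation "emb \<equiv> blinfun_apply \<iota>"

lemma eigen_phase_tangent: "\<psi> i \<in> H0"
  using eigen(2) by (simp add: lin_op_iff[OF J])

lemma hess_eigen: "w \<in> H0 \<Longrightarrow> q (\<psi> i) w = - l i * (emb (\<psi> i) \<bullet> emb w)"
  using eigen(2)[of i] by (simp add: lin_op_iff[OF J])

text \<open>\<open>CARD('n)\<close> independent eigenvectors in a space of this dimension leave no room for others.\<close>

lemma slow_space_eq_span: "slow_space \<iota> X0 J u b = span (range \<psi>)"
proof -
  have inj: "inj \<psi>"
  proof (rule injI)
    fix i j assume "\<psi> i = \<psi> j"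
    then show "i = j" using orthonormal[of i j] orthonormal[of i i] by (auto split: if_splits)
  qed
  define G where "G = {v. \<exists>l. \<bar>l\<bar> \<le> b \<and> (emb v, l *\<^sub>R emb v) \<in> lin_op \<iota> X0 J u}"
  have slow: "slow_space \<iota> X0 J u b = span G" by (simp add: slow_space_def G_def)
  have ind: "independent (emb ` range \<psi>)"
  proof (rule pairwise_orthogonal_independent)
    show "pairwise orthogonal (emb ` range \<psi>)"
      unfolding pairwise_def orthogonal_def using orthonormal by auto
    show "0 \<notin> emb ` range \<psi>"
    proof
      assume "0 \<in> emb ` range \<psi>"
      then obtain i where "emb (\<psi> i) = 0" by auto
      then show False using orthonormal[of i i] by simp
    qed
  qed
  have "independent (range \<psi>)"
    unfolding dependent_def
  proof safe
    fix i assume "\<psi> i \<in> span (range \<psi> - {\<psi> i})"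
    then have "emb (\<psi> i) \<in> span (emb ` (range \<psi> - {\<psi> i}))"
      using linear_span_image[OF bounded_linear.linear[OF blinfun.bounded_linear_right]] by blast
    also have "emb ` (range \<psi> - {\<psi> i}) = emb ` range \<psi> - {emb (\<psi> i)}"
      using image_set_diff[OF inj_embedding] by simp
    finally show False using ind unfolding dependent_def by blast
  qed
  then have "span G = span (range \<psi>)"
    using dim eigen unfolding slow
    by (intro span_eq_of_card_eq_dim) (auto simp: card_image[OF inj] dim_span G_def intro!: span_base)
  then show ?thesis using slow by simp
qed

lemma fast_space_iff:
  "v \<in> fast_space \<iota> X0 J u b \<longleftrightarrow> v \<in> H0 \<and> (\<forall>i. emb v \<bullet> emb (\<psi> i) = 0)"
proof -
  have "(\<forall>y\<in>span (range \<psi>). emb v \<bullet> emb y = 0) \<longleftrightarrow> (\<forall>i. emb v \<bullet> emb (\<psi> i) = 0)"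
  proof
    assume r: "\<forall>i. emb v \<bullet> emb (\<psi> i) = 0"
    show "\<forall>y\<in>span (range \<psi>). emb v \<bullet> emb y = 0"
    proof
      fix y assume "y \<in> span (range \<psi>)"
      then show "emb v \<bullet> emb y = 0"
        by (induction rule: span_induct_alt)
           (use r in \<open>auto simp: blinfun.zero_right blinfun.add_right blinfun.scaleR_right inner_add_right\<close>)
    qed
  qed (auto intro: span_base)
  then show ?thesis
    by (simp add: fast_space_def slow_space_eq_span phase_tangent_def)
qed

lemma subspace_fast: "subspace (fast_space \<iota> X0 J u b)"
  using subspace_phase_tangent
  by (auto simp: subspace_def fast_space_iff blinfun.zero_right blinfun.add_right
      blinfun.scaleR_right inner_add_left)

lemma closed_fast: "closed (fast_space \<iota> X0 J u b)"
proof -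
  have "fast_space \<iota> X0 J u b = H0 \<inter> (\<Inter>i. {v. emb v \<bullet> emb (\<psi> i) = 0})"
    by (auto simp: fast_space_iff)
  then show ?thesis
    by (auto intro!: closed_Int closed_INT closed_phase_tangent closed_Collect_eq continuous_intros)
qed

definition shifted where "shifted v w = q v w + \<gamma>e * (emb v \<bullet> emb w)" for v w

lemma bounded_bilinear_shifted: "bounded_bilinear shifted"
proof -
  have "bounded_bilinear q"
    by (rule bounded_bilinear.comp1[OF bounded_bilinear_blinfun_apply blinfun.bounded_linear_right])
  moreover have "bounded_bilinear (\<lambda>v w. \<gamma>e * (emb v \<bullet> emb w))"
    using bounded_bilinear.comp[OF bounded_bilinear_inner
        bounded_linear_compose[OF bounded_linear_scaleR_right[of \<gamma>e] blinfun.bounded_linear_right[of \<iota>]]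
        blinfun.bounded_linear_right[of \<iota>]] by simp
  ultimately show ?thesis unfolding shifted_def by (rule bounded_bilinear_add)
qed

lemma shifted_sym: "shifted v w = shifted w v"
  unfolding shifted_def using hess_symmetric[OF J, of u v w] by (simp add: inner_commute)

text \<open>This turns the energy coercivity into the hypothesis of \<open>symmetric_lax_milgram\<close>; solving
\<open>shifted v w = y \<bullet> \<iota> w\<close> for \<open>v\<close> amounts to applying the resolvent \<open>(\<gamma>e - L)\<^sup>-\<^sup>1\<close> to \<open>y\<close>.\<close>

lemma shifted_coercive: "v \<in> H0 \<Longrightarrow> \<mu>e * (norm v)\<^sup>2 \<le> shifted v v"
  using coercive by (simp add: energy_coercive_def phase_tangent_def shifted_def blinfun.add_left
      blinfun.scaleR_left to_dual_def)

lemma hess_ge_on_operator_domain: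
  assumes v: "v \<in> fast_space \<iota> X0 J u b" and y: "(emb v, y) \<in> lin_op \<iota> X0 J u"
  shows "ks * (norm (emb v))\<^sup>2 \<le> q v v"
proof -
  note iff = lin_op_iff[OF J]
  have "y \<bullet> emb v \<le> - ks * (norm (emb v))\<^sup>2"
  proof (rule semigroup_decay_imp_dissipative[OF subspace_X0 closed_X0 semigroup(1)])
    show "(emb v, y) \<in> semigroup_generator X0 S" using y semigroup(2) by simp
    fix x z x' z'
    assume xz: "(x, z) \<in> semigroup_generator X0 S" "(x', z') \<in> semigroup_generator X0 S"
    then obtain v1 v2 where v12: "x = emb v1" "x' = emb v2"
      unfolding semigroup(2) lin_op_def by blast
    show "z \<bullet> x' = x \<bullet> z'"
      using xz hess_symmetric[OF J, of u v1 v2] unfolding semigroup(2) v12 iff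
      by (simp add: inner_commute)
  next
    fix t :: real assume t: "0 \<le> t"
    obtain w where w: "emb w = S t (emb v)" "norm w \<le> C2 * exp (- ks * t) * norm v"
      using decay[OF t v] by blast
    have "norm (S t (emb v)) \<le> norm \<iota> * norm w" unfolding w(1)[symmetric] by (rule norm_blinfun)
    also have "\<dots> \<le> norm \<iota> * (C2 * exp (- ks * t) * norm v)" by (intro mult_left_mono w(2)) simp
    finally show "norm (S t (emb v)) \<le> (norm \<iota> * C2 * norm v) * exp (- ks * t)" by (simp add: mult_ac)
  qed
  moreover have "q v v = - (y \<bullet> emb v)" using y unfolding iff by blast
  ultimately show ?thesis by simp
qed

text \<open>Let \<open>g\<close> be the projection of \<open>f\<close> onto the closure in the inner product \<open>shifted\<close>, and \<open>d = f - g\<close>. The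
resolvent applied to \<open>d\<close> gives an element \<open>v\<close> of the domain, which is again fast because the
slow space is spanned by eigenvectors. Testing the orthogonality of \<open>d\<close> with this \<open>v\<close> gives
\<open>0 = shifted v d\<close>, which is the square of the \<open>X\<close>-norm of \<open>d\<close>.\<close>

lemma operator_domain_dense:
  "fast_space \<iota> X0 J u b \<subseteq>
     closure {v \<in> fast_space \<iota> X0 J u b. \<exists>y. (emb v, y) \<in> lin_op \<iota> X0 J u}" (is "?F \<subseteq> closure ?D")
proof
  note iff = lin_op_iff[OF J]
  interpret a: bounded_bilinear shifted by (rule bounded_bilinear_shifted)
  have FH: "?F \<subseteq> H0" by (auto simp: fast_space_iff)
  have "subspace ?D"
    unfolding subspace_def
  proof (safe)
    show "0 \<in> ?F" using subspace_fast subspace_0 by blast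
    show "\<exists>y. (emb 0, y) \<in> lin_op \<iota> X0 J u"
      unfolding iff using subspace_0[OF subspace_phase_tangent] subspace_0[OF subspace_X0]
      by (intro exI[of _ 0]) (simp add: blinfun.zero_right blinfun.zero_left)
    fix v w y z assume *: "v \<in> ?F" "w \<in> ?F" "(emb v, y) \<in> lin_op \<iota> X0 J u" "(emb w, z) \<in> lin_op \<iota> X0 J u"
    show "v + w \<in> ?F" using * subspace_fast subspace_add by blast
    show "\<exists>y. (emb (v + w), y) \<in> lin_op \<iota> X0 J u"
      using * unfolding iff
      using subspace_add[OF subspace_phase_tangent, of v w] subspace_add[OF subspace_X0, of y z]
      by (intro exI[of _ "y + z"]) (simp add: blinfun.add_left blinfun.add_right inner_add_left)
  next
    fix v y c assume *: "v \<in> ?F" "(emb v, y) \<in> lin_op \<iota> X0 J u"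
    show "c *\<^sub>R v \<in> ?F" using * subspace_fast subspace_scale by blast
    show "\<exists>y. (emb (c *\<^sub>R v), y) \<in> lin_op \<iota> X0 J u"
      using * unfolding iff
      using subspace_scale[OF subspace_phase_tangent, of v c] subspace_scale[OF subspace_X0, of y c]
      by (intro exI[of _ "c *\<^sub>R y"]) (simp add: blinfun.scaleR_left blinfun.scaleR_right)
  qed
  then have sub: "subspace (closure ?D)" by (rule subspace_closure)
  have cF: "closure ?D \<subseteq> ?F" by (rule closure_minimal[OF _ closed_fast]) auto
  fix f assume f: "f \<in> ?F"
  have coer: "\<mu>e * (norm w)\<^sup>2 \<le> shifted w w" if "w \<in> closure ?D" for w
    using shifted_coercive that cF FH by blast
  obtain g where g: "g \<in> closure ?D" "\<And>w. w \<in> closure ?D \<Longrightarrow> shifted g w = shifted f w"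
    by (rule symmetric_lax_milgram[OF bounded_bilinear_shifted shifted_sym sub closed_closure pos(1) _
          a.bounded_linear_right[of f]]) (erule coer, rule that)
  define d where "d = f - g"
  have d: "d \<in> ?F" unfolding d_def using f g(1) cF subspace_fast subspace_diff by blast
  have dX: "emb d \<in> X0" using d FH by (auto simp: phase_tangent_def)
  obtain v where v: "v \<in> H0" "\<And>w. w \<in> H0 \<Longrightarrow> shifted v w = emb d \<bullet> emb w"
    by (rule symmetric_lax_milgram[OF bounded_bilinear_shifted shifted_sym subspace_phase_tangent
          closed_phase_tangent pos(1) _
          bounded_linear_compose[OF bounded_linear_inner_right[of "emb d"] blinfun.bounded_linear_right[of \<iota>]]])
       (erule shifted_coercive, rule that)
  have "emb v \<bullet> emb (\<psi> i) = 0" for i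
  proof -
    have e: "shifted (\<psi> i) w = (\<gamma>e - l i) * (emb (\<psi> i) \<bullet> emb w)" if "w \<in> H0" for w
      using hess_eigen[OF that, of i] by (simp add: shifted_def algebra_simps)
    have "\<psi> i \<noteq> 0" using orthonormal[of i i] by (auto simp: blinfun.zero_right)
    then have "0 < \<mu>e * (norm (\<psi> i))\<^sup>2" using pos by simp
    also have "\<dots> \<le> \<gamma>e - l i"
      using shifted_coercive[OF eigen_phase_tangent, of i] e[OF eigen_phase_tangent, of i] orthonormal[of i i] by simp
    finally have "\<gamma>e - l i \<noteq> 0" by simp
    moreover have "shifted (\<psi> i) v = 0"
      using v(2)[OF eigen_phase_tangent, of i] d shifted_sym[of v "\<psi> i"] by (simp add: fast_space_iff)
    ultimately show ?thesis using e[OF v(1)] by (simp add: inner_commute)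
  qed
  then have vF: "v \<in> ?F" using v(1) by (simp add: fast_space_iff)
  have "emb v \<in> X0" using v(1) by (simp add: phase_tangent_def)
  then have "\<gamma>e *\<^sub>R emb v - emb d \<in> X0"
    using dX subspace_X0 subspace_diff subspace_scale by blast
  then have "(emb v, \<gamma>e *\<^sub>R emb v - emb d) \<in> lin_op \<iota> X0 J u"
    unfolding iff using v by (auto simp: shifted_def inner_diff_left algebra_simps)
  with vF have "v \<in> ?D" by (intro CollectI conjI exI)
  then have "v \<in> closure ?D" by (rule subsetD[OF closure_subset])
  then have "shifted v d = 0"
    using g(2) shifted_sym[of v] by (simp add: d_def a.diff_right)
  then have "emb d \<bullet> emb d = 0" using v(2)[of d] d FH by auto
  then have "d = 0" using embedding_eq_0 by simp
  then show "f \<in> closure ?D" using g(1) by (simp add: d_def)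
qed

lemma hess_ge_on_fast_space:
  assumes "v \<in> fast_space \<iota> X0 J u b"
  shows "ks * (norm (emb v))\<^sup>2 \<le> q v v"
proof -
  have "closed {v. ks * (norm (emb v))\<^sup>2 \<le> q v v}"
    by (intro closed_Collect_le continuous_intros)
  then have "closure {v \<in> fast_space \<iota> X0 J u b. \<exists>y. (emb v, y) \<in> lin_op \<iota> X0 J u}
      \<subseteq> {v. ks * (norm (emb v))\<^sup>2 \<le> q v v}"
    by (intro closure_minimal) (use hess_ge_on_operator_domain in auto)
  then show ?thesis using operator_domain_dense assms by blast
qed

text \<open>The lower bound \<open>ks\<close> in the \<open>X\<close>-norm pays for the term \<open>\<gamma>e\<close> in the energy coercivity: weighting
the two inequalities with \<open>\<gamma>e\<close> and \<open>ks\<close> cancels the \<open>X\<close>-norms.\<close>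

lemma hess_coercive_on_fast_space:
  assumes v: "v \<in> fast_space \<iota> X0 J u b"
  shows "\<mu>e * ks / (ks + \<gamma>e) * (norm v)\<^sup>2 \<le> q v v"
proof -
  have "v \<in> H0" using v by (simp add: fast_space_iff)
  then have "ks * (\<mu>e * (norm v)\<^sup>2) \<le> ks * (q v v + \<gamma>e * (norm (emb v))\<^sup>2)"
    using shifted_coercive[of v] pos by (intro mult_left_mono) (auto simp: shifted_def power2_norm_eq_inner)
  also have "\<dots> \<le> ks * q v v + \<gamma>e * q v v"
    using mult_left_mono[OF hess_ge_on_fast_space[OF v], of \<gamma>e] pos by (simp add: algebra_simps)
  finally show ?thesis using pos by (simp add: field_simps)
qed

text \<open>Split \<open>v = f + y\<close> with \<open>f\<close> fast and \<open>y\<close> slow. The two parts are orthogonal for \<open>q\<close>; the slow part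
has coefficients at most \<open>\<epsilon> * norm v\<close> and eigenvalues at most \<open>b\<close>, and \<open>f\<close> keeps at least half of
the norm of \<open>v\<close>.\<close>

lemma hess_coercive_near_fast_space:
  assumes v: "v \<in> H0" and near: "\<And>i. \<bar>emb v \<bullet> emb (\<psi> i)\<bar> \<le> \<epsilon> * norm v"
    and C4: "\<And>i. norm (\<psi> i) \<le> C4" and small: "real CARD('n) * \<epsilon> * C4 \<le> 1/2" and \<epsilon>: "0 \<le> \<epsilon>"
  shows "(\<mu>e * ks / (ks + \<gamma>e) / 4 - b * real CARD('n) * \<epsilon>\<^sup>2) * (norm v)\<^sup>2 \<le> q v v"
proof -
  define c where "c i = emb v \<bullet> emb (\<psi> i)" for i
  define y where "y = (\<Sum>i\<in>UNIV. c i *\<^sub>R \<psi> i)"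
  define f where "f = v - y"
  have yH: "y \<in> H0"
    unfolding y_def by (intro subspace_sum subspace_scale subspace_phase_tangent eigen_phase_tangent)
  have fH: "f \<in> H0" unfolding f_def using v yH subspace_diff[OF subspace_phase_tangent] by blast
  have cy: "emb y \<bullet> emb (\<psi> i) = c i" for i
    by (simp add: y_def blinfun.sum_right blinfun.scaleR_right inner_sum_left orthonormal if_distrib cong: if_cong)
  have fF: "f \<in> fast_space \<iota> X0 J u b"
    using fH cy by (simp add: fast_space_iff f_def blinfun.diff_right inner_diff_left c_def)
  have qy: "q y w = (\<Sum>i\<in>UNIV. c i * (- l i * (emb (\<psi> i) \<bullet> emb w)))" if "w \<in> H0" for w
    by (simp add: y_def blinfun.sum_right blinfun.sum_left blinfun.scaleR_right blinfun.scaleR_left hess_eigen[OF that])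
  have "q y f = 0"
    using fF unfolding qy[OF fH] by (simp add: fast_space_iff inner_commute)
  moreover have "- (b * real CARD('n) * \<epsilon>\<^sup>2) * (norm v)\<^sup>2 \<le> q y y"
  proof -
    have "- (b * (\<epsilon> * norm v)\<^sup>2) \<le> c i * (- l i * (emb (\<psi> i) \<bullet> emb y))" for i
    proof -
      have "(c i)\<^sup>2 \<le> (\<epsilon> * norm v)\<^sup>2"
        using power_mono[OF near[of i] abs_ge_zero, of 2] by (simp add: c_def)
      then have "\<bar>l i\<bar> * (c i)\<^sup>2 \<le> b * (\<epsilon> * norm v)\<^sup>2"
        using eigen(1)[of i] by (intro mult_mono) auto
      moreover have "l i * (c i)\<^sup>2 \<le> \<bar>l i\<bar> * (c i)\<^sup>2" by (intro mult_right_mono) auto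
      moreover have "c i * (- l i * (emb (\<psi> i) \<bullet> emb y)) = - (l i * (c i)\<^sup>2)"
        using cy[of i] by (simp add: inner_commute power2_eq_square)
      ultimately show ?thesis by linarith
    qed
    then have "(\<Sum>i\<in>(UNIV::'n set). - (b * (\<epsilon> * norm v)\<^sup>2)) \<le> q y y"
      unfolding qy[OF yH] by (intro sum_mono)
    then show ?thesis by (simp add: power_mult_distrib mult_ac)
  qed
  moreover have "q v v = q f f + 2 * q y f + q y y"
  proof -
    have "v = f + y" by (simp add: f_def)
    then show ?thesis
      using hess_symmetric[OF J, of u f y] by (simp add: blinfun.add_left blinfun.add_right)
  qed
  moreover have "\<mu>e * ks / (ks + \<gamma>e) / 4 * (norm v)\<^sup>2 \<le> q f f"
  proof -
    have "norm y \<le> (\<Sum>i\<in>(UNIV::'n set). \<epsilon> * norm v * C4)"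
      unfolding y_def
    proof (rule sum_norm_le)
      fix i
      show "norm (c i *\<^sub>R \<psi> i) \<le> \<epsilon> * norm v * C4"
        using near[of i] C4[of i] \<epsilon> by (simp add: c_def mult_mono)
    qed
    also have "\<dots> = (real CARD('n) * \<epsilon> * C4) * norm v" by simp
    also have "\<dots> \<le> 1/2 * norm v" by (intro mult_right_mono small) simp
    finally have "1/2 * norm v \<le> norm f"
      unfolding f_def using norm_triangle_ineq2[of v y] by simp
    then have "(1/2 * norm v)\<^sup>2 \<le> (norm f)\<^sup>2" by (intro power_mono) auto
    then have "\<mu>e * ks / (ks + \<gamma>e) * (1/2 * norm v)\<^sup>2 \<le> \<mu>e * ks / (ks + \<gamma>e) * (norm f)\<^sup>2"
      using pos by (intro mult_left_mono) auto
    also have "\<dots> \<le> q f f" by (rule hess_coercive_on_fast_space[OF fF])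
    finally show ?thesis by (simp add: power_mult_distrib power2_eq_square)
  qed
  ultimately show ?thesis unfolding left_diff_distrib mult_minus_left by linarith
qed

end

section \<open>Nearest points of the manifold\<close>

lemma linear_axis_expansion:
  fixes h :: "real^'n" and f :: "real^'n \<Rightarrow> 'b::real_vector"
  assumes "linear f"
  shows "f h = (\<Sum>i\<in>UNIV. h $ i *\<^sub>R f (axis i 1))"
proof -
  have "f h = f (\<Sum>i\<in>UNIV. h $ i *\<^sub>R axis i 1)"
    using basis_expansion[of h] by (simp add: scalar_mult_eq_scaleR)
  then show ?thesis by (simp add: linear_sum[OF assms] linear_scale[OF assms] o_def)
qed

lemma norm_sum_components_le:
  fixes h :: "real^'n" and f :: "'n \<Rightarrow> 'b::real_normed_vector"
  assumes "\<And>i. norm (f i) \<le> \<epsilon>"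
  shows "norm (\<Sum>i\<in>UNIV. h $ i *\<^sub>R f i) \<le> real CARD('n) * \<epsilon> * norm h"
proof -
  have "norm (\<Sum>i\<in>UNIV. h $ i *\<^sub>R f i) \<le> (\<Sum>i\<in>(UNIV::'n set). norm h * \<epsilon>)"
  proof (rule sum_norm_le)
    fix i
    show "norm (h $ i *\<^sub>R f i) \<le> norm h * \<epsilon>"
      using assms[of i] component_le_norm_cart[of h i] by (simp add: mult_mono)
  qed
  then show ?thesis by (simp add: mult_ac)
qed

lemma norm_orthonormal_combination:
  fixes h :: "real^'n" and f :: "'n \<Rightarrow> 'b::real_inner"
  assumes "\<And>i j. f i \<bullet> f j = (if i = j then 1 else 0)"
  shows "norm (\<Sum>i\<in>UNIV. h $ i *\<^sub>R f i) = norm h"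
proof -
  have "(\<Sum>i\<in>UNIV. h $ i *\<^sub>R f i) \<bullet> (\<Sum>i\<in>UNIV. h $ i *\<^sub>R f i) = h \<bullet> h"
    by (simp add: inner_sum_left inner_sum_right assms inner_vec_def if_distrib cong: if_cong)
  then show ?thesis by (simp add: norm_eq_sqrt_inner)
qed

text \<open>Subtracting the linear map with columns \<open>\<psi> i\<close> leaves a function whose derivative has entries of
size \<open>\<epsilon>\<close>. With an orthonormal frame, \<open>\<Phi>\<close> is therefore almost an isometry.\<close>

lemma linear_approximation_by_frame:
  fixes \<Phi> :: "real^'n \<Rightarrow> 'b::real_normed_vector"
  assumes d: "\<And>p. p \<in> cball p0 s \<Longrightarrow> (\<Phi> has_derivative \<Phi>' p) (at p)"
    and close: "\<And>p i. p \<in> cball p0 s \<Longrightarrow> norm (\<Phi>' p (axis i 1) - \<psi> i) \<le> \<epsilon>"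
    and p: "p \<in> cball p0 s"
  shows "norm (\<Phi> p - \<Phi> p0 - (\<Sum>i\<in>UNIV. (p - p0) $ i *\<^sub>R \<psi> i)) \<le> real CARD('n) * \<epsilon> * norm (p - p0)"
proof -
  define g where "g p = \<Phi> p - (\<Sum>i\<in>UNIV. p $ i *\<^sub>R \<psi> i)" for p
  have p0: "p0 \<in> cball p0 s" using p by (simp add: order_trans[OF zero_le_dist])
  have "norm (g p - g p0) \<le> real CARD('n) * \<epsilon> * norm (p - p0)"
  proof (rule differentiable_bound[OF convex_cball[of p0 s] _ _ p p0])
    fix x assume x: "x \<in> cball p0 s"
    have lin: "bounded_linear (\<lambda>h. \<Sum>i\<in>UNIV. h $ i *\<^sub>R \<psi> i)"
      by (intro bounded_linear_sum bounded_linear_compose[OF bounded_linear_scaleR_left] bounded_linear_vec_nth)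
    show "(g has_derivative (\<lambda>h. \<Phi>' x h - (\<Sum>i\<in>UNIV. h $ i *\<^sub>R \<psi> i))) (at x within cball p0 s)"
      unfolding g_def by (intro has_derivative_diff has_derivative_at_withinI[OF d[OF x]]
          bounded_linear_imp_has_derivative lin)
    show "onorm (\<lambda>h. \<Phi>' x h - (\<Sum>i\<in>UNIV. h $ i *\<^sub>R \<psi> i)) \<le> real CARD('n) * \<epsilon>"
    proof (rule onorm_le)
      fix h
      have "\<Phi>' x h - (\<Sum>i\<in>UNIV. h $ i *\<^sub>R \<psi> i) = (\<Sum>i\<in>UNIV. h $ i *\<^sub>R (\<Phi>' x (axis i 1) - \<psi> i))"
        unfolding linear_axis_expansion[OF has_derivative_linear[OF d[OF x]], of h]
        by (simp add: scaleR_diff_right sum_subtractf)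
      then show "norm (\<Phi>' x h - (\<Sum>i\<in>UNIV. h $ i *\<^sub>R \<psi> i)) \<le> real CARD('n) * \<epsilon> * norm h"
        using norm_sum_components_le[OF close[OF x]] by simp
    qed
  qed
  moreover have "g p - g p0 = \<Phi> p - \<Phi> p0 - (\<Sum>i\<in>UNIV. (p - p0) $ i *\<^sub>R \<psi> i)"
    by (simp add: g_def scaleR_diff_left sum_subtractf)
  ultimately show ?thesis by simp
qed

text \<open>A point \<open>p\<close> on the boundary of the ball has \<open>\<Phi> p\<close> at distance at least \<open>s / 2\<close> from \<open>\<Phi> p0\<close>, hence
farther from \<open>u\<close> than \<open>\<Phi> p0\<close> is. So the minimum of the distance over the compact ball is attained
in the interior, and there the derivative vanishes.\<close>

lemma nearest_point_critical:
  fixes \<Phi> :: "real^'n \<Rightarrow> 'h::real_normed_vector" and \<iota> :: "'h \<Rightarrow>\<^sub>L 'x::real_inner"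
  assumes d: "\<And>p. p \<in> cball p0 s \<Longrightarrow> (\<Phi> has_derivative \<Phi>' p) (at p)"
    and lower: "\<And>p. p \<in> cball p0 s \<Longrightarrow> 1/2 * norm (p - p0) \<le> norm (blinfun_apply \<iota> (\<Phi> p - \<Phi> p0))"
    and s: "0 < s" "norm (blinfun_apply \<iota> (u - \<Phi> p0)) < s / 4"
  obtains p where "p \<in> cball p0 s" "\<And>h. blinfun_apply \<iota> (u - \<Phi> p) \<bullet> blinfun_apply \<iota> (\<Phi>' p h) = 0"
proof -
  define F where "F p = blinfun_apply \<iota> (u - \<Phi> p) \<bullet> blinfun_apply \<iota> (u - \<Phi> p)" for p
  have "continuous_on (cball p0 s) \<Phi>"
    using d by (meson continuous_at_imp_continuous_on has_derivative_continuous)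
  then have "continuous_on (cball p0 s) F" unfolding F_def by (intro continuous_intros)
  then obtain p where p: "p \<in> cball p0 s" "\<And>x. x \<in> cball p0 s \<Longrightarrow> F p \<le> F x"
    using continuous_attains_inf[OF compact_cball, of p0 s F] s by auto
  have "norm (p - p0) < s"
  proof (rule ccontr)
    assume "\<not> norm (p - p0) < s"
    then have "s / 2 \<le> norm (blinfun_apply \<iota> (\<Phi> p - \<Phi> p0))" using lower[OF p(1)] by simp
    also have "\<Phi> p - \<Phi> p0 = (u - \<Phi> p0) - (u - \<Phi> p)" by simp
    also have "norm (blinfun_apply \<iota> ((u - \<Phi> p0) - (u - \<Phi> p)))
        \<le> norm (blinfun_apply \<iota> (u - \<Phi> p0)) + norm (blinfun_apply \<iota> (u - \<Phi> p))"
      unfolding blinfun.diff_right[of \<iota> "u - \<Phi> p0"] by (rule norm_triangle_ineq4)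
    finally have "norm (blinfun_apply \<iota> (u - \<Phi> p0)) < norm (blinfun_apply \<iota> (u - \<Phi> p))"
      using s by simp
    then have "(norm (blinfun_apply \<iota> (u - \<Phi> p0)))\<^sup>2 < (norm (blinfun_apply \<iota> (u - \<Phi> p)))\<^sup>2"
      by (intro power_strict_mono) auto
    then have "F p0 < F p" by (simp add: F_def power2_norm_eq_inner)
    then show False using p(2)[of p0] s by simp
  qed
  then have pb: "p \<in> ball p0 s" by (simp add: dist_norm norm_minus_commute)
  have di: "((\<lambda>p. blinfun_apply \<iota> (u - \<Phi> p)) has_derivative (\<lambda>h. blinfun_apply \<iota> (0 - \<Phi>' p h))) (at p)"
    by (rule bounded_linear.has_derivative[OF blinfun.bounded_linear_right])
       (intro has_derivative_diff has_derivative_const d p)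
  have "(F has_derivative (\<lambda>h. blinfun_apply \<iota> (u - \<Phi> p) \<bullet> blinfun_apply \<iota> (0 - \<Phi>' p h)
      + blinfun_apply \<iota> (0 - \<Phi>' p h) \<bullet> blinfun_apply \<iota> (u - \<Phi> p))) (at p)"
    unfolding F_def by (rule has_derivative_inner[OF di di])
  from differential_zero_maxmin[OF pb open_ball this]
  have "(\<lambda>h. blinfun_apply \<iota> (u - \<Phi> p) \<bullet> blinfun_apply \<iota> (0 - \<Phi>' p h)
      + blinfun_apply \<iota> (0 - \<Phi>' p h) \<bullet> blinfun_apply \<iota> (u - \<Phi> p)) = (\<lambda>h. 0)"
    using p(2) by auto
  from fun_cong[OF this]
  have "blinfun_apply \<iota> (u - \<Phi> p) \<bullet> blinfun_apply \<iota> (\<Phi>' p h) = 0" for h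
    by (simp add: blinfun.minus_right inner_commute)
  then show thesis using that p(1) by blast
qed

text \<open>Around a parameter \<open>p0\<close> whose image is nearly nearest to \<open>u\<close> the point \<open>p\<close> is sought in a ball of
radius proportional to the distance, and \<open>\<Phi>\<close> is Lipschitz there, so that \<open>\<Phi> p\<close> is as close to \<open>u\<close> up
to a factor. A point \<open>u\<close> at distance zero lies on the extended manifold itself; it is its own
foot point.\<close>

lemma foot_point_exists:
  fixes \<Phi> :: "real^'n \<Rightarrow> 'h::{real_inner,complete_space}" and \<iota> :: "'h \<Rightarrow>\<^sub>L 'x::{real_inner,complete_space}"
  assumes b: "1 \<le> b" "norm \<iota> \<le> b" and s: "0 < s"
    and ball: "\<And>p. p \<in> P \<Longrightarrow> cball p s \<subseteq> Q" and diff: "\<And>p. p \<in> Q \<Longrightarrow> \<Phi> differentiable (at p)"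
    and orthonormal: "\<And>p i j. p \<in> P \<Longrightarrow>
        blinfun_apply \<iota> (\<psi> i p) \<bullet> blinfun_apply \<iota> (\<psi> j p) = (if i = j then 1 else 0)"
    and C4: "\<And>p i. p \<in> P \<Longrightarrow> norm (\<psi> i p) \<le> C4"
    and close: "\<And>p0 p i. p0 \<in> P \<Longrightarrow> p \<in> cball p0 s \<Longrightarrow>
        norm (frechet_derivative \<Phi> (at p) (axis i 1) - \<psi> i p0) \<le> 1 / (2 * b * real CARD('n))"
    and M: "P \<noteq> {}" "closure (\<Phi> ` P) \<subseteq> \<Phi> ` Q" and u: "infdist u (\<Phi> ` P) < s / (10 * b)"
  shows "\<exists>p\<in>Q. norm (u - \<Phi> p) \<le> 2 * (1 + 5 * b * (real CARD('n) * C4 + 1)) * infdist u (\<Phi> ` P) \<and>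
     (\<forall>h. blinfun_apply \<iota> (u - \<Phi> p) \<bullet> blinfun_apply \<iota> (frechet_derivative \<Phi> (at p) h) = 0)"
proof (cases "infdist u (\<Phi> ` P) = 0")
  case True
  then have "u \<in> closure (\<Phi> ` P)" using in_closure_iff_infdist_zero[of "\<Phi> ` P" u] M(1) by simp
  then obtain p where "p \<in> Q" "u = \<Phi> p" using M(2) by blast
  then show ?thesis using True by (intro bexI[of _ p]) (simp_all add: blinfun.zero_right)
next
  case False
  define d where "d = infdist u (\<Phi> ` P)"
  define n where "n = real CARD('n)"
  have n: "0 < n" by (simp add: n_def)
  have d: "0 < d" using False infdist_nonneg[of u "\<Phi> ` P"] by (simp add: d_def)
  have "\<exists>a\<in>\<Phi> ` P. dist u a < 2 * d"
  proof (rule ccontr)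
    assume "\<not> ?thesis"
    then have "2 * d \<le> (INF a\<in>\<Phi> ` P. dist u a)"
      using M(1) by (intro cINF_greatest) (auto simp: not_less)
    then show False using d M(1) by (simp add: d_def infdist_notempty)
  qed
  then obtain p0 where p0: "p0 \<in> P" and r: "norm (u - \<Phi> p0) < 2 * d"
    by (auto simp: dist_norm)
  have P0: "0 < norm (u - \<Phi> p0)"
  proof -
    have "d \<le> dist u (\<Phi> p0)" unfolding d_def using p0 by (intro infdist_le) auto
    then show ?thesis using d unfolding dist_norm by linarith
  qed
  \<comment> \<open>more than four times the \<open>X\<close>-distance, as required for an interior minimum\<close>
  define t where "t = 5 * b * norm (u - \<Phi> p0)"
  have t: "0 < t" using P0 b by (simp add: t_def)
  have ts: "t \<le> s"
  proof -
    have "t \<le> 5 * b * (2 * d)" unfolding t_def using r b by (intro mult_left_mono) auto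
    also have "\<dots> \<le> s" using u b by (simp add: d_def[symmetric] pos_less_divide_eq mult_ac)
    finally show ?thesis .
  qed
  have emb: "norm (blinfun_apply \<iota> x) \<le> b * norm x" for x
    by (rule order_trans[OF norm_blinfun]) (intro mult_right_mono b norm_ge_zero)
  have sub: "cball p0 t \<subseteq> cball p0 s" using ts by auto
  have D: "(\<Phi> has_derivative frechet_derivative \<Phi> (at p)) (at p)" if "p \<in> cball p0 t" for p
    using that sub ball[OF p0] diff frechet_derivative_works by blast
  have approx: "norm (\<Phi> p - \<Phi> p0 - (\<Sum>i\<in>UNIV. (p - p0) $ i *\<^sub>R \<psi> i p0)) \<le> 1 / (2 * b) * norm (p - p0)"
    if "p \<in> cball p0 t" for p
    using linear_approximation_by_frame[OF D close[OF p0 subsetD[OF sub]] that] n by (simp add: n_def)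
  have lower: "1/2 * norm (p - p0) \<le> norm (blinfun_apply \<iota> (\<Phi> p - \<Phi> p0))" if p: "p \<in> cball p0 t" for p
  proof -
    define y where "y = (\<Sum>i\<in>UNIV. (p - p0) $ i *\<^sub>R \<psi> i p0)"
    have y: "norm (blinfun_apply \<iota> y) = norm (p - p0)"
      unfolding y_def blinfun.sum_right blinfun.scaleR_right
      by (rule norm_orthonormal_combination) (rule orthonormal[OF p0])
    have "norm (blinfun_apply \<iota> (\<Phi> p - \<Phi> p0 - y)) \<le> b * (1 / (2 * b) * norm (p - p0))"
      using order_trans[OF emb mult_left_mono[OF approx[OF p, folded y_def]]] b by simp
    also have "\<dots> = 1/2 * norm (p - p0)" using b by simp
    finally have "norm (blinfun_apply \<iota> (\<Phi> p - \<Phi> p0) - blinfun_apply \<iota> y) \<le> 1/2 * norm (p - p0)"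
      by (simp add: blinfun.diff_right)
    then show ?thesis
      using norm_triangle_ineq3[of "blinfun_apply \<iota> (\<Phi> p - \<Phi> p0)" "blinfun_apply \<iota> y"] y by simp
  qed
  have "norm (blinfun_apply \<iota> (u - \<Phi> p0)) \<le> b * norm (u - \<Phi> p0)" by (rule emb)
  also have "\<dots> < t / 4" using P0 b by (simp add: t_def)
  finally obtain p where p: "p \<in> cball p0 t"
    "\<And>h. blinfun_apply \<iota> (u - \<Phi> p) \<bullet> blinfun_apply \<iota> (frechet_derivative \<Phi> (at p) h) = 0"
    using nearest_point_critical[OF D lower t] by blast
  have "norm (\<Phi> p - \<Phi> p0) \<le> (n * C4 + 1) * norm (p - p0)"
  proof -
    have "norm (\<Sum>i\<in>UNIV. (p - p0) $ i *\<^sub>R \<psi> i p0) \<le> n * C4 * norm (p - p0)"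
      unfolding n_def by (rule norm_sum_components_le) (rule C4[OF p0])
    moreover have "1 / (2 * b) * norm (p - p0) \<le> 1 * norm (p - p0)"
      using b by (intro mult_right_mono) (auto simp: divide_le_eq)
    ultimately show ?thesis
      using approx[OF p(1)] norm_triangle_sub[of "\<Phi> p - \<Phi> p0" "\<Sum>i\<in>UNIV. (p - p0) $ i *\<^sub>R \<psi> i p0"]
      unfolding distrib_right by linarith
  qed
  also have "\<dots> \<le> (n * C4 + 1) * t"
  proof (intro mult_left_mono)
    show "norm (p - p0) \<le> t" using p(1) by (simp add: dist_norm norm_minus_commute)
    have "0 \<le> C4" using C4[OF p0, of undefined] norm_ge_zero[of "\<psi> undefined p0"] by linarith
    then show "0 \<le> n * C4 + 1" using n by simp
  qed
  finally have "norm (\<Phi> p - \<Phi> p0) \<le> (n * C4 + 1) * (5 * b * norm (u - \<Phi> p0))" by (simp add: t_def)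
  then have "norm (u - \<Phi> p) \<le> (1 + 5 * b * (n * C4 + 1)) * norm (u - \<Phi> p0)"
    using norm_triangle_ineq4[of "u - \<Phi> p0" "\<Phi> p - \<Phi> p0"] by (simp add: algebra_simps)
  also have "\<dots> \<le> (1 + 5 * b * (n * C4 + 1)) * (2 * d)"
  proof (intro mult_left_mono)
    have "0 \<le> C4" using C4[OF p0, of undefined] norm_ge_zero[of "\<psi> undefined p0"] by linarith
    then show "0 \<le> 1 + 5 * b * (n * C4 + 1)" using n b by simp
  qed (use r in simp)
  finally have "norm (u - \<Phi> p) \<le> 2 * (1 + 5 * b * (n * C4 + 1)) * d" by (simp add: mult_ac)
  then show ?thesis using p sub ball[OF p0] unfolding n_def d_def by blast
qed

text \<open>Landau's interpolation inequality: the derivative in a unit direction is the difference quotient over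
length \<open>h\<close>, at most \<open>2 * C / h\<close>, up to the variation \<open>C * h\<close> of the derivative over that length.\<close>

lemma derivative_bound_of_second_derivative:
  fixes \<psi> :: "'p::real_normed_vector \<Rightarrow> 'b::real_normed_vector"
  assumes h: "0 < h"
    and d1: "\<And>q. q \<in> cball p h \<Longrightarrow> (\<psi> has_derivative blinfun_apply (\<psi>' q)) (at q)"
    and d2: "\<And>q. q \<in> cball p h \<Longrightarrow> (\<psi>' has_derivative blinfun_apply (\<psi>'' q)) (at q)"
    and C: "\<And>q. q \<in> cball p h \<Longrightarrow> norm (\<psi> q) \<le> C" "\<And>q. q \<in> cball p h \<Longrightarrow> norm (\<psi>'' q) \<le> C"
  shows "norm (\<psi>' p) \<le> 2 * C / h + C * h"
proof (rule norm_blinfun_bound)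
  have p: "p \<in> cball p h" using h by simp
  have C0: "0 \<le> C" using C(1)[OF p] norm_ge_zero[of "\<psi> p"] by linarith
  then show "0 \<le> 2 * C / h + C * h" using h by simp
  fix v
  show "norm (blinfun_apply (\<psi>' p) v) \<le> (2 * C / h + C * h) * norm v"
  proof (cases "v = 0")
    case False
    define e where "e = (h / norm v) *\<^sub>R v"
    have e: "norm e = h" using False h by (simp add: e_def)
    have pe: "p + e \<in> cball p h" using e by (simp add: dist_norm)
    have D: "norm (\<psi>' q - \<psi>' p) \<le> C * h" if q: "q \<in> cball p h" for q
    proof -
      have "norm (\<psi>' q - \<psi>' p) \<le> C * norm (q - p)"
        by (rule differentiable_bound[OF convex_cball[of p h] has_derivative_at_withinI[OF d2] _ q p])
           (simp_all add: C(2) flip: norm_blinfun.rep_eq)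
      also have "\<dots> \<le> C * h" using q C0 by (intro mult_left_mono) (simp_all add: dist_norm norm_minus_commute)
      finally show ?thesis .
    qed
    have first: "norm ((\<psi> (p + e) - blinfun_apply (\<psi>' p) (p + e)) - (\<psi> p - blinfun_apply (\<psi>' p) p)) \<le> (C * h) * norm (p + e - p)"
    proof (rule differentiable_bound[OF convex_cball[of p h] _ _ pe p])
      fix q assume q: "q \<in> cball p h"
      show "((\<lambda>q. \<psi> q - blinfun_apply (\<psi>' p) q) has_derivative blinfun_apply (\<psi>' q - \<psi>' p)) (at q within cball p h)"
        by (rule has_derivative_eq_rhs[OF has_derivative_diff[OF has_derivative_at_withinI[OF d1[OF q]]
              bounded_linear_imp_has_derivative[OF blinfun.bounded_linear_right]]])
           (simp add: fun_eq_iff blinfun.diff_left)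
      show "onorm (blinfun_apply (\<psi>' q - \<psi>' p)) \<le> C * h"
        using D[OF q] by (simp add: norm_blinfun.rep_eq)
    qed
    have "norm (\<psi> (p + e) - \<psi> p - blinfun_apply (\<psi>' p) e) \<le> C * h * h"
    proof -
      have "\<psi> (p + e) - blinfun_apply (\<psi>' p) (p + e) - (\<psi> p - blinfun_apply (\<psi>' p) p)
          = \<psi> (p + e) - \<psi> p - blinfun_apply (\<psi>' p) e"
        by (simp add: blinfun.add_right)
      with first show ?thesis using e by simp
    qed
    then have "norm (blinfun_apply (\<psi>' p) e) \<le> 2 * C + C * h * h"
      using C(1)[OF p] C(1)[OF pe] norm_triangle_ineq4[of "\<psi> (p + e)" "\<psi> p"]
        norm_triangle_ineq4[of "\<psi> (p + e) - \<psi> p" "\<psi> (p + e) - \<psi> p - blinfun_apply (\<psi>' p) e"]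
      by simp
    then have "norm v / h * norm (blinfun_apply (\<psi>' p) e) \<le> norm v / h * (2 * C + C * h * h)"
      using h by (intro mult_left_mono) auto
    moreover have "norm (blinfun_apply (\<psi>' p) v) = norm v / h * norm (blinfun_apply (\<psi>' p) e)"
      using h False by (simp add: e_def blinfun.scaleR_right)
    moreover have "norm v / h * (2 * C + C * h * h) = (2 * C / h + C * h) * norm v"
      using h by (simp add: add_divide_distrib distrib_left distrib_right)
    ultimately show ?thesis by linarith
  qed simp
qed

text \<open>Only the frame and its second derivative are bounded by \<open>C4\<close>. The margin \<open>m\<close> leaves around each
point of the half ball a ball of radius \<open>m / 4\<close> on which to interpolate.\<close>

lemma frame_lipschitz:
  fixes \<psi> :: "real^'n \<Rightarrow> 'h::real_normed_vector"
  assumes m: "0 < m" and ball: "ball p0 m \<subseteq> Q"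
    and diff: "\<And>p. p \<in> Q \<Longrightarrow> \<psi> differentiable (at p) \<and> fderiv \<psi> differentiable (at p) \<and>
       norm (\<psi> p) + norm (fderiv (fderiv \<psi>) p) \<le> C4"
    and p: "p \<in> cball p0 (m / 2)"
  shows "norm (\<psi> p - \<psi> p0) \<le> (8 * C4 / m + C4 * m / 4) * norm (p - p0)"
proof (rule differentiable_bound[OF convex_cball[of p0 "m/2"] _ _ p])
  show "p0 \<in> cball p0 (m / 2)" using m by simp
  fix x assume x: "x \<in> cball p0 (m / 2)"
  have sub: "q \<in> Q" if "q \<in> cball x (m / 4)" for q
  proof -
    have "dist p0 q \<le> dist p0 x + dist x q" by (rule dist_triangle)
    also have "\<dots> < m" using that x m by simp
    finally have "q \<in> ball p0 m" by (simp only: mem_ball)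
    then show ?thesis by (rule subsetD[OF ball])
  qed
  have xQ: "x \<in> Q" using sub m by simp
  show "(\<psi> has_derivative blinfun_apply (fderiv \<psi> x)) (at x within cball p0 (m / 2))"
    using diff[OF xQ] by (simp add: has_derivative_at_withinI[OF has_derivative_fderiv])
  have "norm (fderiv \<psi> x) \<le> 2 * C4 / (m / 4) + C4 * (m / 4)"
  proof (rule derivative_bound_of_second_derivative)
    fix q assume "q \<in> cball x (m / 4)"
    note dq = diff[OF sub[OF this]]
    show "(\<psi> has_derivative blinfun_apply (fderiv \<psi> q)) (at q)"
      "(fderiv \<psi> has_derivative blinfun_apply (fderiv (fderiv \<psi>) q)) (at q)"
      using dq by (simp_all add: has_derivative_fderiv)
    show "norm (\<psi> q) \<le> C4" "norm (fderiv (fderiv \<psi>) q) \<le> C4"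
      using dq norm_ge_zero[of "\<psi> q"] norm_ge_zero[of "fderiv (fderiv \<psi>) q"] by linarith+
  qed (use m in simp)
  then show "onorm (blinfun_apply (fderiv \<psi> x)) \<le> 8 * C4 / m + C4 * m / 4"
    using m by (simp add: norm_blinfun.rep_eq)
qed

section \<open>Existence of the energy projection\<close>

context constrained_triple
begin

text \<open>The derivative of \<open>J\<close> along the segment from \<open>\<phi>\<close> to \<open>\<phi> + v\<close> is affine up to the pairing of the
nonlinearity with \<open>v\<close>, which gains one power of \<open>norm v\<close>.\<close>

lemma energy_taylor:
  assumes J: "smooth_on UNIV J" and b: "norm \<iota> \<le> b" and r: "1 < r" and C: "0 \<le> C"
    and N: "\<And>v. v \<in> phase_tangent \<iota> X0 \<Longrightarrow> \<exists>N. rhs \<iota> X0 J (\<phi> + v) =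
        rhs \<iota> X0 J \<phi> + blinfun_apply (linearization \<iota> X0 J \<phi>) v + to_dual \<iota> (blinfun_apply \<iota> N) \<and>
        norm N \<le> C * norm v powr r"
    and v: "v \<in> phase_tangent \<iota> X0"
  shows "\<bar>J (\<phi> + v) - J \<phi> - blinfun_apply (grad J \<phi>) v - 1/2 * blinfun_apply (blinfun_apply (hess J \<phi>) v) v\<bar>
    \<le> b\<^sup>2 * C * norm v powr (r + 1)"
proof (rule taylor_second_order[OF smooth_energy_grad[OF J]])
  fix s :: real assume s: "0 \<le> s" "s \<le> 1"
  have b0: "0 \<le> b" using b norm_ge_zero[of \<iota>] by linarith
  have emb: "norm (blinfun_apply \<iota> x) \<le> b * norm x" for x
    by (rule order_trans[OF norm_blinfun]) (intro mult_right_mono b norm_ge_zero)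
  have sv: "s *\<^sub>R v \<in> phase_tangent \<iota> X0" using v subspace_phase_tangent subspace_scale by blast
  obtain N where N: "rhs \<iota> X0 J (\<phi> + s *\<^sub>R v) =
        rhs \<iota> X0 J \<phi> + blinfun_apply (linearization \<iota> X0 J \<phi>) (s *\<^sub>R v) + to_dual \<iota> (blinfun_apply \<iota> N)"
      "norm N \<le> C * norm (s *\<^sub>R v) powr r"
    using N[OF sv] by blast
  have "blinfun_apply (grad J (\<phi> + s *\<^sub>R v)) v - blinfun_apply (grad J \<phi>) v
      - s * blinfun_apply (blinfun_apply (hess J \<phi>) v) v = - (blinfun_apply \<iota> N \<bullet> blinfun_apply \<iota> v)"
    using arg_cong[OF N(1), of "\<lambda>f. blinfun_apply f v"]
    by (simp add: blinfun.add_left rhs_apply linearization_apply[OF J] orth_proj_H_phase_tangent(2)[OF v]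
        to_dual_def blinfun.scaleR_left blinfun.scaleR_right)
  also have "\<bar>- (blinfun_apply \<iota> N \<bullet> blinfun_apply \<iota> v)\<bar> \<le> norm (blinfun_apply \<iota> N) * norm (blinfun_apply \<iota> v)"
    using Cauchy_Schwarz_ineq2 by simp
  also have "\<dots> \<le> (b * (C * norm v powr r)) * (b * norm v)"
  proof (intro mult_mono emb)
    have "norm (s *\<^sub>R v) \<le> norm v" using s by (simp add: mult_left_le_one_le)
    then have "norm (s *\<^sub>R v) powr r \<le> norm v powr r" using r by (intro powr_mono2) auto
    from order_trans[OF N(2) mult_left_mono[OF this C]] have "norm N \<le> C * norm v powr r" .
    from order_trans[OF emb mult_left_mono[OF this b0]]
    show "norm (blinfun_apply \<iota> N) \<le> b * (C * norm v powr r)" .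
  qed (use b0 C in auto)
  also have "\<dots> = b\<^sup>2 * C * norm v powr (r + 1)"
    by (simp add: power2_eq_square powr_mult_base[symmetric] add.commute[of r] mult_ac)
  finally show "\<bar>blinfun_apply (grad J (\<phi> + s *\<^sub>R v)) v - blinfun_apply (grad J \<phi>) v
      - s * blinfun_apply (blinfun_apply (hess J \<phi>) v) v\<bar> \<le> b\<^sup>2 * C * norm v powr (r + 1)" .
qed

lemma grad_bound:
  assumes b: "norm \<iota> \<le> b" and R: "rhs \<iota> X0 J \<phi> = to_dual \<iota> (blinfun_apply \<iota> R)" "norm R \<le> e"
    and v: "v \<in> phase_tangent \<iota> X0"
  shows "\<bar>blinfun_apply (grad J \<phi>) v\<bar> \<le> b\<^sup>2 * e * norm v"
proof -
  have b0: "0 \<le> b" using b norm_ge_zero[of \<iota>] by linarith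
  have emb: "norm (blinfun_apply \<iota> x) \<le> b * norm x" for x
    by (rule order_trans[OF norm_blinfun]) (intro mult_right_mono b norm_ge_zero)
  have e0: "0 \<le> e" using R(2) norm_ge_zero[of R] by linarith
  have "blinfun_apply (grad J \<phi>) v = - (blinfun_apply \<iota> R \<bullet> blinfun_apply \<iota> v)"
    using arg_cong[OF R(1), of "\<lambda>f. blinfun_apply f v"]
    by (simp add: rhs_apply orth_proj_H_phase_tangent(2)[OF v] to_dual_def)
  also have "\<bar>- (blinfun_apply \<iota> R \<bullet> blinfun_apply \<iota> v)\<bar> \<le> norm (blinfun_apply \<iota> R) * norm (blinfun_apply \<iota> v)"
    using Cauchy_Schwarz_ineq2 by simp
  also have "\<dots> \<le> (b * e) * (b * norm v)"
    by (intro mult_mono emb order_trans[OF emb mult_left_mono[OF R(2) b0]]) (use b0 e0 in auto)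
  finally show ?thesis by (simp add: power2_eq_square mult_ac)
qed

text \<open>The projection sends \<open>u\<close> to a foot point, whose residual is \<open>X\<close>-orthogonal to the tangent space.
The tangent vectors are within \<open>C3 * \<delta>\<close> of the slow eigenvectors, so the slow components of the
residual are at most \<open>b\<^sup>2 * C3 * \<delta>\<close> times its norm. The first smallness condition makes \<open>\<Phi>\<close> nearly
isometric, the other two keep the second variation coercive on the residual.\<close>

lemma energy_projection_exists:
  fixes J :: "'h \<Rightarrow> real" and \<Phi> :: "real^'n \<Rightarrow> 'h" and C r C0 c0 ks C2 C3 C4 \<mu>e \<gamma>e m \<delta> b :: real
  assumes J: "smooth_on UNIV J" and manifold: "param_manifold \<Phi> P Q m"
    and hyps: "spectral_hyps \<iota> X0 J \<Phi> Q \<delta> C r C0 c0 ks C2 C3 C4"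
    and affine: "\<Phi> ` Q \<subseteq> in_affine \<iota> X0 u0"
    and coercive: "energy_coercive \<iota> X0 J (\<Phi> ` Q) \<mu>e \<gamma>e"
    and pos: "0 < C" "1 < r" "0 < C0" "0 < c0" "0 < ks" "0 < C3" "0 < C4" "0 < \<mu>e" "0 < \<gamma>e" "0 < m" "0 < \<delta>"
    and b: "1 \<le> b" "norm \<iota> \<le> b"
    and small: "4 * b * real CARD('n) * C3 * \<delta> \<le> 1"
      "2 * real CARD('n) * b\<^sup>2 * C3 * C4 * \<delta> \<le> 1"
      "8 * (c0 * \<delta>) * real CARD('n) * (b\<^sup>2 * C3 * \<delta>)\<^sup>2 \<le> \<mu>e * ks / (ks + \<gamma>e)"
  shows "\<exists>\<pi> \<eta> c1 \<delta>2 c2 \<mu>2 \<rho>. energy_projection \<iota> X0 J \<Phi> P Q u0 \<pi> \<eta> c1 \<delta>2 c2 \<mu>2 \<rho>"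
proof -
  define n where "n = real CARD('n)"
  define \<kappa> where "\<kappa> = \<mu>e * ks / (ks + \<gamma>e)"
  have n: "0 < n" by (simp add: n_def)
  have \<kappa>: "0 < \<kappa>" using pos by (simp add: \<kappa>_def)
  have emb: "norm (blinfun_apply \<iota> x) \<le> b * norm x" for x
    by (rule order_trans[OF norm_blinfun]) (intro mult_right_mono b norm_ge_zero)
  have Q: "open Q" and PQ: "\<And>p. p \<in> P \<Longrightarrow> ball p m \<subseteq> Q" and M: "P \<noteq> {}" "closure (\<Phi> ` P) \<subseteq> \<Phi> ` Q"
    using manifold by (auto simp: param_manifold_def)
  have diff: "\<Phi> differentiable (at p)" if "p \<in> Q" for p
    by (rule smooth_on_differentiable[OF _ Q that]) (use manifold in \<open>simp add: param_manifold_def\<close>)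
  have N: "\<exists>N. rhs \<iota> X0 J (\<Phi> p + v) = rhs \<iota> X0 J (\<Phi> p)
        + blinfun_apply (linearization \<iota> X0 J (\<Phi> p)) v + to_dual \<iota> (blinfun_apply \<iota> N) \<and>
        norm N \<le> C * norm v powr r" if "p \<in> Q" "v \<in> phase_tangent \<iota> X0" for p v
    using hyps that unfolding spectral_hyps_def phase_tangent_def by simp
  have R: "\<exists>R. rhs \<iota> X0 J (\<Phi> p) = to_dual \<iota> (blinfun_apply \<iota> R) \<and> norm R \<le> C0 * \<delta>" if "p \<in> Q" for p
    using hyps that unfolding spectral_hyps_def by simp
  have dim: "dim (slow_space \<iota> X0 J (\<Phi> p) (c0 * \<delta>)) = CARD('n)" if "p \<in> Q" for p
    using hyps that unfolding spectral_hyps_def by simp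
  have semigroup: "\<exists>S. c0_semigroup_on X0 S \<and> semigroup_generator X0 S = lin_op \<iota> X0 J (\<Phi> p) \<and>
        (\<forall>t\<ge>0. \<forall>u\<in>fast_space \<iota> X0 J (\<Phi> p) (c0 * \<delta>).
           \<exists>w. blinfun_apply \<iota> w = S t (blinfun_apply \<iota> u) \<and>
               norm w \<le> C2 * exp (- ks * t) * norm u)" if "p \<in> Q" for p
    using hyps that unfolding spectral_hyps_def by simp
  obtain \<psi> :: "'n \<Rightarrow> real^'n \<Rightarrow> 'h" where
    eigen: "\<forall>p\<in>Q. \<forall>i. \<exists>l. \<bar>l\<bar> \<le> c0 * \<delta> \<and>
           (blinfun_apply \<iota> (\<psi> i p), l *\<^sub>R blinfun_apply \<iota> (\<psi> i p)) \<in> lin_op \<iota> X0 J (\<Phi> p)"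
    and orthonormal: "\<forall>p\<in>Q. \<forall>i j. blinfun_apply \<iota> (\<psi> i p) \<bullet> blinfun_apply \<iota> (\<psi> j p) = (if i = j then 1 else 0)"
    and aligned: "\<forall>p\<in>Q. \<forall>i. norm (\<psi> i p - frechet_derivative \<Phi> (at p) (axis i 1)) \<le> C3 * \<delta>"
    and regular: "\<forall>p\<in>Q. \<forall>i. \<psi> i differentiable (at p) \<and> fderiv (\<psi> i) differentiable (at p) \<and>
           norm (\<psi> i p) + norm (fderiv (fderiv (\<psi> i)) p) \<le> C4"
    using hyps unfolding spectral_hyps_def by (elim conjE exE)
  have C4: "norm (\<psi> i p) \<le> C4" if "p \<in> Q" for i p
    using regular that norm_ge_zero[of "fderiv (fderiv (\<psi> i)) p"] by (meson add_increasing2 order_trans order_refl)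
  have inQ: "p \<in> Q" if "p \<in> P" for p using PQ[OF that] pos by auto

  define Lip where "Lip = 8 * C4 / m + C4 * m / 4"
  have Lip: "0 < Lip" using pos by (simp add: Lip_def add_pos_pos)
  \<comment> \<open>small enough that over a ball of radius \<open>s\<close> the frame varies by at most \<open>1 / (4 * b * n)\<close>\<close>
  define s where "s = min (m / 2) (1 / (4 * b * n * Lip))"
  have s: "0 < s" "s \<le> m / 2" "4 * b * n * Lip * s \<le> 1"
  proof -
    have p: "0 < 4 * b * n * Lip" using b n Lip by simp
    show "0 < s" unfolding s_def using pos p by simp
    show "s \<le> m / 2" by (simp add: s_def)
    have "s \<le> 1 / (4 * b * n * Lip)" by (simp add: s_def)
    then show "4 * b * n * Lip * s \<le> 1" using p by (simp add: pos_le_divide_eq mult.commute)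
  qed
  have sm: "cball p s \<subseteq> ball p m" for p :: "real^'n" using s pos by auto
  have close: "norm (frechet_derivative \<Phi> (at p) (axis i 1) - \<psi> i p0) \<le> 1 / (2 * b * real CARD('n))"
    if p0: "p0 \<in> P" and p: "p \<in> cball p0 s" for p0 p i
  proof -
    have pQ: "p \<in> Q" using p sm PQ[OF p0] by blast
    have "norm (\<psi> i p - \<psi> i p0) \<le> Lip * norm (p - p0)"
      unfolding Lip_def by (rule frame_lipschitz[OF pos(10) PQ[OF p0]]) (use regular p s in auto)
    also have "\<dots> \<le> Lip * s" using p Lip by (intro mult_left_mono) (auto simp: dist_norm norm_minus_commute)
    finally have "norm (\<psi> i p - \<psi> i p0) \<le> Lip * s" .
    moreover have "norm (frechet_derivative \<Phi> (at p) (axis i 1) - \<psi> i p) \<le> C3 * \<delta>"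
      using aligned pQ by (simp add: norm_minus_commute)
    ultimately have "norm (frechet_derivative \<Phi> (at p) (axis i 1) - \<psi> i p0) \<le> C3 * \<delta> + Lip * s"
      using norm_triangle_ineq[of "frechet_derivative \<Phi> (at p) (axis i 1) - \<psi> i p" "\<psi> i p - \<psi> i p0"] by simp
    also have "\<dots> \<le> 1 / (2 * b * n)"
    proof -
      have "(C3 * \<delta> + Lip * s) * (2 * b * n) \<le> 1"
        using small(1) s(3) by (simp add: n_def algebra_simps)
      then show ?thesis using b n by (simp add: pos_le_divide_eq)
    qed
    finally show ?thesis by (simp add: n_def)
  qed
  \<comment> \<open>a parameter with image within twice the distance exists, and its search radius is \<open>5 * b\<close> times that\<close>
  define \<eta> where "\<eta> = s / (10 * b)"
  define c1 where "c1 = 2 * (1 + 5 * b * (n * C4 + 1))"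
  have "\<forall>u\<in>affine_nbhd \<iota> X0 u0 (\<Phi> ` P) \<eta>. \<exists>p. p \<in> Q \<and> norm (u - \<Phi> p) \<le> c1 * infdist u (\<Phi> ` P) \<and>
     (\<forall>h. blinfun_apply \<iota> (u - \<Phi> p) \<bullet> blinfun_apply \<iota> (frechet_derivative \<Phi> (at p) h) = 0)"
  proof
    fix u assume "u \<in> affine_nbhd \<iota> X0 u0 (\<Phi> ` P) \<eta>"
    then have u: "infdist u (\<Phi> ` P) < s / (10 * b)" by (simp add: affine_nbhd_def \<eta>_def)
    have "\<exists>p\<in>Q. norm (u - \<Phi> p) \<le> 2 * (1 + 5 * b * (real CARD('n) * C4 + 1)) * infdist u (\<Phi> ` P) \<and>
     (\<forall>h. blinfun_apply \<iota> (u - \<Phi> p) \<bullet> blinfun_apply \<iota> (frechet_derivative \<Phi> (at p) h) = 0)"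
    proof (rule foot_point_exists[OF b s(1) _ diff _ _ close M u])
      show "cball p s \<subseteq> Q" if "p \<in> P" for p using sm PQ[OF that] by (rule subset_trans)
      show "blinfun_apply \<iota> (\<psi> i p) \<bullet> blinfun_apply \<iota> (\<psi> j p) = (if i = j then 1 else 0)"
        if "p \<in> P" for p i j
        by (rule orthonormal[rule_format, OF inQ[OF that]])
      show "norm (\<psi> i p) \<le> C4" if "p \<in> P" for p i using C4[OF inQ[OF that]] .
    qed
    then show "\<exists>p. p \<in> Q \<and> norm (u - \<Phi> p) \<le> c1 * infdist u (\<Phi> ` P) \<and>
     (\<forall>h. blinfun_apply \<iota> (u - \<Phi> p) \<bullet> blinfun_apply \<iota> (frechet_derivative \<Phi> (at p) h) = 0)"
      unfolding c1_def n_def by blast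
  qed
  from bchoice[OF this] obtain \<pi> where \<pi>: "\<And>u. u \<in> affine_nbhd \<iota> X0 u0 (\<Phi> ` P) \<eta> \<Longrightarrow> \<pi> u \<in> Q"
    "\<And>u. u \<in> affine_nbhd \<iota> X0 u0 (\<Phi> ` P) \<eta> \<Longrightarrow> norm (u - \<Phi> (\<pi> u)) \<le> c1 * infdist u (\<Phi> ` P)"
    "\<And>u h. u \<in> affine_nbhd \<iota> X0 u0 (\<Phi> ` P) \<eta> \<Longrightarrow>
       blinfun_apply \<iota> (u - \<Phi> (\<pi> u)) \<bullet> blinfun_apply \<iota> (frechet_derivative \<Phi> (at (\<pi> u)) h) = 0"
    by blast
  have hess: "\<kappa> / 8 * (norm v)\<^sup>2 \<le> blinfun_apply (blinfun_apply (hess J (\<Phi> p)) v) v"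
    if p: "p \<in> Q" and v: "v \<in> phase_tangent \<iota> X0"
      and crit: "\<And>h. blinfun_apply \<iota> v \<bullet> blinfun_apply \<iota> (frechet_derivative \<Phi> (at p) h) = 0" for p v
  proof -
    define \<epsilon> where "\<epsilon> = b\<^sup>2 * C3 * \<delta>"
    have \<epsilon>: "0 \<le> \<epsilon>" using pos by (simp add: \<epsilon>_def)
    obtain l where l: "\<And>i. \<bar>l i\<bar> \<le> c0 * \<delta>"
      "\<And>i. (blinfun_apply \<iota> (\<psi> i p), l i *\<^sub>R blinfun_apply \<iota> (\<psi> i p)) \<in> lin_op \<iota> X0 J (\<Phi> p)"
      using choice[OF bspec[OF eigen p]] by blast
    obtain S where S: "c0_semigroup_on X0 S" "semigroup_generator X0 S = lin_op \<iota> X0 J (\<Phi> p)"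
      "\<forall>t\<ge>0. \<forall>u\<in>fast_space \<iota> X0 J (\<Phi> p) (c0 * \<delta>). \<exists>w. blinfun_apply \<iota> w = S t (blinfun_apply \<iota> u) \<and>
               norm w \<le> C2 * exp (- ks * t) * norm u"
      using semigroup[OF p] by blast
    interpret sp: spectral_splitting \<iota> X0 J "\<Phi> p" "\<lambda>i. \<psi> i p" l S "c0 * \<delta>" \<mu>e \<gamma>e ks C2
    proof
      show "energy_coercive \<iota> X0 J {\<Phi> p} \<mu>e \<gamma>e" using coercive p by (simp add: energy_coercive_def)
    qed (use J pos dim[OF p] S l orthonormal p in auto)
    have near: "\<bar>blinfun_apply \<iota> v \<bullet> blinfun_apply \<iota> (\<psi> i p)\<bar> \<le> \<epsilon> * norm v" for i
    proof -
      have "blinfun_apply \<iota> v \<bullet> blinfun_apply \<iota> (\<psi> i p)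
          = blinfun_apply \<iota> v \<bullet> blinfun_apply \<iota> (\<psi> i p - frechet_derivative \<Phi> (at p) (axis i 1))"
        using crit by (simp add: blinfun.diff_right inner_diff_right)
      also have "\<bar>\<dots>\<bar> \<le> norm (blinfun_apply \<iota> v) * norm (blinfun_apply \<iota> (\<psi> i p - frechet_derivative \<Phi> (at p) (axis i 1)))"
        by (rule Cauchy_Schwarz_ineq2)
      also have "\<dots> \<le> (b * norm v) * (b * (C3 * \<delta>))"
      proof (intro mult_mono emb)
        have "norm (\<psi> i p - frechet_derivative \<Phi> (at p) (axis i 1)) \<le> C3 * \<delta>" using aligned p by blast
        then show "norm (blinfun_apply \<iota> (\<psi> i p - frechet_derivative \<Phi> (at p) (axis i 1))) \<le> b * (C3 * \<delta>)"
          using emb b by (meson mult_left_mono order_trans zero_le_one)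
      qed (use b in auto)
      finally show ?thesis by (simp add: \<epsilon>_def power2_eq_square mult_ac)
    qed
    have "(\<kappa> / 4 - c0 * \<delta> * n * \<epsilon>\<^sup>2) * (norm v)\<^sup>2 \<le> blinfun_apply (blinfun_apply (hess J (\<Phi> p)) v) v"
      unfolding \<kappa>_def n_def
      by (rule sp.hess_coercive_near_fast_space[OF v near C4[OF p] _ \<epsilon>])
         (use small(2) in \<open>simp add: \<epsilon>_def mult_ac\<close>)
    moreover have "\<kappa> / 8 * (norm v)\<^sup>2 \<le> (\<kappa> / 4 - c0 * \<delta> * n * \<epsilon>\<^sup>2) * (norm v)\<^sup>2"
      using small(3) unfolding \<epsilon>_def[symmetric] n_def[symmetric] \<kappa>_def[symmetric]
      by (intro mult_right_mono) auto
    ultimately show ?thesis by linarith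
  qed
  have "energy_projection \<iota> X0 J \<Phi> P Q u0 \<pi> \<eta> c1 (b\<^sup>2 * (C0 * \<delta>)) (b\<^sup>2 * C) (\<kappa> / 16) (r + 1)"
    unfolding energy_projection_def Let_def
  proof (intro conjI ballI)
    show "0 < \<eta>" using s b by (simp add: \<eta>_def)
    show "0 < c1" using b n pos by (simp add: c1_def add_pos_pos)
    show "0 < b\<^sup>2 * (C0 * \<delta>)" "0 < b\<^sup>2 * C" "0 < \<kappa> / 16" "2 < r + 1" using b pos \<kappa> by auto
    show "\<And>u. u \<in> affine_nbhd \<iota> X0 u0 (\<Phi> ` P) \<eta> \<Longrightarrow> \<pi> u \<in> Q" by (rule \<pi>(1))
    show "\<And>u. u \<in> affine_nbhd \<iota> X0 u0 (\<Phi> ` P) \<eta> \<Longrightarrow> norm (u - \<Phi> (\<pi> u)) \<le> c1 * infdist u (\<Phi> ` P)" by (rule \<pi>(2))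
    show "\<Phi> (\<pi> \<phi>) = \<phi>" if \<phi>: "\<phi> \<in> \<Phi> ` P" for \<phi>
    proof -
      have "\<phi> \<in> affine_nbhd \<iota> X0 u0 (\<Phi> ` P) \<eta>"
        using \<phi> inQ affine \<open>0 < \<eta>\<close> by (auto simp: affine_nbhd_def)
      from \<pi>(2)[OF this] show ?thesis using \<phi> by simp
    qed
    define NE where "NE \<phi> v = J (\<phi> + v) - J \<phi> - blinfun_apply (grad J \<phi>) v
        - 1/2 * blinfun_apply (blinfun_apply (hess J \<phi>) v) v" for \<phi> v
    show "\<exists>NE. \<forall>u\<in>affine_nbhd \<iota> X0 u0 (\<Phi> ` P) \<eta>.
          J u = J (\<Phi> (\<pi> u)) + blinfun_apply (grad J (\<Phi> (\<pi> u))) (u - \<Phi> (\<pi> u))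
                + 1/2 * blinfun_apply (blinfun_apply (hess J (\<Phi> (\<pi> u))) (u - \<Phi> (\<pi> u))) (u - \<Phi> (\<pi> u))
                + NE (\<Phi> (\<pi> u)) (u - \<Phi> (\<pi> u)) \<and>
          \<bar>blinfun_apply (grad J (\<Phi> (\<pi> u))) (u - \<Phi> (\<pi> u))\<bar> \<le> b\<^sup>2 * (C0 * \<delta>) * norm (u - \<Phi> (\<pi> u)) \<and>
          \<kappa> / 16 * (norm (u - \<Phi> (\<pi> u)))\<^sup>2
            \<le> 1/2 * blinfun_apply (blinfun_apply (hess J (\<Phi> (\<pi> u))) (u - \<Phi> (\<pi> u))) (u - \<Phi> (\<pi> u)) \<and>
          \<bar>NE (\<Phi> (\<pi> u)) (u - \<Phi> (\<pi> u))\<bar> \<le> b\<^sup>2 * C * norm (u - \<Phi> (\<pi> u)) powr (r + 1)"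
    proof (intro exI[of _ NE] ballI)
      fix u assume u: "u \<in> affine_nbhd \<iota> X0 u0 (\<Phi> ` P) \<eta>"
      define v where "v = u - \<Phi> (\<pi> u)"
      note pQ = \<pi>(1)[OF u]
      have "blinfun_apply \<iota> (u - u0) \<in> X0" "blinfun_apply \<iota> (\<Phi> (\<pi> u) - u0) \<in> X0"
        using u affine pQ by (auto simp: affine_nbhd_def in_affine_def)
      then have "blinfun_apply \<iota> (u - u0) - blinfun_apply \<iota> (\<Phi> (\<pi> u) - u0) \<in> X0"
        using subspace_X0 subspace_diff by blast
      then have v: "v \<in> phase_tangent \<iota> X0" by (simp add: phase_tangent_def v_def blinfun.diff_right)
      obtain R where R': "rhs \<iota> X0 J (\<Phi> (\<pi> u)) = to_dual \<iota> (blinfun_apply \<iota> R)" "norm R \<le> C0 * \<delta>"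
        using R[OF pQ] by blast
      have "J u = J (\<Phi> (\<pi> u)) + blinfun_apply (grad J (\<Phi> (\<pi> u))) v
                + 1/2 * blinfun_apply (blinfun_apply (hess J (\<Phi> (\<pi> u))) v) v + NE (\<Phi> (\<pi> u)) v"
        by (simp add: NE_def v_def)
      moreover have "\<bar>blinfun_apply (grad J (\<Phi> (\<pi> u))) v\<bar> \<le> b\<^sup>2 * (C0 * \<delta>) * norm v"
        by (rule grad_bound[OF b(2) R' v])
      moreover have "\<kappa> / 16 * (norm v)\<^sup>2 \<le> 1/2 * blinfun_apply (blinfun_apply (hess J (\<Phi> (\<pi> u))) v) v"
        using hess[OF pQ v] \<pi>(3)[OF u] unfolding v_def by simp
      moreover have "\<bar>NE (\<Phi> (\<pi> u)) v\<bar> \<le> b\<^sup>2 * C * norm v powr (r + 1)"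
        unfolding NE_def
        by (rule energy_taylor[OF J b(2) pos(2) less_imp_le[OF pos(1)] N[OF pQ] v])
      ultimately show "J u = J (\<Phi> (\<pi> u)) + blinfun_apply (grad J (\<Phi> (\<pi> u))) (u - \<Phi> (\<pi> u))
                + 1/2 * blinfun_apply (blinfun_apply (hess J (\<Phi> (\<pi> u))) (u - \<Phi> (\<pi> u))) (u - \<Phi> (\<pi> u))
                + NE (\<Phi> (\<pi> u)) (u - \<Phi> (\<pi> u)) \<and>
          \<bar>blinfun_apply (grad J (\<Phi> (\<pi> u))) (u - \<Phi> (\<pi> u))\<bar> \<le> b\<^sup>2 * (C0 * \<delta>) * norm (u - \<Phi> (\<pi> u)) \<and>
          \<kappa> / 16 * (norm (u - \<Phi> (\<pi> u)))\<^sup>2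
            \<le> 1/2 * blinfun_apply (blinfun_apply (hess J (\<Phi> (\<pi> u))) (u - \<Phi> (\<pi> u))) (u - \<Phi> (\<pi> u)) \<and>
          \<bar>NE (\<Phi> (\<pi> u)) (u - \<Phi> (\<pi> u))\<bar> \<le> b\<^sup>2 * C * norm (u - \<Phi> (\<pi> u)) powr (r + 1)"
        unfolding v_def by (intro conjI)
    qed
  qed
  then show ?thesis by blast
qed

end

section \<open>Trapping of the flow\<close>

text \<open>The bound is the larger root of the quadratic polynomial.\<close>

lemma quadratic_bound_imp_le_eta_lower:
  assumes \<mu>2: "0 < \<mu>2" and D: "0 \<le> \<delta>0 + \<delta>1"
    and q: "\<mu>2 / 2 * x\<^sup>2 - \<delta>2 * x \<le> \<delta>0 + \<delta>1"
  shows "x \<le> eta_lower \<delta>2 \<mu>2 \<delta>0 \<delta>1"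
proof -
  have "(x - \<delta>2 / \<mu>2)\<^sup>2 = 2 / \<mu>2 * (\<mu>2 / 2 * x\<^sup>2 - \<delta>2 * x) + \<delta>2\<^sup>2 / \<mu>2\<^sup>2"
    using \<mu>2 by (simp add: power2_eq_square field_simps)
  also have "\<dots> \<le> 2 / \<mu>2 * (\<delta>0 + \<delta>1) + \<delta>2\<^sup>2 / \<mu>2\<^sup>2"
    using \<mu>2 q by (intro add_right_mono mult_left_mono) auto
  finally have "x - \<delta>2 / \<mu>2 \<le> sqrt (\<delta>2\<^sup>2 / \<mu>2\<^sup>2 + 2 * ((\<delta>0 + \<delta>1) / \<mu>2))"
    by (intro real_le_rsqrt) (simp add: algebra_simps)
  then show ?thesis by (simp add: eta_lower_def)
qed

text \<open>The second entry of \<open>eta_upper\<close> is the distance up to which the remainder of the energy expansion is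
at most half of the quadratic term.\<close>

lemma remainder_absorbed:
  assumes pos: "0 < c1" "0 < c2" "0 < \<mu>2" "2 < \<rho>" and x: "0 \<le> x" "x \<le> c1 * d"
    and d: "d < eta_upper \<eta> c1 c2 \<mu>2 \<rho>"
  shows "c2 * x powr \<rho> \<le> \<mu>2 / 2 * x\<^sup>2"
proof (cases "x = 0")
  case False
  then have x0: "0 < x" using x by simp
  define K where "K = (\<mu>2 / (2 * c2)) powr (1 / (\<rho> - 2))"
  have "c1 * d < c1 * (1 / c1 * K)"
    using d pos by (intro mult_strict_left_mono) (auto simp: eta_upper_def K_def)
  then have "x \<le> K" using x pos by simp
  then have "x powr (\<rho> - 2) \<le> K powr (\<rho> - 2)" using x pos by (intro powr_mono2) auto
  also have "K powr (\<rho> - 2) = \<mu>2 / (2 * c2)" using pos by (simp add: K_def powr_powr)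
  finally have le: "x powr (\<rho> - 2) \<le> \<mu>2 / (2 * c2)" .
  have "c2 * x powr \<rho> = c2 * x powr (\<rho> - 2) * x\<^sup>2"
    using x0 powr_add[of x "\<rho> - 2" 2] by (simp add: powr_numeral)
  also have "\<dots> \<le> c2 * (\<mu>2 / (2 * c2)) * x\<^sup>2"
    using le pos by (intro mult_right_mono mult_left_mono) auto
  also have "\<dots> = \<mu>2 / 2 * x\<^sup>2" using pos by simp
  finally show ?thesis .
qed simp

text \<open>Gradients take values in \<open>X\<^sub>0\<close>, so the pairing of the solution with any vector of \<open>X\<^sub>0\<^sup>\<bottom>\<close> is
constant in time.\<close>

lemma flow_stays_in_affine_space:
  fixes \<iota> :: "'h::{real_inner,complete_space} \<Rightarrow>\<^sub>L 'x::{real_inner,complete_space}"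
  assumes X0: "subspace X0" "closed X0" and G: "G \<in> gradients \<iota> X0"
    and u: "flow_solution \<iota> J G u0 T u" and t: "0 \<le> t" "ereal t < T"
  shows "u t \<in> in_affine \<iota> X0 u0"
proof -
  have less_T: "ereal s < T" if "s \<le> t" for s
    using that t(2) by (meson ereal_less_eq(3) le_less_trans)
  have cont: "continuous_on {0..t} u"
    using u less_T unfolding flow_solution_def by (auto intro: continuous_on_subset)
  have "blinfun_apply \<iota> (u t - u0) \<bullet> z = 0" if z: "z \<in> orthogonal_comp X0" for z
  proof (cases "t = 0")
    case True
    then show ?thesis using u by (simp add: flow_solution_def blinfun.zero_right)
  next
    case False
    have "blinfun_apply \<iota> (u t - u0) \<bullet> z = blinfun_apply \<iota> (u 0 - u0) \<bullet> z"
    proof (rule DERIV_isconst_end[where f = "\<lambda>s. blinfun_apply \<iota> (u s - u0) \<bullet> z" and a = 0])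
      show "0 < t" using False t by simp
      show "continuous_on {0..t} (\<lambda>s. blinfun_apply \<iota> (u s - u0) \<bullet> z)"
        by (intro continuous_intros cont)
      fix s assume s: "0 < s" "s < t"
      obtain u' g where u': "(u has_vector_derivative u') (at s)" "(g, - blinfun_apply \<iota> u') \<in> G"
        using u s less_T[of s] unfolding flow_solution_def by auto
      have "- blinfun_apply \<iota> u' \<in> X0" using G u'(2) unfolding gradients_def by auto
      then have "(- blinfun_apply \<iota> u') \<bullet> z = 0"
        using z by (simp only: orthogonal_comp_def orthogonal_def mem_Collect_eq)
      then have 0: "blinfun_apply \<iota> u' \<bullet> z = 0" by simp
      have "((\<lambda>s. blinfun_apply \<iota> (u s - u0) \<bullet> z) has_vector_derivative blinfun_apply \<iota> (u' - 0) \<bullet> z) (at s)"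
        by (rule bounded_linear.has_vector_derivative[OF bounded_linear_compose[OF bounded_linear_inner_left blinfun.bounded_linear_right]])
           (intro has_vector_derivative_diff has_vector_derivative_const u'(1))
      then show "((\<lambda>s. blinfun_apply \<iota> (u s - u0) \<bullet> z) has_real_derivative 0) (at s)"
        by (simp add: has_real_derivative_iff_has_vector_derivative 0)
    qed
    then show ?thesis using u by (simp add: flow_solution_def blinfun.zero_right)
  qed
  then show ?thesis unfolding in_affine_def using mem_double_orthogonal[OF X0] by blast
qed

text \<open>The derivative of the energy is \<open>- \<langle>G g, g\<rangle>\<close> with \<open>g\<close> the gradient of \<open>J\<close>.\<close>

lemma energy_decreases_along_flow:
  fixes \<iota> :: "'h::{real_inner,complete_space} \<Rightarrow>\<^sub>L 'x::{real_inner,complete_space}"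
  assumes J: "smooth_on UNIV J" and G: "G \<in> gradients \<iota> X0"
    and u: "flow_solution \<iota> J G u0 T u" and t: "0 \<le> t" "ereal t < T"
  shows "J (u t) \<le> J u0"
proof -
  have less_T: "ereal s < T" if "s \<le> t" for s
    using that t(2) by (meson ereal_less_eq(3) le_less_trans)
  have cont: "continuous_on {0..t} u"
    using u less_T unfolding flow_solution_def by (auto intro: continuous_on_subset)
  have "J (u t) \<le> J (u 0)"
  proof (rule DERIV_nonpos_imp_decreasing_open[OF t(1), where f = "\<lambda>s. J (u s)"])
    show "continuous_on {0..t} (\<lambda>s. J (u s))"
      by (rule continuous_on_compose2[OF _ cont subset_UNIV])
         (meson J smooth_energy_grad has_derivative_continuous continuous_at_imp_continuous_on)
    fix s assume s: "0 < s" "s < t"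
    obtain u' g where u': "(u has_vector_derivative u') (at s)" "grad J (u s) = to_dual \<iota> g"
        "(g, - blinfun_apply \<iota> u') \<in> G"
      using u s less_T[of s] unfolding flow_solution_def by auto
    have "0 \<le> (- blinfun_apply \<iota> u') \<bullet> g" using G u'(3) unfolding gradients_def by auto
    then have "blinfun_apply (grad J (u s)) u' \<le> 0"
      by (simp add: u'(2) to_dual_def inner_commute)
    moreover have "((\<lambda>s. J (u s)) has_real_derivative blinfun_apply (grad J (u s)) u') (at s)"
      using has_derivative_compose[OF u'(1)[unfolded has_vector_derivative_def] smooth_energy_grad[OF J]]
      unfolding has_field_derivative_def
      by (rule has_derivative_eq_rhs) (simp add: fun_eq_iff blinfun.scaleR_right)
    ultimately show "\<exists>y. ((\<lambda>s. J (u s)) has_real_derivative y) (at s) \<and> y \<le> 0" by blast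
  qed
  then show ?thesis using u by (simp add: flow_solution_def)
qed

text \<open>The energy of the foot point differs by at most \<open>\<delta>0\<close> from the supremum over the manifold, so the energy
excess of \<open>u\<close> over its foot point is at most \<open>\<delta>0 + \<delta>1\<close>. Up to the linear term, the expansion
bounds the squared residual by this excess.\<close>

lemma residual_bound_of_energy:
  assumes proj: "energy_projection \<iota> X0 J \<Phi> P Q u0 \<pi> \<eta> c1 \<delta>2 c2 \<mu>2 \<rho>"
    and \<delta>: "0 < \<delta>0" "\<forall>u1\<in>\<Phi> ` P. \<forall>u2\<in>\<Phi> ` P. \<bar>J u1 - J u2\<bar> \<le> \<delta>0" "0 < \<delta>1"
    and u: "u \<in> in_affine \<iota> X0 u0" "J u \<le> (SUP \<phi>\<in>\<Phi> ` P. J \<phi>) + \<delta>1"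
      "infdist u (\<Phi> ` P) < eta_upper \<eta> c1 c2 \<mu>2 \<rho>" and p: "\<pi> u \<in> P"
  shows "norm (u - \<Phi> (\<pi> u)) \<le> eta_lower \<delta>2 \<mu>2 \<delta>0 \<delta>1"
    and "infdist u (\<Phi> ` P) \<le> eta_lower \<delta>2 \<mu>2 \<delta>0 \<delta>1"
proof -
  define v where "v = u - \<Phi> (\<pi> u)"
  have pos: "0 < c1" "0 < c2" "0 < \<mu>2" "2 < \<rho>" using proj by (auto simp: energy_projection_def)
  have nb: "u \<in> affine_nbhd \<iota> X0 u0 (\<Phi> ` P) \<eta>"
    using u by (auto simp: affine_nbhd_def eta_upper_def)
  obtain NE where NE: "J u = J (\<Phi> (\<pi> u)) + blinfun_apply (grad J (\<Phi> (\<pi> u))) v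
                + 1/2 * blinfun_apply (blinfun_apply (hess J (\<Phi> (\<pi> u))) v) v + NE"
    "\<bar>blinfun_apply (grad J (\<Phi> (\<pi> u))) v\<bar> \<le> \<delta>2 * norm v"
    "1/2 * blinfun_apply (blinfun_apply (hess J (\<Phi> (\<pi> u))) v) v \<ge> \<mu>2 * (norm v)\<^sup>2"
    "\<bar>NE\<bar> \<le> c2 * norm v powr \<rho>"
    using proj nb unfolding energy_projection_def Let_def v_def by blast
  have "norm v \<le> c1 * infdist u (\<Phi> ` P)"
    using proj nb unfolding energy_projection_def v_def by blast
  from remainder_absorbed[OF pos norm_ge_zero this u(3)]
  have "c2 * norm v powr \<rho> \<le> \<mu>2 / 2 * (norm v)\<^sup>2" .
  then have "\<mu>2 / 2 * (norm v)\<^sup>2 - \<delta>2 * norm v \<le> J u - J (\<Phi> (\<pi> u))"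
    using NE by (simp add: abs_le_iff)
  moreover have "(SUP \<phi>\<in>\<Phi> ` P. J \<phi>) \<le> J (\<Phi> (\<pi> u)) + \<delta>0"
  proof (rule cSUP_least)
    fix \<phi> assume "\<phi> \<in> \<Phi> ` P"
    then have "\<bar>J \<phi> - J (\<Phi> (\<pi> u))\<bar> \<le> \<delta>0" using \<delta>(2) p by blast
    then show "J \<phi> \<le> J (\<Phi> (\<pi> u)) + \<delta>0" by linarith
  qed (use p in auto)
  ultimately have "\<mu>2 / 2 * (norm v)\<^sup>2 - \<delta>2 * norm v \<le> \<delta>0 + \<delta>1" using u(2) by linarith
  then have le: "norm v \<le> eta_lower \<delta>2 \<mu>2 \<delta>0 \<delta>1"
    using quadratic_bound_imp_le_eta_lower pos \<delta> by simp
  then show "norm (u - \<Phi> (\<pi> u)) \<le> eta_lower \<delta>2 \<mu>2 \<delta>0 \<delta>1" by (simp add: v_def)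
  have "infdist u (\<Phi> ` P) \<le> dist u (\<Phi> (\<pi> u))" using p by (intro infdist_le) auto
  then show "infdist u (\<Phi> ` P) \<le> eta_lower \<delta>2 \<mu>2 \<delta>0 \<delta>1" using le by (simp add: v_def dist_norm)
qed

text \<open>A continuity argument. Whenever the distance to the manifold is below \<open>eta_upper\<close> it is at most
\<open>eta_lower\<close>; by the intermediate value theorem it cannot cross the gap between the two.\<close>

lemma flow_trapped:
  fixes \<iota> :: "'h::{real_inner,complete_space} \<Rightarrow>\<^sub>L 'x::{real_inner,complete_space}"
  assumes X0: "subspace X0" "closed X0" and J: "smooth_on UNIV J"
    and proj: "energy_projection \<iota> X0 J \<Phi> P Q u0 \<pi> \<eta> c1 \<delta>2 c2 \<mu>2 \<rho>"
    and \<delta>: "0 < \<delta>0" "\<forall>u1\<in>\<Phi> ` P. \<forall>u2\<in>\<Phi> ` P. \<bar>J u1 - J u2\<bar> \<le> \<delta>0" "0 < \<delta>1"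
    and J0: "J u0 \<le> (SUP \<phi>\<in>\<Phi> ` P. J \<phi>) + \<delta>1"
    and near: "infdist u0 (\<Phi> ` P) < eta_upper \<eta> c1 c2 \<mu>2 \<rho>"
    and gap: "eta_lower \<delta>2 \<mu>2 \<delta>0 \<delta>1 < eta_upper \<eta> c1 c2 \<mu>2 \<rho>"
    and G: "G \<in> gradients \<iota> X0" and u: "flow_solution \<iota> J G u0 T u"
    and t: "0 < t" "ereal t < T" "ereal t < exit_time \<pi> P (\<Phi> ` P) \<eta> T u"
  shows "infdist (u t) (\<Phi> ` P) < \<eta>" "\<pi> (u t) \<in> P"
    "norm (u t - \<Phi> (\<pi> (u t))) \<le> eta_lower \<delta>2 \<mu>2 \<delta>0 \<delta>1"
proof -
  define E where "E = eta_upper \<eta> c1 c2 \<mu>2 \<rho>"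
  define L where "L = eta_lower \<delta>2 \<mu>2 \<delta>0 \<delta>1"
  define d where "d s = infdist (u s) (\<Phi> ` P)" for s
  have E\<eta>: "E \<le> \<eta>" by (simp add: E_def eta_upper_def)
  have less_T: "ereal s < T" if "s \<le> t" for s
    using that t(2) by (meson ereal_less_eq(3) le_less_trans)
  have cont: "continuous_on {0..t} d"
    using u less_T unfolding flow_solution_def d_def
    by (intro continuous_intros) (auto intro: continuous_on_subset)
  have inP: "\<pi> (u s) \<in> P" if s: "0 \<le> s" "s \<le> t" "d s < \<eta>" for s
  proof (rule ccontr)
    assume "\<pi> (u s) \<notin> P"
    then have "exit_time \<pi> P (\<Phi> ` P) \<eta> T u \<le> ereal s"
      unfolding exit_time_def using s less_T[of s] by (intro Inf_lower) (auto simp: d_def)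
    also have "\<dots> \<le> ereal t" using s by simp
    finally show False using t(3) by simp
  qed
  have step: "d s \<le> L \<and> norm (u s - \<Phi> (\<pi> (u s))) \<le> L" if s: "0 \<le> s" "s \<le> t" "d s < E" for s
  proof -
    have "J (u s) \<le> (SUP \<phi>\<in>\<Phi> ` P. J \<phi>) + \<delta>1"
      using energy_decreases_along_flow[OF J G u s(1) less_T[OF s(2)]] J0 by linarith
    note R = residual_bound_of_energy[OF proj \<delta> flow_stays_in_affine_space[OF X0 G u s(1) less_T[OF s(2)]] this
        s(3)[unfolded d_def E_def] inP[OF s(1,2) less_le_trans[OF s(3) E\<eta>]]]
    show ?thesis using R unfolding d_def L_def by (rule conjI[rotated])
  qed
  have "d t < E"
  proof (rule ccontr)
    assume "\<not> d t < E"
    moreover have "d 0 < E" using near u by (simp add: d_def E_def flow_solution_def)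
    ultimately have "d 0 \<le> (L + E) / 2" "(L + E) / 2 \<le> d t"
      using step[of 0] t(1) gap by (auto simp: E_def L_def)
    from IVT'[of d 0 _ t, OF this _ cont] t(1)
    obtain s where "0 \<le> s" "s \<le> t" "d s = (L + E) / 2" by auto
    then show False using step[of s] gap by (simp add: E_def L_def)
  qed
  then show "infdist (u t) (\<Phi> ` P) < \<eta>" "\<pi> (u t) \<in> P"
    "norm (u t - \<Phi> (\<pi> (u t))) \<le> eta_lower \<delta>2 \<mu>2 \<delta>0 \<delta>1"
    using step[of t] inP[of t] E\<eta> t(1) by (auto simp: d_def L_def)
qed

theorem theorem2p4:
  fixes \<iota> :: "'h::{real_inner,complete_space} \<Rightarrow>\<^sub>L 'x::{real_inner,complete_space}"
    and X0 :: "'x set"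
    and C r C0 c0 ks C2 C3 C4 \<mu>e \<gamma>e m :: real
  assumes "gelfand_triple \<iota>" and "constraint_space \<iota> X0"
    and "0 < C" and "1 < r"
    and "0 < C0" and "0 < c0" and "0 < ks" and "0 < C2" and "0 < C3" and "0 < C4"
    and "0 < \<mu>e" and "0 < \<gamma>e" and "0 < m"
  shows "\<exists>\<delta>s>0. \<forall>(\<delta>::real) (J::'h \<Rightarrow> real) (\<Phi>::real^'n \<Rightarrow> 'h) P Q (u0::'h).
    0 < \<delta> \<and> \<delta> < \<delta>s \<and> smooth_on UNIV J \<and> param_manifold \<Phi> P Q m \<and>
    spectral_hyps \<iota> X0 J \<Phi> Q \<delta> C r C0 c0 ks C2 C3 C4 \<and>
    \<Phi> ` Q \<subseteq> in_affine \<iota> X0 u0 \<and>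
    energy_coercive \<iota> X0 J (\<Phi> ` Q) \<mu>e \<gamma>e
    \<longrightarrow>
    (\<exists>\<pi> \<eta> c1 \<delta>2 c2 \<mu>2 \<rho>. energy_projection \<iota> X0 J \<Phi> P Q u0 \<pi> \<eta> c1 \<delta>2 c2 \<mu>2 \<rho>) \<and>
    (\<forall>\<pi> \<eta> c1 \<delta>2 c2 \<mu>2 \<rho> \<delta>0 \<delta>1.
       energy_projection \<iota> X0 J \<Phi> P Q u0 \<pi> \<eta> c1 \<delta>2 c2 \<mu>2 \<rho> \<and>
       0 < \<delta>0 \<and> (\<forall>u1\<in>\<Phi> ` P. \<forall>u2\<in>\<Phi> ` P. \<bar>J u1 - J u2\<bar> \<le> \<delta>0) \<and>
       0 < \<delta>1 \<and> J u0 \<le> (SUP \<phi>\<in>\<Phi> ` P. J \<phi>) + \<delta>1 \<and>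
       infdist u0 (\<Phi> ` P) < eta_upper \<eta> c1 c2 \<mu>2 \<rho> \<and>
       eta_lower \<delta>2 \<mu>2 \<delta>0 \<delta>1 < eta_upper \<eta> c1 c2 \<mu>2 \<rho>
       \<longrightarrow>
       (\<forall>G\<in>gradients \<iota> X0. \<forall>T u. flow_solution \<iota> J G u0 T u \<longrightarrow>
          (\<exists>p w. (\<forall>t. p t = \<pi> (u t)) \<and>
             (\<forall>t. 0 < t \<and> ereal t < T \<and> ereal t < exit_time \<pi> P (\<Phi> ` P) \<eta> T u \<longrightarrow>
                infdist (u t) (\<Phi> ` P) < \<eta> \<and> p t \<in> P \<and>
                u t = \<Phi> (p t) + w t \<and> norm (w t) \<le> eta_lower \<delta>2 \<mu>2 \<delta>0 \<delta>1))))"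
proof -
  interpret constrained_triple \<iota> X0 by unfold_locales (use assms in auto)
  define b where "b = norm \<iota> + 1"
  define n where "n = real CARD('n)"
  define \<kappa> where "\<kappa> = \<mu>e * ks / (ks + \<gamma>e)"
  define K1 where "K1 = 4 * b * n * C3"
  define K2 where "K2 = 2 * n * b\<^sup>2 * C3 * C4"
  define K3 where "K3 = 8 * c0 * n * (b\<^sup>2 * C3)\<^sup>2"
  \<comment> \<open>\<open>K1\<close>, \<open>K2\<close> and \<open>K3\<close> come from the three smallness conditions; since \<open>\<delta> \<le> 1\<close>, the cubic condition may be replaced by a linear one\<close>
  define \<delta>s where "\<delta>s = min (min 1 (\<kappa> / K3)) (min (1 / K1) (1 / K2))"
  have b: "1 \<le> b" "norm \<iota> \<le> b" and n: "0 < n" by (auto simp: b_def n_def)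
  have \<kappa>: "0 < \<kappa>" using assms by (simp add: \<kappa>_def)
  have K: "0 < K1" "0 < K2" "0 < K3" using assms b n by (auto simp: K1_def K2_def K3_def)
  have \<delta>s: "0 < \<delta>s" using \<kappa> K by (simp add: \<delta>s_def)
  have small: "K1 * \<delta> \<le> 1" "K2 * \<delta> \<le> 1" "K3 * \<delta> * \<delta>\<^sup>2 \<le> \<kappa>" if \<delta>: "0 < \<delta>" "\<delta> < \<delta>s" for \<delta>
  proof -
    have le: "\<delta> \<le> 1" "\<delta> \<le> \<kappa> / K3" "\<delta> \<le> 1 / K1" "\<delta> \<le> 1 / K2" using \<delta> by (auto simp: \<delta>s_def)
    show "K1 * \<delta> \<le> 1" "K2 * \<delta> \<le> 1" using le K by (simp_all add: pos_le_divide_eq mult.commute)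
    have "\<delta>\<^sup>2 \<le> 1" using \<delta> le by (simp add: power_le_one)
    then have "K3 * \<delta> * \<delta>\<^sup>2 \<le> K3 * \<delta> * 1" using K \<delta> by (intro mult_left_mono) auto
    also have "\<dots> \<le> \<kappa>" using le K by (simp add: pos_le_divide_eq mult.commute)
    finally show "K3 * \<delta> * \<delta>\<^sup>2 \<le> \<kappa>" .
  qed
  show ?thesis
  proof (rule exI[of _ \<delta>s], intro conjI allI impI ballI)
    show "0 < \<delta>s" by (rule \<delta>s)
    fix \<delta> :: real and J :: "'h \<Rightarrow> real" and \<Phi> :: "real^'n \<Rightarrow> 'h" and P Q u0
    assume A: "0 < \<delta> \<and> \<delta> < \<delta>s \<and> smooth_on UNIV J \<and> param_manifold \<Phi> P Q m \<and>
      spectral_hyps \<iota> X0 J \<Phi> Q \<delta> C r C0 c0 ks C2 C3 C4 \<and>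
      \<Phi> ` Q \<subseteq> in_affine \<iota> X0 u0 \<and> energy_coercive \<iota> X0 J (\<Phi> ` Q) \<mu>e \<gamma>e"
    then have \<delta>: "0 < \<delta>" "\<delta> < \<delta>s" and J: "smooth_on UNIV J" by auto
    show "\<exists>\<pi> \<eta> c1 \<delta>2 c2 \<mu>2 \<rho>. energy_projection \<iota> X0 J \<Phi> P Q u0 \<pi> \<eta> c1 \<delta>2 c2 \<mu>2 \<rho>"
    proof (rule energy_projection_exists[where b = b and m = m and C = C and r = r and ?C0.0 = C0 and ?C2.0 = C2])
      show "4 * b * real CARD('n) * C3 * \<delta> \<le> 1" using small(1)[OF \<delta>] by (simp add: K1_def n_def)
      show "2 * real CARD('n) * b\<^sup>2 * C3 * C4 * \<delta> \<le> 1" using small(2)[OF \<delta>] by (simp add: K2_def n_def)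
      have "8 * (c0 * \<delta>) * real CARD('n) * (b\<^sup>2 * C3 * \<delta>)\<^sup>2 = K3 * \<delta> * \<delta>\<^sup>2"
        by (simp add: K3_def n_def power_mult_distrib)
      with small(3)[OF \<delta>] show "8 * (c0 * \<delta>) * real CARD('n) * (b\<^sup>2 * C3 * \<delta>)\<^sup>2 \<le> \<mu>e * ks / (ks + \<gamma>e)"
        by (simp only: \<kappa>_def)
    qed (use A assms b in auto)
    fix \<pi> \<eta> c1 \<delta>2 c2 \<mu>2 \<rho> \<delta>0 \<delta>1 G T u
    assume B: "energy_projection \<iota> X0 J \<Phi> P Q u0 \<pi> \<eta> c1 \<delta>2 c2 \<mu>2 \<rho> \<and>
       0 < \<delta>0 \<and> (\<forall>u1\<in>\<Phi> ` P. \<forall>u2\<in>\<Phi> ` P. \<bar>J u1 - J u2\<bar> \<le> \<delta>0) \<and>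
       0 < \<delta>1 \<and> J u0 \<le> (SUP \<phi>\<in>\<Phi> ` P. J \<phi>) + \<delta>1 \<and>
       infdist u0 (\<Phi> ` P) < eta_upper \<eta> c1 c2 \<mu>2 \<rho> \<and>
       eta_lower \<delta>2 \<mu>2 \<delta>0 \<delta>1 < eta_upper \<eta> c1 c2 \<mu>2 \<rho>"
      and G: "G \<in> gradients \<iota> X0" and u: "flow_solution \<iota> J G u0 T u"
    show "\<exists>p w. (\<forall>t. p t = \<pi> (u t)) \<and>
             (\<forall>t. 0 < t \<and> ereal t < T \<and> ereal t < exit_time \<pi> P (\<Phi> ` P) \<eta> T u \<longrightarrow>
                infdist (u t) (\<Phi> ` P) < \<eta> \<and> p t \<in> P \<and>
                u t = \<Phi> (p t) + w t \<and> norm (w t) \<le> eta_lower \<delta>2 \<mu>2 \<delta>0 \<delta>1)"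
    proof (intro exI[of _ "\<lambda>t. \<pi> (u t)"] exI[of _ "\<lambda>t. u t - \<Phi> (\<pi> (u t))"] conjI allI impI)
      fix t assume t: "0 < t \<and> ereal t < T \<and> ereal t < exit_time \<pi> P (\<Phi> ` P) \<eta> T u"
      note trapped = flow_trapped[OF subspace_X0 closed_X0 J _ _ _ _ _ _ _ G u,
          of \<Phi> P Q \<pi> \<eta> c1 \<delta>2 c2 \<mu>2 \<rho> \<delta>0 \<delta>1 t]
      show "infdist (u t) (\<Phi> ` P) < \<eta>" using B t by (intro trapped(1)) simp_all
      show "\<pi> (u t) \<in> P" using B t by (intro trapped(2)) simp_all
      show "norm (u t - \<Phi> (\<pi> (u t))) \<le> eta_lower \<delta>2 \<mu>2 \<delta>0 \<delta>1"
        using B t by (intro trapped(3)) simp_all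
    qed simp_all
  qed
qed

end
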